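(* The base interpretation of the $\mathcal I^{\mathrm{cp}}$-interpretation (canonical upon the precise interpretation) is a sound type-informative base interpretation of $\mathrm{HA}^\omega$.
   Context: $\mathrm{HA}^\omega$: intuitionistic theory with finite types generated by $\sigma\to\tau$ from ground types $\mathbb N$, $\mathbb B$; constants: combinators $\Pi,\Sigma$, zero $0^{\mathbb N}$, successor $\mathsf S^{\mathbb N\to\mathbb N}$, recursors $\mathsf R_\sigma:\mathbb N\to\sigma\to(\mathbb N\to\sigma\to\sigma)\to\sigma$ (simultaneous recursion allowed), Booleans $0^{\mathbb B},1^{\mathbb B}$, conditionals $\mathrm{Cond}_\sigma:\mathbb B\to\sigma\to\sigma\to\sigma$; relation symbols: only logical equality $\equiv_\sigma$ at every type. Formulas use $\bot,\wedge,\to,\forall x^\sigma,\exists x^\sigma$; $A\vee B$ abbreviates $\exists i^{\mathbb B}((i\equiv0\to A)\wedge(i\equiv1\to B))$. Axioms: equality and combinator axioms ($\Pi xy\equiv x$, $\Sigma xyz\equiv xz(yz)$); $\mathsf S$ injective, $0\notin\mathrm{range}(\mathsf S)$; $\mathsf R0wf\equiv w$, $\mathsf R(\mathsf Sn)wf\equiv fn(\mathsf Rnwf)$; $\neg(0\equiv_{\mathbb B}1)$; $D(0)\wedge D(1)\to\forall i^{\mathbb B}D(i)$ for all formulas $D$; $\mathrm{Cond}(0,x,y)\equiv x$, $\mathrm{Cond}(1,x,y)\equiv y$; induction for all formulas. Target language: the language of $\mathrm{HA}^\omega$ with the extra type constructor $\sigma\mapsto\sigma^*$ (non-empty finite subsets)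 and constants for singleton, union, indexed union $\bigcup_{w\in t}qw$, membership, combinators, conditionals and recursors for all these types, and $\mathrm m:\mathbb N^*\to\mathbb N$ (maximum). $\mathcal S^\omega_*$ is the structure with $\mathcal S_{\mathbb N}=\mathbb N$, $\mathcal S_{\mathbb B}=\{0,1\}$, $\mathcal S_{\rho\to\sigma}$ all functions from $\mathcal S_\rho$ to $\mathcal S_\sigma$, $\mathcal S_{\sigma^*}$ all non-empty finite subsets of $\mathcal S_\sigma$. The target theory $T$ is the set of sentences true in $\mathcal S^\omega_*$. Witnessing types are the types of the target language (ground witnessing types $\mathbb N,\mathbb B$); witnessing terms are terms of such types. $\mathcal L^{\mathcal I}$ adds to the language of $\mathrm{HA}^\omega$ a unary predicate $\mathcal I_\sigma(x^\sigma)$ for each type. Boldface letters are (possibly empty) tuples, $\forall\boldsymbol b\in\boldsymbol B$ is componentwise. A base interpretation assigns to each $\mathcal I_\sigma$ tuples of witnessing types $\boldsymbol\tau_\sigma^+,\boldsymbol\tau_\sigma^-$ and a relation $\langle\mathcal I_\sigma(x)\rangle^{\boldsymbol a}_{\boldsymbol b}$ ($\boldsymbol a:\boldsymbol\tau_\sigma^+$, $\boldsymbol b:\boldsymbol\tau_\sigma^-$); always $\langle x\equiv_\sigma y\rangle$ is $x=y$. $\mathcal U$-interpretation: $\langle\bot\rangle:\equiv\bot$; $\langle A\wedge B\rangle^{\boldsymbol a,\boldsymbol c}_{\boldsymbol b,\boldsymbol d}:\equiv\langle A\rangle^{\boldsymbol a}_{\boldsymbol b}\wedge\langle B\rangle^{\boldsymbol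 c}_{\boldsymbol d}$; $\langle A\to B\rangle^{\boldsymbol f,\boldsymbol g}_{\boldsymbol a,\boldsymbol d}:\equiv\forall\boldsymbol b\in\boldsymbol g\boldsymbol a\boldsymbol d\,\langle A\rangle^{\boldsymbol a}_{\boldsymbol b}\to\langle B\rangle^{\boldsymbol f\boldsymbol a}_{\boldsymbol d}$; $\langle\forall xA\rangle^{\boldsymbol a}_{\boldsymbol b}:\equiv\forall x\langle A\rangle^{\boldsymbol a}_{\boldsymbol b}$; $\langle\exists xA\rangle^{\boldsymbol a}_{\boldsymbol B}:\equiv\exists x\forall\boldsymbol b\in\boldsymbol B\langle A\rangle^{\boldsymbol a}_{\boldsymbol b}$. $A(\boldsymbol x)$ is $\mathcal U$-interpretable if there are closed witnessing terms $\boldsymbol t$ with $T\vdash\forall\boldsymbol b\langle A(\boldsymbol x)\rangle^{\boldsymbol t}_{\boldsymbol b}$. $A^{\mathcal I}$ replaces $\forall x^\sigma(\dots)$ by $\forall x^\sigma(\mathcal I_\sigma(x)\to\dots)$ and $\exists x^\sigma(\dots)$ by $\exists x^\sigma(\mathcal I_\sigma(x)\wedge\dots)$. $A(\boldsymbol x)$ is $\mathcal I$-interpretable if $\forall\boldsymbol x(\mathcal I(\boldsymbol x)\to A^{\mathcal I}(\boldsymbol x))$ is $\mathcal U$-interpretable. The base interpretation is a sound type-informative base interpretation of $\mathrm{HA}^\omega$ if all $\mathcal I_\sigma(c)$ ($c^\sigma$ a constant of $\mathrm{HA}^\omega$) and all $\forall x^\sigma\forall f^{\sigma\to\tau}(\mathcal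 I_\sigma(x)\wedge\mathcal I_{\sigma\to\tau}(f)\to\mathcal I_\tau(fx))$ are $\mathcal U$-interpretable, and all non-logical axioms of $\mathrm{HA}^\omega$ are $\mathcal I$-interpretable. $\mathcal I^{\mathrm{cp}}$ is given by: $\langle\mathcal I_{\mathbb N}(x)\rangle^n$ is $x=n$ ($n:\mathbb N$, no negative witnesses); $\langle\mathcal I_{\mathbb B}(i)\rangle^j$ is $i=j$ ($j:\mathbb B$, no negative witnesses); and canonically at function types, $$\langle\mathcal I_{\rho\to\sigma}(h)\rangle^{\boldsymbol f,\boldsymbol g}_{\boldsymbol a,\boldsymbol d}:\equiv\forall x^\rho(\forall\boldsymbol b\in\boldsymbol g\boldsymbol a\boldsymbol d\,\langle\mathcal I_\rho(x)\rangle^{\boldsymbol a}_{\boldsymbol b}\to\langle\mathcal I_\sigma(hx)\rangle^{\boldsymbol f\boldsymbol a}_{\boldsymbol d}).$$ *)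

theory Defs
  imports Complex_Main "HOL-Library.FuncSet"
begin

section \<open>Syntax\<close>

text \<open>
  One raw syntax serves the target language, the language of $\mathrm{HA}^\omega$ (the fragment
  without starred types and without the predicates \<open>I\<close>) and the language
  $\mathcal L^{\mathcal I}$. Variables are de Bruijn indices; a context is the list of the types
  of the variables \<open>0, 1, \<dots>\<close>.
\<close>

datatype ty = NatT | BoolT | Fun ty ty (infixr "\<leadsto>" 65) | Star ty

primrec ha_ty :: "ty \<Rightarrow> bool" where
  "ha_ty NatT = True"
| "ha_ty BoolT = True"
| "ha_ty (\<rho> \<leadsto> \<sigma>) = (ha_ty \<rho> \<and> ha_ty \<sigma>)"
| "ha_ty (Star \<sigma>) = False"

definition funs :: "ty list \<Rightarrow> ty \<Rightarrow> ty" where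
  "funs \<sigma>s \<tau> = foldr Fun \<sigma>s \<tau>"

text \<open>
  \<open>RecC i [\<sigma>\<^sub>0, \<dots>, \<sigma>\<^sub>k]\<close> is the \<open>i\<close>-th simultaneous recursor for
  the tuple of types \<open>\<sigma>\<^sub>0, \<dots>, \<sigma>\<^sub>k\<close>; the plain recursor is
  \<open>RecC 0 [\<sigma>]\<close>. \<open>FalseC\<close> and \<open>TrueC\<close> are $0^{\mathbb B}$ and $1^{\mathbb B}$.
\<close>

datatype con =
    PiC ty ty | SigmaC ty ty ty
  | ZeroC | SuccC | RecC nat "ty list"
  | FalseC | TrueC | CondC ty
  | SingC ty | UnionC ty | IUnionC ty ty | MemC ty | MaxC

definition step_ty :: "ty list \<Rightarrow> ty \<Rightarrow> ty" where
  "step_ty \<sigma>s \<sigma> = NatT \<leadsto> funs \<sigma>s \<sigma>"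

primrec con_ty :: "con \<Rightarrow> ty" where
  "con_ty (PiC \<sigma> \<tau>) = \<sigma> \<leadsto> \<tau> \<leadsto> \<sigma>"
| "con_ty (SigmaC \<rho> \<sigma> \<tau>) = (\<rho> \<leadsto> \<sigma> \<leadsto> \<tau>) \<leadsto> (\<rho> \<leadsto> \<sigma>) \<leadsto> \<rho> \<leadsto> \<tau>"
| "con_ty ZeroC = NatT"
| "con_ty SuccC = NatT \<leadsto> NatT"
| "con_ty (RecC i \<sigma>s) = NatT \<leadsto> funs (\<sigma>s @ map (step_ty \<sigma>s) \<sigma>s) (\<sigma>s ! i)"
| "con_ty FalseC = BoolT"
| "con_ty TrueC = BoolT"
| "con_ty (CondC \<sigma>) = BoolT \<leadsto> \<sigma> \<leadsto> \<sigma> \<leadsto> \<sigma>"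
| "con_ty (SingC \<sigma>) = \<sigma> \<leadsto> Star \<sigma>"
| "con_ty (UnionC \<sigma>) = Star \<sigma> \<leadsto> Star \<sigma> \<leadsto> Star \<sigma>"
| "con_ty (IUnionC \<sigma> \<tau>) = Star \<sigma> \<leadsto> (\<sigma> \<leadsto> Star \<tau>) \<leadsto> Star \<tau>"
| "con_ty (MemC \<sigma>) = \<sigma> \<leadsto> Star \<sigma> \<leadsto> BoolT"
| "con_ty MaxC = Star NatT \<leadsto> NatT"

fun wf_con :: "con \<Rightarrow> bool" where
  "wf_con (RecC i \<sigma>s) = (i < length \<sigma>s)"
| "wf_con _ = True"

text \<open>
  A constant belongs to $\mathrm{HA}^\omega$ iff its type is star-free: every type parameter of a
  constant occurs in its type, and the types of the set constants all contain a star.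
\<close>

definition ha_con :: "con \<Rightarrow> bool" where
  "ha_con c \<longleftrightarrow> wf_con c \<and> ha_ty (con_ty c)"

datatype tm = Var nat | Con con | App tm tm

abbreviation apps :: "tm \<Rightarrow> tm list \<Rightarrow> tm" where
  "apps t ts \<equiv> foldl App t ts"

primrec has_ty :: "ty list \<Rightarrow> tm \<Rightarrow> ty \<Rightarrow> bool" where
  "has_ty \<Gamma> (Var n) \<sigma> = (n < length \<Gamma> \<and> \<sigma> = \<Gamma> ! n)"
| "has_ty \<Gamma> (Con c) \<sigma> = (wf_con c \<and> \<sigma> = con_ty c)"
| "has_ty \<Gamma> (App t u) \<sigma> = (\<exists>\<rho>. has_ty \<Gamma> t (\<rho> \<leadsto> \<sigma>) \<and> has_ty \<Gamma> u \<rho>)"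

primrec ha_tm :: "tm \<Rightarrow> bool" where
  "ha_tm (Var n) = True"
| "ha_tm (Con c) = ha_con c"
| "ha_tm (App t u) = (ha_tm t \<and> ha_tm u)"

text \<open>\<open>Pred \<sigma> t\<close> is $\mathcal I_\sigma(t)$; \<open>All\<close> and \<open>Ex\<close> bind variable \<open>0\<close>.\<close>

datatype fm =
    Bot | Eq ty tm tm | Pred ty tm
  | And fm fm | Imp fm fm | All ty fm | Ex ty fm

primrec wf_fm :: "ty list \<Rightarrow> fm \<Rightarrow> bool" where
  "wf_fm \<Gamma> Bot = True"
| "wf_fm \<Gamma> (Eq \<sigma> t u) = (has_ty \<Gamma> t \<sigma> \<and> has_ty \<Gamma> u \<sigma>)"
| "wf_fm \<Gamma> (Pred \<sigma> t) = has_ty \<Gamma> t \<sigma>"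
| "wf_fm \<Gamma> (And A B) = (wf_fm \<Gamma> A \<and> wf_fm \<Gamma> B)"
| "wf_fm \<Gamma> (Imp A B) = (wf_fm \<Gamma> A \<and> wf_fm \<Gamma> B)"
| "wf_fm \<Gamma> (All \<sigma> A) = wf_fm (\<sigma> # \<Gamma>) A"
| "wf_fm \<Gamma> (Ex \<sigma> A) = wf_fm (\<sigma> # \<Gamma>) A"

primrec pred_free :: "fm \<Rightarrow> bool" where
  "pred_free Bot = True"
| "pred_free (Eq \<sigma> t u) = True"
| "pred_free (Pred \<sigma> t) = False"
| "pred_free (And A B) = (pred_free A \<and> pred_free B)"
| "pred_free (Imp A B) = (pred_free A \<and> pred_free B)"
| "pred_free (All \<sigma> A) = pred_free A"
| "pred_free (Ex \<sigma> A) = pred_free A"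

primrec star_free :: "fm \<Rightarrow> bool" where
  "star_free Bot = True"
| "star_free (Eq \<sigma> t u) = (ha_ty \<sigma> \<and> ha_tm t \<and> ha_tm u)"
| "star_free (Pred \<sigma> t) = (ha_ty \<sigma> \<and> ha_tm t)"
| "star_free (And A B) = (star_free A \<and> star_free B)"
| "star_free (Imp A B) = (star_free A \<and> star_free B)"
| "star_free (All \<sigma> A) = (ha_ty \<sigma> \<and> star_free A)"
| "star_free (Ex \<sigma> A) = (ha_ty \<sigma> \<and> star_free A)"

definition target_fm :: "ty list \<Rightarrow> fm \<Rightarrow> bool" where
  "target_fm \<Gamma> A \<longleftrightarrow> wf_fm \<Gamma> A \<and> pred_free A"

definition ha_fm :: "ty list \<Rightarrow> fm \<Rightarrow> bool" where
  "ha_fm \<Gamma> A \<longleftrightarrow> wf_fm \<Gamma> A \<and> pred_free A \<and> star_free A \<and> (\<forall>\<sigma>\<in>set \<Gamma>. ha_ty \<sigma>)"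

primrec sub :: "(nat \<Rightarrow> tm) \<Rightarrow> tm \<Rightarrow> tm" where
  "sub s (Var n) = s n"
| "sub s (Con c) = Con c"
| "sub s (App t u) = App (sub s t) (sub s u)"

definition shift :: "nat \<Rightarrow> tm \<Rightarrow> tm" where
  "shift k t = sub (\<lambda>n. Var (n + k)) t"

definition up :: "(nat \<Rightarrow> tm) \<Rightarrow> nat \<Rightarrow> tm" where
  "up s = case_nat (Var 0) (\<lambda>n. shift 1 (s n))"

primrec fsub :: "(nat \<Rightarrow> tm) \<Rightarrow> fm \<Rightarrow> fm" where
  "fsub s Bot = Bot"
| "fsub s (Eq \<sigma> t u) = Eq \<sigma> (sub s t) (sub s u)"
| "fsub s (Pred \<sigma> t) = Pred \<sigma> (sub s t)"
| "fsub s (And A B) = And (fsub s A) (fsub s B)"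
| "fsub s (Imp A B) = Imp (fsub s A) (fsub s B)"
| "fsub s (All \<sigma> A) = All \<sigma> (fsub (up s) A)"
| "fsub s (Ex \<sigma> A) = Ex \<sigma> (fsub (up s) A)"

text \<open>\<open>close \<Gamma> A\<close> is the universal closure of a formula \<open>A\<close> in context \<open>\<Gamma>\<close>.\<close>

primrec close :: "ty list \<Rightarrow> fm \<Rightarrow> fm" where
  "close [] A = A"
| "close (\<sigma> # \<Gamma>) A = close \<Gamma> (All \<sigma> A)"


section \<open>The non-logical axioms of $\mathrm{HA}^\omega$\<close>

text \<open>
  \<open>ha_axiom \<Gamma> A\<close>: the open formula \<open>A\<close>, with free variables typed by \<open>\<Gamma>\<close>, is an axiom.
  In the schemata \<open>D\<close> is an arbitrary formula of $\mathrm{HA}^\omega$ with arbitrary parameters.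
\<close>

inductive ha_axiom :: "ty list \<Rightarrow> fm \<Rightarrow> bool" where
  eq_refl:
    "ha_ty \<sigma> \<Longrightarrow> ha_axiom [\<sigma>] (Eq \<sigma> (Var 0) (Var 0))"
| eq_subst: \<comment> \<open>\<open>x = y \<and> D(x) \<longrightarrow> D(y)\<close>, with \<open>x\<close>, \<open>y\<close> the variables 0 and 1\<close>
    "ha_fm (\<sigma> # \<Gamma>) D \<Longrightarrow>
     ha_axiom (\<sigma> # \<sigma> # \<Gamma>)
       (Imp (And (Eq \<sigma> (Var 0) (Var 1)) (fsub (case_nat (Var 0) (\<lambda>n. Var (n + 2))) D))
            (fsub (case_nat (Var 1) (\<lambda>n. Var (n + 2))) D))"
| pi:
    "ha_ty \<sigma> \<Longrightarrow> ha_ty \<tau> \<Longrightarrow>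
     ha_axiom [\<sigma>, \<tau>] (Eq \<sigma> (apps (Con (PiC \<sigma> \<tau>)) [Var 0, Var 1]) (Var 0))"
| sigma:
    "ha_ty \<rho> \<Longrightarrow> ha_ty \<sigma> \<Longrightarrow> ha_ty \<tau> \<Longrightarrow>
     ha_axiom [\<rho> \<leadsto> \<sigma> \<leadsto> \<tau>, \<rho> \<leadsto> \<sigma>, \<rho>]
       (Eq \<tau> (apps (Con (SigmaC \<rho> \<sigma> \<tau>)) [Var 0, Var 1, Var 2])
             (apps (Var 0) [Var 2, App (Var 1) (Var 2)]))"
| succ_inj:
    "ha_axiom [NatT, NatT]
       (Imp (Eq NatT (App (Con SuccC) (Var 0)) (App (Con SuccC) (Var 1)))
            (Eq NatT (Var 0) (Var 1)))"
| succ_not_zero: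
    "ha_axiom [NatT] (Imp (Eq NatT (App (Con SuccC) (Var 0)) (Con ZeroC)) Bot)"
| rec_zero: \<comment> \<open>the variables are \<open>w\<^sub>0, \<dots>, w\<^sub>k, f\<^sub>0, \<dots>, f\<^sub>k\<close>\<close>
    "i < length \<sigma>s \<Longrightarrow> \<forall>\<sigma>\<in>set \<sigma>s. ha_ty \<sigma> \<Longrightarrow>
     ha_axiom (\<sigma>s @ map (step_ty \<sigma>s) \<sigma>s)
       (Eq (\<sigma>s ! i)
           (apps (Con (RecC i \<sigma>s)) (Con ZeroC # map Var [0..<2 * length \<sigma>s]))
           (Var i))"
| rec_succ: \<comment> \<open>the variables are \<open>n, w\<^sub>0, \<dots>, w\<^sub>k, f\<^sub>0, \<dots>, f\<^sub>k\<close>\<close>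
    "i < length \<sigma>s \<Longrightarrow> \<forall>\<sigma>\<in>set \<sigma>s. ha_ty \<sigma> \<Longrightarrow>
     ws = map Var [1..<1 + 2 * length \<sigma>s] \<Longrightarrow>
     ha_axiom (NatT # \<sigma>s @ map (step_ty \<sigma>s) \<sigma>s)
       (Eq (\<sigma>s ! i)
           (apps (Con (RecC i \<sigma>s)) (App (Con SuccC) (Var 0) # ws))
           (apps (Var (1 + length \<sigma>s + i))
              (Var 0 # map (\<lambda>j. apps (Con (RecC j \<sigma>s)) (Var 0 # ws)) [0..<length \<sigma>s])))"
| bool_distinct:
    "ha_axiom [] (Imp (Eq BoolT (Con FalseC) (Con TrueC)) Bot)"
| bool_cases:
    "ha_fm (BoolT # \<Gamma>) D \<Longrightarrow>
     ha_axiom \<Gamma>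
       (Imp (And (fsub (case_nat (Con FalseC) Var) D) (fsub (case_nat (Con TrueC) Var) D))
            (All BoolT D))"
| cond_false:
    "ha_ty \<sigma> \<Longrightarrow>
     ha_axiom [\<sigma>, \<sigma>] (Eq \<sigma> (apps (Con (CondC \<sigma>)) [Con FalseC, Var 0, Var 1]) (Var 0))"
| cond_true:
    "ha_ty \<sigma> \<Longrightarrow>
     ha_axiom [\<sigma>, \<sigma>] (Eq \<sigma> (apps (Con (CondC \<sigma>)) [Con TrueC, Var 0, Var 1]) (Var 1))"
| induction:
    "ha_fm (NatT # \<Gamma>) D \<Longrightarrow>
     ha_axiom \<Gamma>
       (Imp (And (fsub (case_nat (Con ZeroC) Var) D)
                 (All NatT
                   (Imp D (fsub (case_nat (App (Con SuccC) (Var 0)) (\<lambda>n. Var (n + 1))) D))))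
            (All NatT D))"


section \<open>The structure $\mathcal S^\omega_*$ and the target theory\<close>

text \<open>
  No single HOL type can be proved to contain all finite types over \<open>\<nat>\<close> (their union has
  cardinality $\beth_\omega$), so $\mathcal S^\omega_*$ is given by a presentation: an arbitrary
  record over a universe \<open>'u\<close> that is isomorphic to the full set-theoretic structure, as
  expressed by \<open>is_S_omega_star\<close>. It is determined up to isomorphism. The carriers of
  different types need not be disjoint.
\<close>

record 'u struc =
  carr :: "ty \<Rightarrow> 'u set"
  num :: "nat \<Rightarrow> 'u"
  boo :: "bool \<Rightarrow> 'u"
  app :: "'u \<Rightarrow> 'u \<Rightarrow> 'u"
  elems :: "'u \<Rightarrow> 'u set"

definition is_S_omega_star :: "'u struc \<Rightarrow> bool" where
  "is_S_omega_star M \<longleftrightarrow>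
     bij_betw (num M) UNIV (carr M NatT) \<and>
     bij_betw (boo M) UNIV (carr M BoolT) \<and>
     (\<forall>\<rho> \<sigma>. bij_betw (\<lambda>h. restrict (app M h) (carr M \<rho>))
               (carr M (\<rho> \<leadsto> \<sigma>)) (carr M \<rho> \<rightarrow>\<^sub>E carr M \<sigma>)) \<and>
     (\<forall>\<sigma>. bij_betw (elems M) (carr M (Star \<sigma>))
            {X. X \<subseteq> carr M \<sigma> \<and> finite X \<and> X \<noteq> {}})"

definition nat_of :: "'u struc \<Rightarrow> 'u \<Rightarrow> nat" where
  "nat_of M = inv (num M)"

definition bool_of :: "'u struc \<Rightarrow> 'u \<Rightarrow> bool" where
  "bool_of M = inv (boo M)"

text \<open>The codes of the function \<open>f\<close> from \<open>\<rho>\<close> to \<open>\<sigma>\<close> and of the finite set \<open>X\<close>.\<close>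

definition lam :: "'u struc \<Rightarrow> ty \<Rightarrow> ty \<Rightarrow> ('u \<Rightarrow> 'u) \<Rightarrow> 'u" where
  "lam M \<rho> \<sigma> f =
     inv_into (carr M (\<rho> \<leadsto> \<sigma>)) (\<lambda>h. restrict (app M h) (carr M \<rho>)) (restrict f (carr M \<rho>))"

definition fset_of :: "'u struc \<Rightarrow> ty \<Rightarrow> 'u set \<Rightarrow> 'u" where
  "fset_of M \<sigma> X = inv_into (carr M (Star \<sigma>)) (elems M) X"

primrec lams :: "'u struc \<Rightarrow> ty list \<Rightarrow> ty \<Rightarrow> ('u list \<Rightarrow> 'u) \<Rightarrow> 'u" where
  "lams M [] \<tau> f = f []"
| "lams M (\<sigma> # \<sigma>s) \<tau> f = lam M \<sigma> (funs \<sigma>s \<tau>) (\<lambda>x. lams M \<sigma>s \<tau> (\<lambda>xs. f (x # xs)))"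

primrec rec_val :: "'u struc \<Rightarrow> 'u list \<Rightarrow> 'u list \<Rightarrow> nat \<Rightarrow> 'u list" where
  "rec_val M ws fs 0 = ws"
| "rec_val M ws fs (Suc n) =
     map (\<lambda>f. foldl (app M) f (num M n # rec_val M ws fs n)) fs"

primrec con_val :: "'u struc \<Rightarrow> con \<Rightarrow> 'u" where
  "con_val M (PiC \<sigma> \<tau>) = lams M [\<sigma>, \<tau>] \<sigma> (\<lambda>v. v ! 0)"
| "con_val M (SigmaC \<rho> \<sigma> \<tau>) =
     lams M [\<rho> \<leadsto> \<sigma> \<leadsto> \<tau>, \<rho> \<leadsto> \<sigma>, \<rho>] \<tau>
       (\<lambda>v. app M (app M (v ! 0) (v ! 2)) (app M (v ! 1) (v ! 2)))"
| "con_val M ZeroC = num M 0"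
| "con_val M SuccC = lam M NatT NatT (\<lambda>x. num M (Suc (nat_of M x)))"
| "con_val M (RecC i \<sigma>s) =
     lams M (NatT # \<sigma>s @ map (step_ty \<sigma>s) \<sigma>s) (\<sigma>s ! i)
       (\<lambda>v. rec_val M (take (length \<sigma>s) (tl v)) (drop (length \<sigma>s) (tl v)) (nat_of M (hd v)) ! i)"
| "con_val M FalseC = boo M False"
| "con_val M TrueC = boo M True"
| "con_val M (CondC \<sigma>) =
     lams M [BoolT, \<sigma>, \<sigma>] \<sigma> (\<lambda>v. if bool_of M (v ! 0) then v ! 2 else v ! 1)"
| "con_val M (SingC \<sigma>) = lam M \<sigma> (Star \<sigma>) (\<lambda>x. fset_of M \<sigma> {x})"
| "con_val M (UnionC \<sigma>) =
     lams M [Star \<sigma>, Star \<sigma>] (Star \<sigma>)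
       (\<lambda>v. fset_of M \<sigma> (elems M (v ! 0) \<union> elems M (v ! 1)))"
| "con_val M (IUnionC \<sigma> \<tau>) =
     lams M [Star \<sigma>, \<sigma> \<leadsto> Star \<tau>] (Star \<tau>)
       (\<lambda>v. fset_of M \<tau> (\<Union>w\<in>elems M (v ! 0). elems M (app M (v ! 1) w)))"
| "con_val M (MemC \<sigma>) = lams M [\<sigma>, Star \<sigma>] BoolT (\<lambda>v. boo M (v ! 0 \<in> elems M (v ! 1)))"
| "con_val M MaxC = lam M (Star NatT) NatT (\<lambda>x. num M (Max (nat_of M ` elems M x)))"

primrec tm_val :: "'u struc \<Rightarrow> (nat \<Rightarrow> 'u) \<Rightarrow> tm \<Rightarrow> 'u" where
  "tm_val M e (Var n) = e n"
| "tm_val M e (Con c) = con_val M c"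
| "tm_val M e (App t u) = app M (tm_val M e t) (tm_val M e u)"

text \<open>
  \<open>Pred\<close> is not interpreted in $\mathcal S^\omega_*$; its clause is a dummy, never reached on
  formulas of the target language.
\<close>

primrec sat :: "'u struc \<Rightarrow> (nat \<Rightarrow> 'u) \<Rightarrow> fm \<Rightarrow> bool" where
  "sat M e Bot = False"
| "sat M e (Eq \<sigma> t u) = (tm_val M e t = tm_val M e u)"
| "sat M e (Pred \<sigma> t) = False"
| "sat M e (And A B) = (sat M e A \<and> sat M e B)"
| "sat M e (Imp A B) = (sat M e A \<longrightarrow> sat M e B)"
| "sat M e (All \<sigma> A) = (\<forall>x\<in>carr M \<sigma>. sat M (case_nat x e) A)"
| "sat M e (Ex \<sigma> A) = (\<exists>x\<in>carr M \<sigma>. sat M (case_nat x e) A)"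

text \<open>
  The set of target sentences true in \<open>M\<close>. It is deductively closed, so provability from it
  is membership, and an open formula is provable iff its universal closure is a member.
\<close>

definition target_theory :: "'u struc \<Rightarrow> fm set" where
  "target_theory M = {A. target_fm [] A \<and> (\<forall>e. sat M e A)}"


section \<open>Base interpretations and the $\mathcal U$-interpretation\<close>

text \<open>
  \<open>brel \<sigma>\<close> is the target formula $\langle\mathcal I_\sigma(x)\rangle^{\boldsymbol a}_{\boldsymbol b}$
  in the context \<open>x, a\<^sub>0, \<dots>, b\<^sub>0, \<dots>\<close> of types \<open>\<sigma> # bpos \<sigma> @ bneg \<sigma>\<close>. Only star-free
  \<open>\<sigma>\<close> are relevant.
\<close>

record base_interp =
  bpos :: "ty \<Rightarrow> ty list"
  bneg :: "ty \<Rightarrow> ty list"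
  brel :: "ty \<Rightarrow> fm"

definition is_base_interp :: "base_interp \<Rightarrow> bool" where
  "is_base_interp I \<longleftrightarrow> (\<forall>\<sigma>. ha_ty \<sigma> \<longrightarrow> target_fm (\<sigma> # bpos I \<sigma> @ bneg I \<sigma>) (brel I \<sigma>))"

text \<open>Types of the positive and negative witnesses of $A \to B$, from those of \<open>A\<close> and \<open>B\<close>.\<close>

definition imp_pos :: "ty list \<Rightarrow> ty list \<Rightarrow> ty list \<Rightarrow> ty list \<Rightarrow> ty list" where
  "imp_pos pA nA pB nB =
     map (\<lambda>\<tau>. funs pA \<tau>) pB @ map (\<lambda>\<beta>. funs (pA @ nB) (Star \<beta>)) nA"

definition imp_neg :: "ty list \<Rightarrow> ty list \<Rightarrow> ty list" where
  "imp_neg pA nB = pA @ nB"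

fun pos :: "base_interp \<Rightarrow> fm \<Rightarrow> ty list" and neg :: "base_interp \<Rightarrow> fm \<Rightarrow> ty list" where
  "pos I Bot = []"
| "pos I (Eq \<sigma> t u) = []"
| "pos I (Pred \<sigma> t) = bpos I \<sigma>"
| "pos I (And A B) = pos I A @ pos I B"
| "pos I (Imp A B) = imp_pos (pos I A) (neg I A) (pos I B) (neg I B)"
| "pos I (All \<sigma> A) = pos I A"
| "pos I (Ex \<sigma> A) = pos I A"
| "neg I Bot = []"
| "neg I (Eq \<sigma> t u) = []"
| "neg I (Pred \<sigma> t) = bneg I \<sigma>"
| "neg I (And A B) = neg I A @ neg I B"
| "neg I (Imp A B) = imp_neg (pos I A) (neg I B)"
| "neg I (All \<sigma> A) = neg I A"
| "neg I (Ex \<sigma> A) = map Star (neg I A)"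

text \<open>
  \<open>balls \<beta>s Bs \<phi>\<close> is $\forall\boldsymbol b\in\boldsymbol B\,\varphi$, where the terms \<open>Bs\<close> live in a
  context \<open>\<Gamma>\<close> and \<open>\<phi>\<close> lives in \<open>\<beta>s @ \<Gamma>\<close>, so that the bound variables are
  \<open>Var 0, \<dots>, Var (length \<beta>s - 1)\<close>. Membership is a constant with values in $\mathbb B$;
  $b\in B$ says that it has value $1^{\mathbb B}$.
\<close>

definition mem_fm :: "ty \<Rightarrow> tm \<Rightarrow> tm \<Rightarrow> fm" where
  "mem_fm \<beta> b B = Eq BoolT (apps (Con (MemC \<beta>)) [b, B]) (Con TrueC)"

fun balls :: "ty list \<Rightarrow> tm list \<Rightarrow> fm \<Rightarrow> fm" where
  "balls (\<beta> # \<beta>s) (B # Bs) \<phi> =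
     balls \<beta>s Bs (All \<beta> (Imp (mem_fm \<beta> (Var 0) (shift (Suc (length \<beta>s)) B)) \<phi>))"
| "balls _ _ \<phi> = \<phi>"

abbreviation vars :: "nat \<Rightarrow> tm list" where
  "vars k \<equiv> map Var [0..<k]"

text \<open>
  \<open>uint I s A as bs\<close> is $\langle A\rangle^{\boldsymbol a}_{\boldsymbol b}$ for terms \<open>as\<close>, \<open>bs\<close>, with
  the free variables of \<open>A\<close> replaced by means of \<open>s\<close>. All of \<open>as\<close>, \<open>bs\<close> and the values of
  \<open>s\<close> are terms in the ambient context and are shifted when a quantifier is introduced.
\<close>

primrec uint :: "base_interp \<Rightarrow> (nat \<Rightarrow> tm) \<Rightarrow> fm \<Rightarrow> tm list \<Rightarrow> tm list \<Rightarrow> fm" where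
  "uint I s Bot as bs = Bot"
| "uint I s (Eq \<sigma> t u) as bs = Eq \<sigma> (sub s t) (sub s u)"
| "uint I s (Pred \<sigma> t) as bs = fsub (\<lambda>n. (sub s t # as @ bs) ! n) (brel I \<sigma>)"
| "uint I s (And A B) as bs =
     And (uint I s A (take (length (pos I A)) as) (take (length (neg I A)) bs))
         (uint I s B (drop (length (pos I A)) as) (drop (length (neg I A)) bs))"
| "uint I s (Imp A B) as bs =
     (let f = take (length (pos I B)) as; g = drop (length (pos I B)) as;
          a = take (length (pos I A)) bs; d = drop (length (pos I A)) bs;
          k = length (neg I A)
      in Imp (balls (neg I A) (map (\<lambda>t. apps t (a @ d)) g)
                (uint I (\<lambda>n. shift k (s n)) A (map (shift k) a) (vars k)))
             (uint I s B (map (\<lambda>t. apps t a) f) d))"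
| "uint I s (All \<sigma> A) as bs = All \<sigma> (uint I (up s) A (map (shift 1) as) (map (shift 1) bs))"
| "uint I s (Ex \<sigma> A) as bs =
     (let k = length (neg I A)
      in Ex \<sigma> (balls (neg I A) (map (shift 1) bs)
                (uint I (\<lambda>n. shift k (up s n)) A (map (shift (Suc k)) as) (vars k))))"

text \<open>\<open>A\<close> is a formula in the context \<open>\<Gamma>\<close>.\<close>

definition U_interpretable :: "'u struc \<Rightarrow> base_interp \<Rightarrow> ty list \<Rightarrow> fm \<Rightarrow> bool" where
  "U_interpretable M I \<Gamma> A \<longleftrightarrow>
     (\<exists>ts. list_all2 (has_ty []) ts (pos I A) \<and>
        (let k = length (neg I A)
         in close (neg I A @ \<Gamma>) (uint I (\<lambda>n. Var (n + k)) A ts (vars k)) \<in> target_theory M))"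

primrec relat :: "fm \<Rightarrow> fm" where
  "relat Bot = Bot"
| "relat (Eq \<sigma> t u) = Eq \<sigma> t u"
| "relat (Pred \<sigma> t) = Pred \<sigma> t"
| "relat (And A B) = And (relat A) (relat B)"
| "relat (Imp A B) = Imp (relat A) (relat B)"
| "relat (All \<sigma> A) = All \<sigma> (Imp (Pred \<sigma> (Var 0)) (relat A))"
| "relat (Ex \<sigma> A) = Ex \<sigma> (And (Pred \<sigma> (Var 0)) (relat A))"

primrec conjs :: "fm \<Rightarrow> fm list \<Rightarrow> fm" where
  "conjs A [] = A"
| "conjs A (B # Bs) = And A (conjs B Bs)"

text \<open>
  $\mathcal I(\boldsymbol x)\to A$ for the variables of the context; for an empty tuple this is \<open>A\<close>.
\<close>

definition guard :: "ty list \<Rightarrow> fm \<Rightarrow> fm" where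
  "guard \<Gamma> A =
     (case map2 Pred \<Gamma> (vars (length \<Gamma>)) of [] \<Rightarrow> A | P # Ps \<Rightarrow> Imp (conjs P Ps) A)"

definition I_interpretable :: "'u struc \<Rightarrow> base_interp \<Rightarrow> ty list \<Rightarrow> fm \<Rightarrow> bool" where
  "I_interpretable M I \<Gamma> A \<longleftrightarrow> U_interpretable M I [] (close \<Gamma> (guard \<Gamma> (relat A)))"

definition sound_type_informative_base :: "'u struc \<Rightarrow> base_interp \<Rightarrow> bool" where
  "sound_type_informative_base M I \<longleftrightarrow>
     is_base_interp I \<and>
     (\<forall>c. ha_con c \<longrightarrow> U_interpretable M I [] (Pred (con_ty c) (Con c))) \<and>
     (\<forall>\<sigma> \<tau>. ha_ty \<sigma> \<longrightarrow> ha_ty \<tau> \<longrightarrow>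
        U_interpretable M I []
          (All \<sigma> (All (\<sigma> \<leadsto> \<tau>)
             (Imp (And (Pred \<sigma> (Var 1)) (Pred (\<sigma> \<leadsto> \<tau>) (Var 0)))
                  (Pred \<tau> (App (Var 0) (Var 1))))))) \<and>
     (\<forall>\<Gamma> A. ha_axiom \<Gamma> A \<longrightarrow> I_interpretable M I \<Gamma> A)"


section \<open>The base interpretation of $\mathcal I^{\mathrm{cp}}$\<close>

text \<open>The values at starred types are irrelevant.\<close>

fun cp_pos :: "ty \<Rightarrow> ty list" and cp_neg :: "ty \<Rightarrow> ty list" where
  "cp_pos NatT = [NatT]"
| "cp_pos BoolT = [BoolT]"
| "cp_pos (\<rho> \<leadsto> \<sigma>) = imp_pos (cp_pos \<rho>) (cp_neg \<rho>) (cp_pos \<sigma>) (cp_neg \<sigma>)"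
| "cp_pos (Star \<sigma>) = []"
| "cp_neg NatT = []"
| "cp_neg BoolT = []"
| "cp_neg (\<rho> \<leadsto> \<sigma>) = imp_neg (cp_pos \<rho>) (cp_neg \<sigma>)"
| "cp_neg (Star \<sigma>) = []"

text \<open>
  \<open>cp_at \<sigma> x as bs\<close> is $\langle\mathcal I_\sigma(x)\rangle^{\boldsymbol a}_{\boldsymbol b}$ for terms
  \<open>x\<close>, \<open>as\<close>, \<open>bs\<close>.
\<close>

primrec cp_at :: "ty \<Rightarrow> tm \<Rightarrow> tm list \<Rightarrow> tm list \<Rightarrow> fm" where
  "cp_at NatT x as bs = Eq NatT x (hd as)"
| "cp_at BoolT x as bs = Eq BoolT x (hd as)"
| "cp_at (\<rho> \<leadsto> \<sigma>) h as bs =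
     (let f = take (length (cp_pos \<sigma>)) as; g = drop (length (cp_pos \<sigma>)) as;
          a = take (length (cp_pos \<rho>)) bs; d = drop (length (cp_pos \<rho>)) bs;
          k = length (cp_neg \<rho>)
      in All \<rho>
           (Imp (balls (cp_neg \<rho>) (map (\<lambda>t. shift 1 (apps t (a @ d))) g)
                   (cp_at \<rho> (Var k) (map (shift (Suc k)) a) (vars k)))
                (cp_at \<sigma> (App (shift 1 h) (Var 0))
                   (map (\<lambda>t. shift 1 (apps t a)) f) (map (shift 1) d))))"
| "cp_at (Star \<sigma>) x as bs = Bot"

definition cp_base :: base_interp where
  "cp_base =
     \<lparr> bpos = cp_pos, bneg = cp_neg,
       brel = (\<lambda>\<sigma>. let p = length (cp_pos \<sigma>); q = length (cp_neg \<sigma>)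
                   in cp_at \<sigma> (Var 0) (map Var [1..<1 + p]) (map Var [1 + p..<1 + p + q])) \<rparr>"

end

(*
  The structure is classical, so only the witnesses matter. A realizer of A |- B is a tuple f of
  functions definable by closed terms, taking positive witnesses of A to positive witnesses of B,
  together with a tuple g of definable functions producing finite sets of challenges to A from a
  challenge to B. With respect to this notion of entailment, semantic formulas form a model of
  intuitionistic logic, in which definability is inherited through bracket abstraction, and which
  satisfies induction and case distinction on the guarded quantifiers over N and B. In the
  induction rule the positive witness is defined by primitive recursion, and the set of challenges
  by a primitive recursion of higher type that lets the challenge to D(n) vary. Since the clause
  for I at function types is the interpretation of "forall x. I(x) -> I(h x)", the claims on
  constants and on application are derivations in this logic; for the simultaneous recursors one
  applies the induction rule to the conjunction of all the components. The schemata of the theory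
  are derivable likewise, and the remaining axioms carry no witnesses.
*)

theory Submission
  imports Defs
begin

section \<open>The structure\<close>

text \<open>Two facts shape the definitions. First, quantifiers range over all of
  \<open>carr M \<sigma>\<close>, which may contain elements denoted by no term, so witnesses cannot
  depend on the values of variables. Entailment is therefore stated for families over an index type
  \<open>'i\<close>, with the terms chosen before the index; a term learns about a value only
  through the positive witness of an \<open>I\<close>-guard. In the rules for N and B the index
  carries a HOL number or Boolean, and the guard equates it with the witness. Second, sets in
  starred types are never empty. A projection from a conjunction must invent a challenge to the
  discarded part, but in return a hypothesis quantified over a product of challenge sets always has
  an instance. Contraction merges two challenge sets, so no decision between challenges is required.
  Enlarging a challenge set only strengthens the hypothesis ranging over it, so componentwise
  unions, whose products may exceed the union of the products, are harmless. Existential quantifiers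
  occur in the axioms only inside the schematic formula, which the derivations treat as
  opaque.\<close>

locale omega_star =
  fixes M :: "'u struc"
  assumes S_omega_star: "is_S_omega_star M"
begin

abbreviation apl :: "'u \<Rightarrow> 'u list \<Rightarrow> 'u" where
  "apl \<equiv> foldl (app M)"

lemma num_bij: "bij_betw (num M) UNIV (carr M NatT)"
  and boo_bij: "bij_betw (boo M) UNIV (carr M BoolT)"
  and fun_bij: "bij_betw (\<lambda>h. restrict (app M h) (carr M \<rho>)) (carr M (\<rho> \<leadsto> \<sigma>))
    (carr M \<rho> \<rightarrow>\<^sub>E carr M \<sigma>)"
  and set_bij: "bij_betw (elems M) (carr M (Star \<sigma>)) {X. X \<subseteq> carr M \<sigma> \<and> finite X \<and> X \<noteq> {}}"
  using S_omega_star unfolding is_S_omega_star_def by blast+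

lemma nat_of_num [simp]: "nat_of M (num M n) = n"
  using bij_betw_inv_into_left[OF num_bij] by (simp add: nat_of_def)

lemma num_in [simp]: "num M n \<in> carr M NatT"
  using bij_betw_apply[OF num_bij] by simp

lemma num_nat_of [simp]: "x \<in> carr M NatT \<Longrightarrow> num M (nat_of M x) = x"
  using bij_betw_inv_into_right[OF num_bij] by (simp add: nat_of_def)

lemma num_eq_iff [simp]: "num M m = num M n \<longleftrightarrow> m = n"
  using num_bij by (auto simp: bij_betw_def inj_eq)

lemma bool_of_boo [simp]: "bool_of M (boo M b) = b"
  using bij_betw_inv_into_left[OF boo_bij] by (simp add: bool_of_def)

lemma boo_in [simp]: "boo M b \<in> carr M BoolT"
  using bij_betw_apply[OF boo_bij] by simp

lemma boo_bool_of [simp]: "x \<in> carr M BoolT \<Longrightarrow> boo M (bool_of M x) = x"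
  using bij_betw_inv_into_right[OF boo_bij] by (simp add: bool_of_def)

lemma boo_eq_iff [simp]: "boo M a = boo M b \<longleftrightarrow> a = b"
  using boo_bij by (auto simp: bij_betw_def inj_eq)

lemma app_in [intro]:
  assumes "h \<in> carr M (\<rho> \<leadsto> \<sigma>)" "x \<in> carr M \<rho>"
  shows "app M h x \<in> carr M \<sigma>"
proof -
  have "restrict (app M h) (carr M \<rho>) \<in> carr M \<rho> \<rightarrow>\<^sub>E carr M \<sigma>"
    using fun_bij assms(1) by (rule bij_betw_apply)
  then show ?thesis using assms(2) by (metis PiE_mem restrict_apply')
qed

lemma fun_ext:
  assumes "h \<in> carr M (\<rho> \<leadsto> \<sigma>)" "h' \<in> carr M (\<rho> \<leadsto> \<sigma>)"
    "\<And>x. x \<in> carr M \<rho> \<Longrightarrow> app M h x = app M h' x"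
  shows "h = h'"
proof -
  have "restrict (app M h) (carr M \<rho>) = restrict (app M h') (carr M \<rho>)"
    using assms(3) by (rule restrict_ext)
  then show ?thesis using fun_bij assms(1,2) unfolding bij_betw_def inj_on_def by blast
qed

text \<open>The code exists because the map of \<open>fun_bij\<close> is onto: every function
  between carriers is represented. The restriction in \<open>lam\<close> hides the values of
  \<open>f\<close> outside \<open>carr M \<rho>\<close>.\<close>

lemma
  assumes "\<And>x. x \<in> carr M \<rho> \<Longrightarrow> f x \<in> carr M \<sigma>"
  shows lam_in: "lam M \<rho> \<sigma> f \<in> carr M (\<rho> \<leadsto> \<sigma>)"
    and app_lam: "x \<in> carr M \<rho> \<Longrightarrow> app M (lam M \<rho> \<sigma> f) x = f x"
proof -
  have im: "restrict f (carr M \<rho>) \<in>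
      (\<lambda>h. restrict (app M h) (carr M \<rho>)) ` carr M (\<rho> \<leadsto> \<sigma>)"
    using assms fun_bij[of \<rho> \<sigma>] unfolding bij_betw_def by auto
  show "lam M \<rho> \<sigma> f \<in> carr M (\<rho> \<leadsto> \<sigma>)"
    unfolding lam_def using im by (rule inv_into_into)
  have "restrict (app M (lam M \<rho> \<sigma> f)) (carr M \<rho>) = restrict f (carr M \<rho>)"
    unfolding lam_def using im by (rule f_inv_into_f)
  then show "app M (lam M \<rho> \<sigma> f) x = f x" if "x \<in> carr M \<rho>"
    using that by (metis restrict_apply')
qed

lemma
  assumes "A \<in> carr M (Star \<sigma>)"
  shows elems_subset: "elems M A \<subseteq> carr M \<sigma>"
    and finite_elems: "finite (elems M A)"
    and elems_nonempty: "elems M A \<noteq> {}"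
  using bij_betw_apply[OF set_bij assms] by auto

lemma
  assumes "X \<subseteq> carr M \<sigma>" "finite X" "X \<noteq> {}"
  shows fset_of_in: "fset_of M \<sigma> X \<in> carr M (Star \<sigma>)"
    and elems_fset_of: "elems M (fset_of M \<sigma> X) = X"
proof -
  have "X \<in> elems M ` carr M (Star \<sigma>)"
    using assms set_bij[of \<sigma>] unfolding bij_betw_def by auto
  then show "fset_of M \<sigma> X \<in> carr M (Star \<sigma>)" "elems M (fset_of M \<sigma> X) = X"
    unfolding fset_of_def by (rule inv_into_into, rule f_inv_into_f)
qed

lemma fset_of_elems: "A \<in> carr M (Star \<sigma>) \<Longrightarrow> fset_of M \<sigma> (elems M A) = A"
  unfolding fset_of_def using set_bij[of \<sigma>] by (simp add: bij_betw_def)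

lemma
  assumes "x \<in> carr M \<sigma>"
  shows fset_of_singleton_in: "fset_of M \<sigma> {x} \<in> carr M (Star \<sigma>)"
    and elems_singleton: "elems M (fset_of M \<sigma> {x}) = {x}"
  using assms fset_of_in[of "{x}" \<sigma>] elems_fset_of[of "{x}" \<sigma>] by auto

lemma
  assumes "A \<in> carr M (Star \<sigma>)" "B \<in> carr M (Star \<sigma>)"
  shows fset_of_union_in: "fset_of M \<sigma> (elems M A \<union> elems M B) \<in> carr M (Star \<sigma>)"
    and elems_union: "elems M (fset_of M \<sigma> (elems M A \<union> elems M B)) = elems M A \<union> elems M B"
proof -
  have "elems M A \<union> elems M B \<subseteq> carr M \<sigma>" "finite (elems M A \<union> elems M B)"
    "elems M A \<union> elems M B \<noteq> {}"
    using assms elems_subset finite_elems elems_nonempty by blast+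
  then show "fset_of M \<sigma> (elems M A \<union> elems M B) \<in> carr M (Star \<sigma>)"
    "elems M (fset_of M \<sigma> (elems M A \<union> elems M B)) = elems M A \<union> elems M B"
    by (rule fset_of_in, rule elems_fset_of)
qed

lemma
  assumes "finite X" "X \<noteq> {}" "\<And>x. x \<in> X \<Longrightarrow> f x \<in> carr M (Star \<tau>)"
  shows fset_of_UN_in: "fset_of M \<tau> (\<Union>x\<in>X. elems M (f x)) \<in> carr M (Star \<tau>)"
    and elems_UN: "elems M (fset_of M \<tau> (\<Union>x\<in>X. elems M (f x))) = (\<Union>x\<in>X. elems M (f x))"
proof -
  have "(\<Union>x\<in>X. elems M (f x)) \<subseteq> carr M \<tau>" "finite (\<Union>x\<in>X. elems M (f x))"
    "(\<Union>x\<in>X. elems M (f x)) \<noteq> {}"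
    using elems_subset[OF assms(3)] finite_elems[OF assms(3)] elems_nonempty[OF assms(3)] assms(1,2)
    by auto
  then show "fset_of M \<tau> (\<Union>x\<in>X. elems M (f x)) \<in> carr M (Star \<tau>)"
    "elems M (fset_of M \<tau> (\<Union>x\<in>X. elems M (f x))) = (\<Union>x\<in>X. elems M (f x))"
    by (rule fset_of_in, rule elems_fset_of)
qed

section \<open>Tuples typed by a context\<close>

definition tup :: "ty list \<Rightarrow> 'u list set" where
  "tup \<Gamma> = {v. list_all2 (\<lambda>x \<sigma>. x \<in> carr M \<sigma>) v \<Gamma>}"

lemma tup_Nil [simp]: "v \<in> tup [] \<longleftrightarrow> v = []"
  by (simp add: tup_def)

lemma Nil_tup [simp]: "[] \<in> tup \<Gamma> \<longleftrightarrow> \<Gamma> = []"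
  by (simp add: tup_def)

lemma Cons_tup [simp]: "x # v \<in> tup (\<sigma> # \<Gamma>) \<longleftrightarrow> x \<in> carr M \<sigma> \<and> v \<in> tup \<Gamma>"
  by (simp add: tup_def)

lemma tup_Cons: "v \<in> tup (\<sigma> # \<Gamma>) \<longleftrightarrow> (\<exists>x w. v = x # w \<and> x \<in> carr M \<sigma> \<and> w \<in> tup \<Gamma>)"
  by (simp add: tup_def list_all2_Cons2)

lemma tup_length: "v \<in> tup \<Gamma> \<Longrightarrow> length v = length \<Gamma>"
  by (auto simp: tup_def dest: list_all2_lengthD)

lemma tup_iff: "v \<in> tup \<Gamma> \<longleftrightarrow> length v = length \<Gamma> \<and> (\<forall>n<length \<Gamma>. v ! n \<in> carr M (\<Gamma> ! n))"
  by (auto simp: tup_def list_all2_conv_all_nth)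

lemma tup_nth: "v \<in> tup \<Gamma> \<Longrightarrow> n < length \<Gamma> \<Longrightarrow> v ! n \<in> carr M (\<Gamma> ! n)"
  by (simp add: tup_iff)

lemma append_tup: "v \<in> tup \<Gamma> \<Longrightarrow> w \<in> tup \<Delta> \<Longrightarrow> v @ w \<in> tup (\<Gamma> @ \<Delta>)"
  by (simp add: tup_def list_all2_appendI)

lemma tup_append: "v \<in> tup (\<Gamma> @ \<Delta>) \<longleftrightarrow> (\<exists>a b. v = a @ b \<and> a \<in> tup \<Gamma> \<and> b \<in> tup \<Delta>)"
proof
  assume "v \<in> tup (\<Gamma> @ \<Delta>)"
  then show "\<exists>a b. v = a @ b \<and> a \<in> tup \<Gamma> \<and> b \<in> tup \<Delta>"
    unfolding tup_def list_all2_append2 mem_Collect_eq by blast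
qed (use append_tup in blast)

lemma take_tup: "v \<in> tup (\<Gamma> @ \<Delta>) \<Longrightarrow> take (length \<Gamma>) v \<in> tup \<Gamma>"
  and drop_tup: "v \<in> tup (\<Gamma> @ \<Delta>) \<Longrightarrow> drop (length \<Gamma>) v \<in> tup \<Delta>"
  unfolding tup_append by (elim exE conjE, simp add: tup_length)+

lemma append_tup_iff:
  "length v = length \<Gamma> \<Longrightarrow> v @ w \<in> tup (\<Gamma> @ \<Delta>) \<longleftrightarrow> v \<in> tup \<Gamma> \<and> w \<in> tup \<Delta>"
  by (simp add: tup_def list_all2_append)

lemma funs_simps [simp]: "funs [] \<tau> = \<tau>" "funs (\<sigma> # \<sigma>s) \<tau> = \<sigma> \<leadsto> funs \<sigma>s \<tau>"
  by (simp_all add: funs_def)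

lemma apl_in: "h \<in> carr M (funs \<sigma>s \<tau>) \<Longrightarrow> v \<in> tup \<sigma>s \<Longrightarrow> apl h v \<in> carr M \<tau>"
  by (induction \<sigma>s arbitrary: h v) (auto simp: tup_Cons dest: app_in)

lemma map_apl_in:
  "gs \<in> tup (map (\<lambda>\<tau>. funs \<sigma>s (F \<tau>)) \<tau>s) \<Longrightarrow> v \<in> tup \<sigma>s \<Longrightarrow> map (\<lambda>g. apl g v) gs \<in> tup (map F \<tau>s)"
  by (auto simp: tup_iff intro!: apl_in)

text \<open>Both claims go through one induction, because \<open>app_lam\<close> for the outer
  argument needs the inner iterated abstraction to lie in its carrier.\<close>

lemma lams_in_apl:
  assumes "\<And>v. v \<in> tup \<sigma>s \<Longrightarrow> f v \<in> carr M \<tau>"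
  shows "lams M \<sigma>s \<tau> f \<in> carr M (funs \<sigma>s \<tau>) \<and> (\<forall>v\<in>tup \<sigma>s. apl (lams M \<sigma>s \<tau> f) v = f v)"
  using assms
proof (induction \<sigma>s arbitrary: f)
  case (Cons \<sigma> \<sigma>s)
  have *: "lams M \<sigma>s \<tau> (\<lambda>xs. f (x # xs)) \<in> carr M (funs \<sigma>s \<tau>)"
    "\<forall>v\<in>tup \<sigma>s. apl (lams M \<sigma>s \<tau> (\<lambda>xs. f (x # xs))) v = f (x # v)" if "x \<in> carr M \<sigma>" for x
    using Cons.IH[of "\<lambda>xs. f (x # xs)"] Cons.prems that by auto
  show ?case
    using * by (auto simp: tup_Cons lam_in app_lam)
qed auto

lemmas lams_in = lams_in_apl[THEN conjunct1]
lemmas apl_lams = lams_in_apl[THEN conjunct2, rule_format]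

section \<open>Typing and computation rules of the constants\<close>

lemma rec_val_in:
  assumes "ws \<in> tup \<sigma>s" "fs \<in> tup (map (step_ty \<sigma>s) \<sigma>s)"
  shows "rec_val M ws fs n \<in> tup \<sigma>s"
proof (induction n)
  case (Suc n)
  have "apl f (num M n # rec_val M ws fs n) \<in> carr M \<sigma>" if "f \<in> carr M (step_ty \<sigma>s \<sigma>)" for f \<sigma>
    using that apl_in[of f "NatT # \<sigma>s" \<sigma> "num M n # rec_val M ws fs n"] Suc
    by (simp add: step_ty_def)
  then show ?case using assms(2) by (auto simp: tup_iff)
qed (use assms in simp)

lemma
  assumes "i < length \<sigma>s"
  shows con_val_RecC_in: "con_val M (RecC i \<sigma>s) \<in> carr M (con_ty (RecC i \<sigma>s))"
    and apl_RecC: "ws \<in> tup \<sigma>s \<Longrightarrow> fs \<in> tup (map (step_ty \<sigma>s) \<sigma>s) \<Longrightarrow> x \<in> carr M NatT \<Longrightarrow>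
      apl (con_val M (RecC i \<sigma>s)) (x # ws @ fs) = rec_val M ws fs (nat_of M x) ! i"
proof -
  let ?f = "\<lambda>v. rec_val M (take (length \<sigma>s) (tl v)) (drop (length \<sigma>s) (tl v)) (nat_of M (hd v)) ! i"
  have *: "?f v \<in> carr M (\<sigma>s ! i)"
    if v: "v \<in> tup (NatT # \<sigma>s @ map (step_ty \<sigma>s) \<sigma>s)" for v
  proof -
    obtain x ws fs where "v = x # ws @ fs" "ws \<in> tup \<sigma>s" "fs \<in> tup (map (step_ty \<sigma>s) \<sigma>s)"
      using v unfolding tup_Cons tup_append by blast
    then show ?thesis
      using tup_nth[OF rec_val_in assms] by (simp add: tup_length)
  qed
  show "con_val M (RecC i \<sigma>s) \<in> carr M (con_ty (RecC i \<sigma>s))"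
    using lams_in[where f = ?f and \<sigma>s = "NatT # \<sigma>s @ map (step_ty \<sigma>s) \<sigma>s", OF *] by simp
  show "apl (con_val M (RecC i \<sigma>s)) (x # ws @ fs) = rec_val M ws fs (nat_of M x) ! i"
    if "ws \<in> tup \<sigma>s" "fs \<in> tup (map (step_ty \<sigma>s) \<sigma>s)" "x \<in> carr M NatT"
    using apl_lams[where f = ?f and \<sigma>s = "NatT # \<sigma>s @ map (step_ty \<sigma>s) \<sigma>s", OF *, of "x # ws @ fs"] that append_tup[OF that(1,2)]
    by (simp add: tup_length[OF that(1)])
qed

lemma
  shows con_val_PiC_in: "con_val M (PiC \<sigma> \<tau>) \<in> carr M (con_ty (PiC \<sigma> \<tau>))"
    and app_PiC: "\<lbrakk>x \<in> carr M \<sigma>; y \<in> carr M \<tau>\<rbrakk> \<Longrightarrow> app M (app M (con_val M (PiC \<sigma> \<tau>)) x) y = x"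
proof -
  let ?f = "\<lambda>v. v ! 0"
  have *: "?f v \<in> carr M \<sigma>" if v: "v \<in> tup [\<sigma>, \<tau>]" for v
    using that by (auto simp: tup_Cons)
  show "con_val M (PiC \<sigma> \<tau>) \<in> carr M (con_ty (PiC \<sigma> \<tau>))"
    using lams_in[where f = ?f and \<sigma>s = "[\<sigma>, \<tau>]", OF *] by simp
  show "\<lbrakk>x \<in> carr M \<sigma>; y \<in> carr M \<tau>\<rbrakk> \<Longrightarrow> app M (app M (con_val M (PiC \<sigma> \<tau>)) x) y = x"
    using apl_lams[where f = ?f and \<sigma>s = "[\<sigma>, \<tau>]", OF *, of "[x, y]"] by simp
qed

lemma
  shows con_val_SigmaC_in: "con_val M (SigmaC \<rho> \<sigma> \<tau>) \<in> carr M (con_ty (SigmaC \<rho> \<sigma> \<tau>))"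
    and app_SigmaC: "\<lbrakk>x \<in> carr M (\<rho> \<leadsto> \<sigma> \<leadsto> \<tau>); y \<in> carr M (\<rho> \<leadsto> \<sigma>); z \<in> carr M \<rho>\<rbrakk> \<Longrightarrow>
      app M (app M (app M (con_val M (SigmaC \<rho> \<sigma> \<tau>)) x) y) z = app M (app M x z) (app M y z)"
proof -
  let ?f = "\<lambda>v. app M (app M (v ! 0) (v ! 2)) (app M (v ! 1) (v ! 2))"
  have *: "?f v \<in> carr M \<tau>" if v: "v \<in> tup [\<rho> \<leadsto> \<sigma> \<leadsto> \<tau>, \<rho> \<leadsto> \<sigma>, \<rho>]" for v
    using that by (auto simp: tup_Cons intro!: app_in)
  show "con_val M (SigmaC \<rho> \<sigma> \<tau>) \<in> carr M (con_ty (SigmaC \<rho> \<sigma> \<tau>))"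
    using lams_in[where f = ?f and \<sigma>s = "[\<rho> \<leadsto> \<sigma> \<leadsto> \<tau>, \<rho> \<leadsto> \<sigma>, \<rho>]", OF *] by simp
  show "\<lbrakk>x \<in> carr M (\<rho> \<leadsto> \<sigma> \<leadsto> \<tau>); y \<in> carr M (\<rho> \<leadsto> \<sigma>); z \<in> carr M \<rho>\<rbrakk> \<Longrightarrow>
      app M (app M (app M (con_val M (SigmaC \<rho> \<sigma> \<tau>)) x) y) z = app M (app M x z) (app M y z)"
    using apl_lams[where f = ?f and \<sigma>s = "[\<rho> \<leadsto> \<sigma> \<leadsto> \<tau>, \<rho> \<leadsto> \<sigma>, \<rho>]", OF *, of "[x, y, z]"] by simp
qed

lemma
  shows con_val_SuccC_in: "con_val M SuccC \<in> carr M (con_ty SuccC)"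
    and app_SuccC: "x \<in> carr M NatT \<Longrightarrow> app M (con_val M SuccC) x = num M (Suc (nat_of M x))"
  by (auto intro!: lam_in app_lam)

lemma
  shows con_val_CondC_in: "con_val M (CondC \<sigma>) \<in> carr M (con_ty (CondC \<sigma>))"
    and app_CondC: "\<lbrakk>i \<in> carr M BoolT; x \<in> carr M \<sigma>; y \<in> carr M \<sigma>\<rbrakk> \<Longrightarrow>
      app M (app M (app M (con_val M (CondC \<sigma>)) i) x) y = (if bool_of M i then y else x)"
proof -
  let ?f = "\<lambda>v. if bool_of M (v ! 0) then v ! 2 else v ! 1"
  have *: "?f v \<in> carr M \<sigma>" if v: "v \<in> tup [BoolT, \<sigma>, \<sigma>]" for v
    using that by (auto simp: tup_Cons)
  show "con_val M (CondC \<sigma>) \<in> carr M (con_ty (CondC \<sigma>))"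
    using lams_in[where f = ?f and \<sigma>s = "[BoolT, \<sigma>, \<sigma>]", OF *] by simp
  show "\<lbrakk>i \<in> carr M BoolT; x \<in> carr M \<sigma>; y \<in> carr M \<sigma>\<rbrakk> \<Longrightarrow>
      app M (app M (app M (con_val M (CondC \<sigma>)) i) x) y = (if bool_of M i then y else x)"
    using apl_lams[where f = ?f and \<sigma>s = "[BoolT, \<sigma>, \<sigma>]", OF *, of "[i, x, y]"] by simp
qed

lemma
  shows con_val_SingC_in: "con_val M (SingC \<sigma>) \<in> carr M (con_ty (SingC \<sigma>))"
    and app_SingC: "x \<in> carr M \<sigma> \<Longrightarrow> app M (con_val M (SingC \<sigma>)) x = fset_of M \<sigma> {x}"
  using fset_of_singleton_in by (auto intro!: lam_in app_lam)

lemma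
  shows con_val_UnionC_in: "con_val M (UnionC \<sigma>) \<in> carr M (con_ty (UnionC \<sigma>))"
    and app_UnionC: "\<lbrakk>x \<in> carr M (Star \<sigma>); y \<in> carr M (Star \<sigma>)\<rbrakk> \<Longrightarrow>
      app M (app M (con_val M (UnionC \<sigma>)) x) y = fset_of M \<sigma> (elems M x \<union> elems M y)"
proof -
  let ?f = "\<lambda>v. fset_of M \<sigma> (elems M (v ! 0) \<union> elems M (v ! 1))"
  have *: "?f v \<in> carr M (Star \<sigma>)" if v: "v \<in> tup [Star \<sigma>, Star \<sigma>]" for v
    using that by (auto simp: tup_Cons intro!: fset_of_union_in)
  show "con_val M (UnionC \<sigma>) \<in> carr M (con_ty (UnionC \<sigma>))"
    using lams_in[where f = ?f and \<sigma>s = "[Star \<sigma>, Star \<sigma>]", OF *] by simp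
  show "\<lbrakk>x \<in> carr M (Star \<sigma>); y \<in> carr M (Star \<sigma>)\<rbrakk> \<Longrightarrow>
      app M (app M (con_val M (UnionC \<sigma>)) x) y = fset_of M \<sigma> (elems M x \<union> elems M y)"
    using apl_lams[where f = ?f and \<sigma>s = "[Star \<sigma>, Star \<sigma>]", OF *, of "[x, y]"] by simp
qed

lemma
  shows con_val_IUnionC_in: "con_val M (IUnionC \<sigma> \<tau>) \<in> carr M (con_ty (IUnionC \<sigma> \<tau>))"
    and app_IUnionC: "\<lbrakk>x \<in> carr M (Star \<sigma>); y \<in> carr M (\<sigma> \<leadsto> Star \<tau>)\<rbrakk> \<Longrightarrow>
      app M (app M (con_val M (IUnionC \<sigma> \<tau>)) x) y = fset_of M \<tau> (\<Union>w\<in>elems M x. elems M (app M y w))"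
proof -
  let ?f = "\<lambda>v. fset_of M \<tau> (\<Union>w\<in>elems M (v ! 0). elems M (app M (v ! 1) w))"
  have *: "?f v \<in> carr M (Star \<tau>)" if v: "v \<in> tup [Star \<sigma>, \<sigma> \<leadsto> Star \<tau>]" for v
  proof -
    obtain x y where v: "v = [x, y]" and x: "x \<in> carr M (Star \<sigma>)" and y: "y \<in> carr M (\<sigma> \<leadsto> Star \<tau>)"
      using v unfolding tup_Cons tup_Nil by blast
    show ?thesis
      using fset_of_UN_in[of "elems M x" "app M y" \<tau>] finite_elems[OF x] elems_nonempty[OF x]
        elems_subset[OF x] y v by auto
  qed
  show "con_val M (IUnionC \<sigma> \<tau>) \<in> carr M (con_ty (IUnionC \<sigma> \<tau>))"
    using lams_in[where f = ?f and \<sigma>s = "[Star \<sigma>, \<sigma> \<leadsto> Star \<tau>]", OF *] by simp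
  show "\<lbrakk>x \<in> carr M (Star \<sigma>); y \<in> carr M (\<sigma> \<leadsto> Star \<tau>)\<rbrakk> \<Longrightarrow>
      app M (app M (con_val M (IUnionC \<sigma> \<tau>)) x) y = fset_of M \<tau> (\<Union>w\<in>elems M x. elems M (app M y w))"
    using apl_lams[where f = ?f and \<sigma>s = "[Star \<sigma>, \<sigma> \<leadsto> Star \<tau>]", OF *, of "[x, y]"] by simp
qed

lemma
  shows con_val_MemC_in: "con_val M (MemC \<sigma>) \<in> carr M (con_ty (MemC \<sigma>))"
    and app_MemC: "\<lbrakk>x \<in> carr M \<sigma>; y \<in> carr M (Star \<sigma>)\<rbrakk> \<Longrightarrow>
      app M (app M (con_val M (MemC \<sigma>)) x) y = boo M (x \<in> elems M y)"
proof -
  let ?f = "\<lambda>v. boo M (v ! 0 \<in> elems M (v ! 1))"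
  have *: "?f v \<in> carr M BoolT" if v: "v \<in> tup [\<sigma>, Star \<sigma>]" for v
    by simp
  show "con_val M (MemC \<sigma>) \<in> carr M (con_ty (MemC \<sigma>))"
    using lams_in[where f = ?f and \<sigma>s = "[\<sigma>, Star \<sigma>]", OF *] by simp
  show "\<lbrakk>x \<in> carr M \<sigma>; y \<in> carr M (Star \<sigma>)\<rbrakk> \<Longrightarrow>
      app M (app M (con_val M (MemC \<sigma>)) x) y = boo M (x \<in> elems M y)"
    using apl_lams[where f = ?f and \<sigma>s = "[\<sigma>, Star \<sigma>]", OF *, of "[x, y]"] by simp
qed

lemma con_val_in: "wf_con c \<Longrightarrow> con_val M c \<in> carr M (con_ty c)"
proof (induction c)
  case MaxC
  show ?case by (simp, rule lam_in) simp
next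
  case FalseC
  show ?case by simp
next
  case TrueC
  show ?case by simp
next
  case ZeroC
  show ?case by simp
next
  case (RecC i \<sigma>s)
  then show ?case using con_val_RecC_in by (simp only: wf_con.simps)
qed (rule con_val_PiC_in con_val_SigmaC_in con_val_SuccC_in con_val_CondC_in
      con_val_SingC_in con_val_UnionC_in con_val_IUnionC_in con_val_MemC_in)+

section \<open>Values of terms\<close>

lemma tm_val_in:
  "has_ty \<Gamma> t \<sigma> \<Longrightarrow> (\<And>n. n < length \<Gamma> \<Longrightarrow> e n \<in> carr M (\<Gamma> ! n)) \<Longrightarrow> tm_val M e t \<in> carr M \<sigma>"
proof (induction t arbitrary: \<sigma>)
  case (App t u)
  from App.prems(1) obtain \<rho> where "has_ty \<Gamma> t (\<rho> \<leadsto> \<sigma>)" "has_ty \<Gamma> u \<rho>" by auto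
  then show ?case using App.prems(2)
    App.IH(1)[of "\<rho> \<leadsto> \<sigma>"] App.IH(2)[of \<rho>] by auto
qed (simp_all add: con_val_in)

lemma tm_val_cong:
  "has_ty \<Gamma> t \<sigma> \<Longrightarrow> (\<And>n. n < length \<Gamma> \<Longrightarrow> e n = e' n) \<Longrightarrow> tm_val M e t = tm_val M e' t"
proof (induction t arbitrary: \<sigma>)
  case (App t u)
  from App.prems(1) obtain \<rho> where "has_ty \<Gamma> t (\<rho> \<leadsto> \<sigma>)" "has_ty \<Gamma> u \<rho>" by auto
  then show ?case using App.IH(1)[of "\<rho> \<leadsto> \<sigma>"] App.IH(2)[of \<rho>] App.prems(2) by simp
qed simp_all

lemma tm_val_sub: "tm_val M e (sub s t) = tm_val M (\<lambda>n. tm_val M e (s n)) t"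
  by (induction t) auto

lemma tm_val_apps: "tm_val M e (apps t us) = apl (tm_val M e t) (map (tm_val M e) us)"
  by (induction us arbitrary: t) auto

end

lemma has_ty_sub:
  "has_ty \<Delta> t \<tau> \<Longrightarrow> (\<And>n. n < length \<Delta> \<Longrightarrow> has_ty \<Gamma> (s n) (\<Delta> ! n)) \<Longrightarrow> has_ty \<Gamma> (sub s t) \<tau>"
proof (induction t arbitrary: \<tau>)
  case (App t u)
  from App.prems(1) obtain \<rho> where "has_ty \<Delta> t (\<rho> \<leadsto> \<tau>)" "has_ty \<Delta> u \<rho>" by auto
  then show ?case using App.IH(1)[of "\<rho> \<leadsto> \<tau>"] App.IH(2)[of \<rho>] App.prems(2) by auto
qed simp_all

lemma has_ty_apps:
  "has_ty \<Gamma> t (funs \<sigma>s \<tau>) \<Longrightarrow> list_all2 (has_ty \<Gamma>) us \<sigma>s \<Longrightarrow> has_ty \<Gamma> (apps t us) \<tau>"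
proof (induction \<sigma>s arbitrary: t us)
  case (Cons \<sigma> \<sigma>s)
  then obtain u us' where us: "us = u # us'" "has_ty \<Gamma> u \<sigma>" "list_all2 (has_ty \<Gamma>) us' \<sigma>s"
    by (auto simp: list_all2_Cons2)
  then show ?case
    using Cons.IH[of "App t u" us'] Cons.prems(1) by (auto simp: funs_def)
qed (simp add: funs_def)

context omega_star
begin

section \<open>Definability by closed terms\<close>

text \<open>Open terms spare currying while witnesses are being composed;
  \<open>bracket_abstraction\<close> turns them into functions when needed, and for an empty context
  they are closed. Only the values on \<open>tup \<Gamma>\<close> are constrained, so
  \<open>F\<close> may be built from list operations such as \<open>take\<close> and
  \<open>(!)\<close>.\<close>

definition dfn :: "ty list \<Rightarrow> ty \<Rightarrow> ('u list \<Rightarrow> 'u) \<Rightarrow> bool" where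
  "dfn \<Gamma> \<tau> F \<longleftrightarrow> (\<exists>t. has_ty \<Gamma> t \<tau> \<and> (\<forall>v\<in>tup \<Gamma>. F v = tm_val M ((!) v) t))"

definition dfnl :: "ty list \<Rightarrow> ty list \<Rightarrow> ('u list \<Rightarrow> 'u list) \<Rightarrow> bool" where
  "dfnl \<Gamma> \<tau>s F \<longleftrightarrow>
     (\<exists>ts. list_all2 (has_ty \<Gamma>) ts \<tau>s \<and> (\<forall>v\<in>tup \<Gamma>. F v = map (tm_val M ((!) v)) ts))"

lemma dfn_cong: "dfn \<Gamma> \<tau> F \<Longrightarrow> (\<And>v. v \<in> tup \<Gamma> \<Longrightarrow> F v = G v) \<Longrightarrow> dfn \<Gamma> \<tau> G"
  unfolding dfn_def by auto

lemma dfnl_cong: "dfnl \<Gamma> \<tau>s F \<Longrightarrow> (\<And>v. v \<in> tup \<Gamma> \<Longrightarrow> F v = G v) \<Longrightarrow> dfnl \<Gamma> \<tau>s G"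
  unfolding dfnl_def by auto

lemma dfn_in: "dfn \<Gamma> \<tau> F \<Longrightarrow> v \<in> tup \<Gamma> \<Longrightarrow> F v \<in> carr M \<tau>"
  unfolding dfn_def by (auto intro!: tm_val_in tup_nth)

text \<open>A choice of terms reduces tuples to single components. The length is demanded
  separately, since the entries \<open>F v ! k\<close> do not determine how long \<open>F v\<close>
  is.\<close>

lemma dfnl_iff:
  "dfnl \<Gamma> \<tau>s F \<longleftrightarrow>
     (\<forall>v\<in>tup \<Gamma>. length (F v) = length \<tau>s) \<and> (\<forall>k<length \<tau>s. dfn \<Gamma> (\<tau>s ! k) (\<lambda>v. F v ! k))"
proof
  assume "dfnl \<Gamma> \<tau>s F"
  then obtain ts where "list_all2 (has_ty \<Gamma>) ts \<tau>s" "\<forall>v\<in>tup \<Gamma>. F v = map (tm_val M ((!) v)) ts"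
    unfolding dfnl_def by blast
  then show "(\<forall>v\<in>tup \<Gamma>. length (F v) = length \<tau>s) \<and>
      (\<forall>k<length \<tau>s. dfn \<Gamma> (\<tau>s ! k) (\<lambda>v. F v ! k))"
    unfolding dfn_def by (auto simp: list_all2_conv_all_nth)
next
  assume *: "(\<forall>v\<in>tup \<Gamma>. length (F v) = length \<tau>s) \<and>
      (\<forall>k<length \<tau>s. dfn \<Gamma> (\<tau>s ! k) (\<lambda>v. F v ! k))"
  then have "\<forall>k. \<exists>t. k < length \<tau>s \<longrightarrow>
      has_ty \<Gamma> t (\<tau>s ! k) \<and> (\<forall>v\<in>tup \<Gamma>. F v ! k = tm_val M ((!) v) t)"
    unfolding dfn_def by blast
  then obtain t where t: "\<And>k. k < length \<tau>s \<Longrightarrow>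
      has_ty \<Gamma> (t k) (\<tau>s ! k) \<and> (\<forall>v\<in>tup \<Gamma>. F v ! k = tm_val M ((!) v) (t k))"
    by metis
  show "dfnl \<Gamma> \<tau>s F"
    unfolding dfnl_def
  proof (intro exI conjI ballI)
    show "list_all2 (has_ty \<Gamma>) (map t [0..<length \<tau>s]) \<tau>s"
      using t by (simp add: list_all2_conv_all_nth)
    show "F v = map (tm_val M ((!) v)) (map t [0..<length \<tau>s])" if "v \<in> tup \<Gamma>" for v
      using * t that by (intro nth_equalityI) auto
  qed
qed

lemma dfnl_nth: "dfnl \<Gamma> \<tau>s F \<Longrightarrow> k < length \<tau>s \<Longrightarrow> dfn \<Gamma> (\<tau>s ! k) (\<lambda>v. F v ! k)"
  by (simp add: dfnl_iff)

lemma dfnl_in: "dfnl \<Gamma> \<tau>s F \<Longrightarrow> v \<in> tup \<Gamma> \<Longrightarrow> F v \<in> tup \<tau>s"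
  unfolding dfnl_iff tup_iff[of "F v"] by (auto dest: dfn_in)

lemma dfnl_Nil [simp]: "dfnl \<Gamma> [] (\<lambda>v. [])"
  by (simp add: dfnl_iff)

lemma dfnl_Cons: "dfn \<Gamma> \<tau> F \<Longrightarrow> dfnl \<Gamma> \<tau>s G \<Longrightarrow> dfnl \<Gamma> (\<tau> # \<tau>s) (\<lambda>v. F v # G v)"
  unfolding dfnl_iff by (auto simp: nth_Cons split: nat.split)

lemma dfnl_append:
  assumes "dfnl \<Gamma> \<tau>s F" "dfnl \<Gamma> \<tau>s' G"
  shows "dfnl \<Gamma> (\<tau>s @ \<tau>s') (\<lambda>v. F v @ G v)"
proof -
  from assms(1) obtain ts where ts: "list_all2 (has_ty \<Gamma>) ts \<tau>s"
    "\<And>v. v \<in> tup \<Gamma> \<Longrightarrow> F v = map (tm_val M ((!) v)) ts"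
    unfolding dfnl_def by auto
  from assms(2) obtain us where us: "list_all2 (has_ty \<Gamma>) us \<tau>s'"
    "\<And>v. v \<in> tup \<Gamma> \<Longrightarrow> G v = map (tm_val M ((!) v)) us"
    unfolding dfnl_def by auto
  show ?thesis
    unfolding dfnl_def
    by (intro exI[of _ "ts @ us"]) (auto simp: ts us intro: list_all2_appendI)
qed

lemma
  assumes "dfnl \<Gamma> (\<tau>s @ \<tau>s') F"
  shows dfnl_take: "dfnl \<Gamma> \<tau>s (\<lambda>v. take (length \<tau>s) (F v))"
    and dfnl_drop: "dfnl \<Gamma> \<tau>s' (\<lambda>v. drop (length \<tau>s) (F v))"
proof -
  from assms obtain ts us where tu: "list_all2 (has_ty \<Gamma>) ts \<tau>s" "list_all2 (has_ty \<Gamma>) us \<tau>s'"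
    "\<And>v. v \<in> tup \<Gamma> \<Longrightarrow> F v = map (tm_val M ((!) v)) (ts @ us)"
    unfolding dfnl_def list_all2_append2 by blast
  moreover have "length ts = length \<tau>s"
    using tu(1) by (rule list_all2_lengthD)
  ultimately show "dfnl \<Gamma> \<tau>s (\<lambda>v. take (length \<tau>s) (F v))"
    and "dfnl \<Gamma> \<tau>s' (\<lambda>v. drop (length \<tau>s) (F v))"
    unfolding dfnl_def by (intro exI[of _ ts], simp, intro exI[of _ us], simp)
qed

lemma dfn_var: "n < length \<Gamma> \<Longrightarrow> dfn \<Gamma> (\<Gamma> ! n) (\<lambda>v. v ! n)"
  unfolding dfn_def by (intro exI[of _ "Var n"]) auto

lemma dfnl_id: "dfnl \<Gamma> \<Gamma> (\<lambda>v. v)"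
  by (auto simp: dfnl_iff tup_length dfn_var)

lemma dfn_con: "wf_con c \<Longrightarrow> con_ty c = \<tau> \<Longrightarrow> dfn \<Gamma> \<tau> (\<lambda>_. con_val M c)"
  unfolding dfn_def by (intro exI[of _ "Con c"]) auto

lemma dfn_app:
  assumes "dfn \<Gamma> (\<rho> \<leadsto> \<sigma>) F" "dfn \<Gamma> \<rho> G"
  shows "dfn \<Gamma> \<sigma> (\<lambda>v. app M (F v) (G v))"
proof -
  from assms obtain t u where "has_ty \<Gamma> t (\<rho> \<leadsto> \<sigma>)" "has_ty \<Gamma> u \<rho>"
    "\<forall>v\<in>tup \<Gamma>. F v = tm_val M ((!) v) t" "\<forall>v\<in>tup \<Gamma>. G v = tm_val M ((!) v) u"
    unfolding dfn_def by blast
  then show ?thesis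
    unfolding dfn_def by (intro exI[of _ "App t u"]) auto
qed

lemma dfn_apl: "dfn \<Gamma> (funs \<sigma>s \<tau>) F \<Longrightarrow> dfnl \<Gamma> \<sigma>s G \<Longrightarrow> dfn \<Gamma> \<tau> (\<lambda>v. apl (F v) (G v))"
proof (induction \<sigma>s arbitrary: F G)
  case Nil
  then show ?case by (auto simp: dfnl_iff intro: dfn_cong)
next
  case (Cons \<sigma> \<sigma>s)
  have G: "dfn \<Gamma> \<sigma> (\<lambda>v. G v ! 0)" "dfnl \<Gamma> \<sigma>s (\<lambda>v. drop 1 (G v))"
    using dfnl_nth[OF Cons.prems(2), of 0] dfnl_drop[of \<Gamma> "[\<sigma>]" \<sigma>s G] Cons.prems(2) by auto
  have "dfn \<Gamma> \<tau> (\<lambda>v. apl (app M (F v) (G v ! 0)) (drop 1 (G v)))"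
    using Cons.prems(1) G by (auto intro!: Cons.IH dfn_app)
  then show ?case
  proof (rule dfn_cong)
    fix v assume "v \<in> tup \<Gamma>"
    with Cons.prems(2) have "G v \<in> tup (\<sigma> # \<sigma>s)" by (rule dfnl_in)
    then show "apl (app M (F v) (G v ! 0)) (drop 1 (G v)) = apl (F v) (G v)"
      by (auto simp: tup_Cons)
  qed
qed

text \<open>Composition is substitution: the terms defining \<open>G\<close> replace the variables
  of the term defining \<open>F\<close>.\<close>

lemma dfn_comp:
  assumes "dfn \<Delta> \<tau> F" "dfnl \<Gamma> \<Delta> G"
  shows "dfn \<Gamma> \<tau> (\<lambda>v. F (G v))"
proof -
  from assms obtain t ts where t: "has_ty \<Delta> t \<tau>" "\<forall>v\<in>tup \<Delta>. F v = tm_val M ((!) v) t"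
    and ts: "list_all2 (has_ty \<Gamma>) ts \<Delta>" "\<forall>v\<in>tup \<Gamma>. G v = map (tm_val M ((!) v)) ts"
    unfolding dfn_def dfnl_def by blast
  have "F (G v) = tm_val M ((!) v) (sub ((!) ts) t)" if v: "v \<in> tup \<Gamma>" for v
  proof -
    have "F (G v) = tm_val M ((!) (G v)) t"
      using t(2) dfnl_in[OF assms(2) v] by blast
    also have "\<dots> = tm_val M (\<lambda>n. tm_val M ((!) v) (ts ! n)) t"
      using t(1) by (rule tm_val_cong) (use ts v in \<open>auto dest: list_all2_lengthD\<close>)
    finally show ?thesis by (simp add: tm_val_sub)
  qed
  moreover have "has_ty \<Gamma> (sub ((!) ts) t) \<tau>"
    using t(1) by (rule has_ty_sub) (use ts(1) in \<open>auto simp: list_all2_conv_all_nth\<close>)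
  ultimately show ?thesis unfolding dfn_def by blast
qed

lemma dfnl_comp: "dfnl \<Delta> \<tau>s F \<Longrightarrow> dfnl \<Gamma> \<Delta> G \<Longrightarrow> dfnl \<Gamma> \<tau>s (\<lambda>v. F (G v))"
  using dfnl_in[of \<Gamma> \<Delta> G] by (auto simp: dfnl_iff[of _ \<tau>s] intro: dfn_comp)

lemma dfnl_fst: "dfnl (\<Gamma> @ \<Delta>) \<Gamma> (\<lambda>v. take (length \<Gamma>) v)"
  and dfnl_snd: "dfnl (\<Gamma> @ \<Delta>) \<Delta> (\<lambda>v. drop (length \<Gamma>) v)"
  by (rule dfnl_take dfnl_drop, rule dfnl_id)+

lemma dfnl_weaken: "dfnl \<Gamma> \<tau>s F \<Longrightarrow> dfnl (\<Gamma> @ \<Delta>) \<tau>s (\<lambda>v. F (take (length \<Gamma>) v))"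
  by (rule dfnl_comp[OF _ dfnl_fst])

text \<open>Elimination of a variable by combinators, with \<open>PiC\<close> as K and
  \<open>SigmaC\<close> as S. The abstracted variable is the last one of the context, so the indices
  of all the others stay as they are.\<close>

lemma bracket_abstraction:
  assumes "has_ty (\<Gamma> @ [\<rho>]) t \<sigma>"
  shows "\<exists>t'. has_ty \<Gamma> t' (\<rho> \<leadsto> \<sigma>) \<and>
    (\<forall>v\<in>tup \<Gamma>. \<forall>x\<in>carr M \<rho>. app M (tm_val M ((!) v) t') x = tm_val M ((!) (v @ [x])) t)"
  using assms
proof (induction t arbitrary: \<sigma>)
  case (Var n)
  show ?case
  proof (cases "n < length \<Gamma>")
    case True
    then have \<sigma>: "\<sigma> = \<Gamma> ! n" using Var by (simp add: nth_append)
    show ?thesis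
      using True
      by (intro exI[of _ "App (Con (PiC \<sigma> \<rho>)) (Var n)"])
        (auto simp: \<sigma> tup_length nth_append tup_nth app_PiC simp del: con_val.simps)
  next
    case False
    then have n: "n = length \<Gamma>" "\<sigma> = \<rho>" using Var by (auto simp: nth_append)
    \<comment> \<open>The abstracted variable itself becomes the identity S K K.\<close>
    show ?thesis
      using con_val_PiC_in[of \<rho> \<rho>] con_val_PiC_in[of \<rho> "\<rho> \<leadsto> \<rho>"]
      by (intro exI[of _ "App (App (Con (SigmaC \<rho> (\<rho> \<leadsto> \<rho>) \<rho>)) (Con (PiC \<rho> (\<rho> \<leadsto> \<rho>)))) (Con (PiC \<rho> \<rho>))"])
        (auto simp: n tup_length nth_append app_SigmaC app_PiC app_in simp del: con_val.simps)
  qed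
next
  case (Con c)
  then show ?case
    by (intro exI[of _ "App (Con (PiC \<sigma> \<rho>)) (Con c)"])
      (auto simp: con_val_in app_PiC simp del: con_val.simps)
next
  case (App t u)
  from App.prems obtain \<pi> where tu: "has_ty (\<Gamma> @ [\<rho>]) t (\<pi> \<leadsto> \<sigma>)" "has_ty (\<Gamma> @ [\<rho>]) u \<pi>"
    by auto
  obtain t' where t': "has_ty \<Gamma> t' (\<rho> \<leadsto> \<pi> \<leadsto> \<sigma>)"
    "\<forall>v\<in>tup \<Gamma>. \<forall>x\<in>carr M \<rho>. app M (tm_val M ((!) v) t') x = tm_val M ((!) (v @ [x])) t"
    using App.IH(1)[OF tu(1)] by blast
  obtain u' where u': "has_ty \<Gamma> u' (\<rho> \<leadsto> \<pi>)"
    "\<forall>v\<in>tup \<Gamma>. \<forall>x\<in>carr M \<rho>. app M (tm_val M ((!) v) u') x = tm_val M ((!) (v @ [x])) u"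
    using App.IH(2)[OF tu(2)] by blast
  show ?case
  proof (intro exI[of _ "App (App (Con (SigmaC \<rho> \<pi> \<sigma>)) t') u'"] conjI ballI)
    show "has_ty \<Gamma> (App (App (Con (SigmaC \<rho> \<pi> \<sigma>)) t') u') (\<rho> \<leadsto> \<sigma>)"
      using t'(1) u'(1) by auto
    fix v x assume vx: "v \<in> tup \<Gamma>" "x \<in> carr M \<rho>"
    have "tm_val M ((!) v) t' \<in> carr M (\<rho> \<leadsto> \<pi> \<leadsto> \<sigma>)" "tm_val M ((!) v) u' \<in> carr M (\<rho> \<leadsto> \<pi>)"
      using t'(1) u'(1) tup_nth[OF vx(1)] by (auto intro: tm_val_in)
    then show "app M (tm_val M ((!) v) (App (App (Con (SigmaC \<rho> \<pi> \<sigma>)) t') u')) x =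
        tm_val M ((!) (v @ [x])) (App t u)"
      using t'(2) u'(2) vx by (simp add: app_SigmaC del: con_val.simps)
  qed
qed

text \<open>The code of the function and the value of the abstracted term act alike on
  \<open>carr M \<rho>\<close>, hence are equal by extensionality.\<close>

lemma dfn_lam:
  assumes "dfn (\<Gamma> @ [\<rho>]) \<sigma> F"
  shows "dfn \<Gamma> (\<rho> \<leadsto> \<sigma>) (\<lambda>v. lam M \<rho> \<sigma> (\<lambda>x. F (v @ [x])))"
proof -
  obtain t where "has_ty (\<Gamma> @ [\<rho>]) t \<sigma>" and t: "\<forall>v\<in>tup (\<Gamma> @ [\<rho>]). F v = tm_val M ((!) v) t"
    using assms unfolding dfn_def by blast
  from bracket_abstraction[OF this(1)] obtain t' where t': "has_ty \<Gamma> t' (\<rho> \<leadsto> \<sigma>)"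
    "\<forall>v\<in>tup \<Gamma>. \<forall>x\<in>carr M \<rho>. app M (tm_val M ((!) v) t') x = tm_val M ((!) (v @ [x])) t"
    by blast
  have "lam M \<rho> \<sigma> (\<lambda>x. F (v @ [x])) = tm_val M ((!) v) t'" if v: "v \<in> tup \<Gamma>" for v
  proof (rule fun_ext)
    have F: "F (v @ [x]) \<in> carr M \<sigma>" if "x \<in> carr M \<rho>" for x
      by (rule dfn_in[OF assms]) (use v that in \<open>simp add: append_tup\<close>)
    then show "lam M \<rho> \<sigma> (\<lambda>x. F (v @ [x])) \<in> carr M (\<rho> \<leadsto> \<sigma>)" by (rule lam_in)
    show "tm_val M ((!) v) t' \<in> carr M (\<rho> \<leadsto> \<sigma>)"
      using t'(1) tup_nth[OF v] by (rule tm_val_in)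
    show "app M (lam M \<rho> \<sigma> (\<lambda>x. F (v @ [x]))) x = app M (tm_val M ((!) v) t') x"
      if x: "x \<in> carr M \<rho>" for x
      using t t'(2) v x F by (simp add: app_lam append_tup)
  qed
  then show ?thesis using t'(1) unfolding dfn_def by blast
qed

lemma dfn_lams:
  "dfn (\<Gamma> @ \<sigma>s) \<tau> F \<Longrightarrow> dfn \<Gamma> (funs \<sigma>s \<tau>) (\<lambda>v. lams M \<sigma>s \<tau> (\<lambda>xs. F (v @ xs)))"
proof (induction \<sigma>s arbitrary: \<Gamma>)
  case (Cons \<sigma> \<sigma>s)
  have "dfn (\<Gamma> @ [\<sigma>]) (funs \<sigma>s \<tau>) (\<lambda>v. lams M \<sigma>s \<tau> (\<lambda>xs. F (v @ xs)))"
    using Cons by simp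
  from dfn_lam[OF this] show ?case by simp
qed simp

lemma apl_lams_dfn:
  "dfn (\<Gamma> @ \<sigma>s) \<tau> F \<Longrightarrow> v \<in> tup \<Gamma> \<Longrightarrow> w \<in> tup \<sigma>s \<Longrightarrow>
    apl (lams M \<sigma>s \<tau> (\<lambda>xs. F (v @ xs))) w = F (v @ w)"
  by (rule apl_lams) (auto intro: dfn_in append_tup)

lemma dfn_num: "dfn \<Gamma> NatT (\<lambda>_. num M n)"
proof (induction n)
  case 0
  show ?case using dfn_con[of ZeroC NatT] by simp
next
  case (Suc n)
  have "dfn \<Gamma> NatT (\<lambda>_. app M (con_val M SuccC) (num M n))"
    by (rule dfn_app[OF _ Suc]) (rule dfn_con, auto)
  then show ?case by (simp add: app_SuccC del: con_val.simps)
qed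

lemma dfn_succ: "dfn \<Gamma> NatT F \<Longrightarrow> dfn \<Gamma> NatT (\<lambda>v. num M (Suc (nat_of M (F v))))"
  by (rule dfn_cong[OF dfn_app[OF dfn_con[of SuccC "NatT \<leadsto> NatT"], of \<Gamma> F]])
    (simp_all add: app_SuccC dfn_in del: con_val.simps)

lemma dfn_cond:
  assumes "dfn \<Gamma> BoolT I" "dfn \<Gamma> \<sigma> F" "dfn \<Gamma> \<sigma> G"
  shows "dfn \<Gamma> \<sigma> (\<lambda>v. if bool_of M (I v) then G v else F v)"
proof -
  have "dfn \<Gamma> \<sigma> (\<lambda>v. app M (app M (app M (con_val M (CondC \<sigma>)) (I v)) (F v)) (G v))"
    by (intro dfn_app[OF _ assms(3)] dfn_app[OF _ assms(2)] dfn_app[OF _ assms(1)] dfn_con) auto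
  then show ?thesis
    by (rule dfn_cong)
      (simp add: app_CondC dfn_in[OF assms(1)] dfn_in[OF assms(2)] dfn_in[OF assms(3)] del: con_val.simps)
qed

lemma dfnl_cond:
  assumes "dfn \<Gamma> BoolT I" "dfnl \<Gamma> \<sigma>s F" "dfnl \<Gamma> \<sigma>s G"
  shows "dfnl \<Gamma> \<sigma>s (\<lambda>v. if bool_of M (I v) then G v else F v)"
  using assms dfn_cond[OF assms(1)] unfolding dfnl_iff by (auto simp: if_distrib[of "\<lambda>x. x ! _"])

text \<open>Bridges list-valued recursion in HOL and the simultaneous recursors: each component of
  the step, abstracted over the number and all previous values, becomes one functional argument of
  every \<open>RecC i \<sigma>s\<close>.\<close>

lemma dfnl_rec:
  assumes N: "dfn \<Gamma> NatT N" and W: "dfnl \<Gamma> \<sigma>s W" and F: "dfnl (\<Gamma> @ NatT # \<sigma>s) \<sigma>s F"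
  shows "dfnl \<Gamma> \<sigma>s (\<lambda>v. rec_nat (W v) (\<lambda>k xs. F (v @ num M k # xs)) (nat_of M (N v)))"
proof -
  define fs where
    "fs v = map (\<lambda>j. lams M (NatT # \<sigma>s) (\<sigma>s ! j) (\<lambda>xs. F (v @ xs) ! j)) [0..<length \<sigma>s]" for v
  have fs: "dfnl \<Gamma> (map (step_ty \<sigma>s) \<sigma>s) fs"
    unfolding dfnl_iff
  proof (intro conjI ballI allI impI)
    fix j assume "j < length (map (step_ty \<sigma>s) \<sigma>s)"
    then have j: "j < length \<sigma>s" by simp
    have "dfn \<Gamma> (funs (NatT # \<sigma>s) (\<sigma>s ! j)) (\<lambda>v. lams M (NatT # \<sigma>s) (\<sigma>s ! j) (\<lambda>xs. F (v @ xs) ! j))"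
      by (rule dfn_lams) (rule dfnl_nth[OF F j])
    then show "dfn \<Gamma> (map (step_ty \<sigma>s) \<sigma>s ! j) (\<lambda>v. fs v ! j)"
      using j by (simp add: fs_def step_ty_def)
  qed (simp add: fs_def)
  \<comment> \<open>Agreement and typing are proved together: the coded steps compute only on
    arguments known to lie in their carriers.\<close>
  have rec: "rec_val M (W v) (fs v) n = rec_nat (W v) (\<lambda>k xs. F (v @ num M k # xs)) n \<and>
      rec_val M (W v) (fs v) n \<in> tup \<sigma>s" if v: "v \<in> tup \<Gamma>" for v n
  proof (induction n)
    case 0
    show ?case using dfnl_in[OF W v] by simp
  next
    case (Suc n)
    let ?r = "rec_val M (W v) (fs v) n"
    have v': "v @ num M n # ?r \<in> tup (\<Gamma> @ NatT # \<sigma>s)"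
      using Suc[THEN conjunct2] v by (auto intro!: append_tup)
    have "rec_val M (W v) (fs v) (Suc n) = F (v @ num M n # ?r)"
    proof (rule nth_equalityI)
      show "length (rec_val M (W v) (fs v) (Suc n)) = length (F (v @ num M n # ?r))"
        using tup_length[OF dfnl_in[OF F v']] by (simp add: fs_def)
      fix j assume "j < length (rec_val M (W v) (fs v) (Suc n))"
      then have j: "j < length \<sigma>s" by (simp add: fs_def)
      have "apl (lams M (NatT # \<sigma>s) (\<sigma>s ! j) (\<lambda>xs. F (v @ xs) ! j)) (num M n # ?r) =
          F (v @ num M n # ?r) ! j"
        using apl_lams_dfn[OF dfnl_nth[OF F j] v, of "num M n # ?r"] Suc[THEN conjunct2] by simp
      then show "rec_val M (W v) (fs v) (Suc n) ! j = F (v @ num M n # ?r) ! j"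
        using j by (simp add: fs_def)
    qed
    then show ?case using dfnl_in[OF F v'] Suc by simp
  qed
  show ?thesis
    unfolding dfnl_iff
  proof (intro conjI ballI allI impI)
    show "length (rec_nat (W v) (\<lambda>k xs. F (v @ num M k # xs)) (nat_of M (N v))) = length \<sigma>s"
      if "v \<in> tup \<Gamma>" for v
      using rec[OF that] by (metis tup_length)
    fix i assume i: "i < length \<sigma>s"
    have "dfn \<Gamma> (\<sigma>s ! i) (\<lambda>v. apl (con_val M (RecC i \<sigma>s)) (N v # W v @ fs v))"
      by (intro dfn_apl[of _ "NatT # \<sigma>s @ map (step_ty \<sigma>s) \<sigma>s"] dfn_con dfnl_Cons dfnl_append N W fs)
        (use i in auto)
    then show "dfn \<Gamma> (\<sigma>s ! i) (\<lambda>v. rec_nat (W v) (\<lambda>k xs. F (v @ num M k # xs)) (nat_of M (N v)) ! i)"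
    proof (rule dfn_cong)
      fix v assume v: "v \<in> tup \<Gamma>"
      show "apl (con_val M (RecC i \<sigma>s)) (N v # W v @ fs v) =
          rec_nat (W v) (\<lambda>k xs. F (v @ num M k # xs)) (nat_of M (N v)) ! i"
        using apl_RecC[OF i dfnl_in[OF W v] dfnl_in[OF fs v] dfn_in[OF N v]] rec[OF v] by simp
    qed
  qed
qed

section \<open>Tuples of finite sets and their products\<close>

definition prodl :: "'u list \<Rightarrow> 'u list set" where
  "prodl Bs = {bs. list_all2 (\<lambda>b B. b \<in> elems M B) bs Bs}"

lemma prodl_Nil [simp]: "prodl [] = {[]}"
  by (auto simp: prodl_def)

lemma prodl_Cons: "prodl (B # Bs) = (\<Union>b\<in>elems M B. (#) b ` prodl Bs)"
  by (auto simp: prodl_def list_all2_Cons2)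

lemma prodl_iff: "bs \<in> prodl Bs \<longleftrightarrow> length bs = length Bs \<and> (\<forall>k<length Bs. bs ! k \<in> elems M (Bs ! k))"
  by (auto simp: prodl_def list_all2_conv_all_nth)

lemma prodl_append:
  "prodl (Bs @ Cs) = {b @ c |b c. b \<in> prodl Bs \<and> c \<in> prodl Cs}"
  unfolding prodl_def list_all2_append2 by (auto dest: list_all2_lengthD)

lemma prodl_in: "Bs \<in> tup (map Star \<beta>s) \<Longrightarrow> bs \<in> prodl Bs \<Longrightarrow> bs \<in> tup \<beta>s"
  using elems_subset by (fastforce simp: tup_iff prodl_iff)

lemma finite_prodl: "Bs \<in> tup (map Star \<beta>s) \<Longrightarrow> finite (prodl Bs)"
  by (induction \<beta>s arbitrary: Bs) (auto simp: tup_Cons prodl_Cons finite_elems)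

text \<open>This is what lets a hypothesis about all challenges yield at least one instance; it
  rests on starred types containing non-empty sets only.\<close>

lemma prodl_nonempty: "Bs \<in> tup (map Star \<beta>s) \<Longrightarrow> prodl Bs \<noteq> {}"
  by (induction \<beta>s arbitrary: Bs) (auto simp: tup_Cons prodl_Cons elems_nonempty)

abbreviation sing :: "ty list \<Rightarrow> 'u list \<Rightarrow> 'u list" where
  "sing \<tau>s v \<equiv> map2 (\<lambda>\<tau> x. fset_of M \<tau> {x}) \<tau>s v"

lemma prodl_sing: "v \<in> tup \<tau>s \<Longrightarrow> prodl (sing \<tau>s v) = {v}"
  by (induction \<tau>s arbitrary: v) (auto simp: tup_Cons prodl_Cons elems_singleton)

lemma dfn_sing:
  assumes "dfn \<Gamma> \<sigma> F"
  shows "dfn \<Gamma> (Star \<sigma>) (\<lambda>v. fset_of M \<sigma> {F v})"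
  by (rule dfn_cong[OF dfn_app[OF dfn_con[of "SingC \<sigma>" "\<sigma> \<leadsto> Star \<sigma>"] assms]])
    (simp_all add: app_SingC dfn_in[OF assms] del: con_val.simps)

lemma dfnl_sing: "dfnl \<Gamma> \<tau>s F \<Longrightarrow> dfnl \<Gamma> (map Star \<tau>s) (\<lambda>v. sing \<tau>s (F v))"
  unfolding dfnl_iff
  using dfn_sing by (auto intro!: dfn_cong[OF dfn_sing])

lemma dfn_union:
  assumes "dfn \<Gamma> (Star \<sigma>) F" "dfn \<Gamma> (Star \<sigma>) G"
  shows "dfn \<Gamma> (Star \<sigma>) (\<lambda>v. fset_of M \<sigma> (elems M (F v) \<union> elems M (G v)))"
proof -
  have "dfn \<Gamma> (Star \<sigma>) (\<lambda>v. app M (app M (con_val M (UnionC \<sigma>)) (F v)) (G v))"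
    by (intro dfn_app[OF _ assms(2)] dfn_app[OF _ assms(1)] dfn_con) auto
  then show ?thesis
    by (rule dfn_cong)
      (simp add: app_UnionC dfn_in[OF assms(1)] dfn_in[OF assms(2)] del: con_val.simps)
qed

abbreviation unionl :: "ty list \<Rightarrow> 'u list \<Rightarrow> 'u list \<Rightarrow> 'u list" where
  "unionl \<tau>s v w \<equiv>
     map (\<lambda>k. fset_of M (\<tau>s ! k) (elems M (v ! k) \<union> elems M (w ! k))) [0..<length \<tau>s]"

lemma dfnl_union:
  assumes "dfnl \<Gamma> (map Star \<tau>s) F" "dfnl \<Gamma> (map Star \<tau>s) G"
  shows "dfnl \<Gamma> (map Star \<tau>s) (\<lambda>v. unionl \<tau>s (F v) (G v))"
  unfolding dfnl_iff using assms
  by (auto intro!: dfn_union simp: dfnl_iff)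

text \<open>Only this inclusion is wanted. The componentwise union also mixes components of
  \<open>v\<close> and \<open>w\<close>, but additional challenges merely strengthen the hypothesis
  that ranges over them.\<close>

lemma prodl_union:
  assumes "v \<in> tup (map Star \<tau>s)" "w \<in> tup (map Star \<tau>s)" "b \<in> prodl v \<or> b \<in> prodl w"
  shows "b \<in> prodl (unionl \<tau>s v w)"
proof -
  have "elems M (unionl \<tau>s v w ! k) = elems M (v ! k) \<union> elems M (w ! k)" if "k < length \<tau>s" for k
    using tup_nth[OF assms(1), of k] tup_nth[OF assms(2), of k] that by (simp add: elems_union)
  then show ?thesis
    using assms(3) tup_length[OF assms(1)] tup_length[OF assms(2)] by (auto simp: prodl_iff)
qed

text \<open>The body is abstracted to a code and handed to \<open>IUnionC\<close>, which evaluates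
  it only at elements of \<open>A v\<close>; these lie in \<open>carr M \<sigma>\<close>, where the
  code computes.\<close>

lemma dfn_UN:
  assumes "dfn \<Gamma> (Star \<sigma>) A" "dfn (\<Gamma> @ [\<sigma>]) (Star \<tau>) B"
  shows "dfn \<Gamma> (Star \<tau>) (\<lambda>v. fset_of M \<tau> (\<Union>x\<in>elems M (A v). elems M (B (v @ [x]))))"
proof -
  have "dfn \<Gamma> (Star \<tau>) (\<lambda>v. app M (app M (con_val M (IUnionC \<sigma> \<tau>)) (A v))
      (lam M \<sigma> (Star \<tau>) (\<lambda>x. B (v @ [x]))))"
    by (intro dfn_app[OF _ dfn_lam[OF assms(2)]] dfn_app[OF _ assms(1)] dfn_con) auto
  then show ?thesis
  proof (rule dfn_cong)
    fix v assume v: "v \<in> tup \<Gamma>"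
    have B: "B (v @ [x]) \<in> carr M (Star \<tau>)" if "x \<in> carr M \<sigma>" for x
      by (rule dfn_in[OF assms(2)]) (use v that in \<open>simp add: append_tup\<close>)
    have "app M (lam M \<sigma> (Star \<tau>) (\<lambda>x. B (v @ [x]))) x = B (v @ [x])" if "x \<in> elems M (A v)" for x
      using elems_subset[OF dfn_in[OF assms(1) v]] that by (intro app_lam B) auto
    then show "app M (app M (con_val M (IUnionC \<sigma> \<tau>)) (A v)) (lam M \<sigma> (Star \<tau>) (\<lambda>x. B (v @ [x]))) =
        fset_of M \<tau> (\<Union>x\<in>elems M (A v). elems M (B (v @ [x])))"
      using app_IUnionC[OF dfn_in[OF assms(1) v] lam_in[OF B]] by simp
  qed
qed

text \<open>A union over a product is an iterated union, with one use of \<open>IUnionC\<close> for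
  each factor.\<close>

lemma dfn_UN_prodl:
  "dfnl \<Gamma> (map Star \<beta>s) A \<Longrightarrow> dfn (\<Gamma> @ \<beta>s) (Star \<tau>) B \<Longrightarrow>
   dfn \<Gamma> (Star \<tau>) (\<lambda>v. fset_of M \<tau> (\<Union>b\<in>prodl (A v). elems M (B (v @ b))))"
proof (induction \<beta>s arbitrary: \<Gamma> A)
  case Nil
  have "dfn \<Gamma> (Star \<tau>) B" using Nil.prems(2) by simp
  then show ?case
  proof (rule dfn_cong)
    fix v assume v: "v \<in> tup \<Gamma>"
    have "A v = []" using dfnl_in[OF Nil.prems(1) v] by simp
    then show "B v = fset_of M \<tau> (\<Union>b\<in>prodl (A v). elems M (B (v @ b)))"
      using dfn_in[OF \<open>dfn \<Gamma> (Star \<tau>) B\<close> v] by (simp add: fset_of_elems)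
  qed
next
  case (Cons \<beta> \<beta>s)
  have A: "dfn \<Gamma> (Star \<beta>) (\<lambda>v. A v ! 0)" "dfnl \<Gamma> (map Star \<beta>s) (\<lambda>v. drop 1 (A v))"
    using dfnl_nth[OF Cons.prems(1), of 0] dfnl_drop[of \<Gamma> "[Star \<beta>]" "map Star \<beta>s" A] Cons.prems(1)
    by auto
  \<comment> \<open>The remaining factors do not depend on the element chosen from the first, so
    \<open>?A'\<close> ignores the variable added at the end of the context.\<close>
  let ?A' = "\<lambda>v. drop 1 (A (take (length \<Gamma>) v))"
  have IH: "dfn (\<Gamma> @ [\<beta>]) (Star \<tau>) (\<lambda>v. fset_of M \<tau> (\<Union>b\<in>prodl (?A' v). elems M (B (v @ b))))"
    using Cons.IH[of "\<Gamma> @ [\<beta>]" ?A'] dfnl_weaken[OF A(2), of "[\<beta>]"] Cons.prems(2) by simp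
  from dfn_UN[OF A(1) IH] show ?case
  proof (rule dfn_cong)
    fix v assume v: "v \<in> tup \<Gamma>"
    obtain X Xs where X: "A v = X # Xs" "X \<in> carr M (Star \<beta>)" "Xs \<in> tup (map Star \<beta>s)"
      using dfnl_in[OF Cons.prems(1) v] unfolding list.map tup_Cons by blast
    have "elems M (fset_of M \<tau> (\<Union>b\<in>prodl Xs. elems M (B (v @ x # b)))) =
        (\<Union>b\<in>prodl Xs. elems M (B (v @ x # b)))" if "x \<in> elems M X" for x
    proof (rule elems_UN)
      fix b assume "b \<in> prodl Xs"
      then have "v @ x # b \<in> tup (\<Gamma> @ \<beta> # \<beta>s)"
        using v that elems_subset[OF X(2)] prodl_in[OF X(3)] by (auto intro!: append_tup)
      then show "B (v @ x # b) \<in> carr M (Star \<tau>)" by (rule dfn_in[OF Cons.prems(2)])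
    qed (use finite_prodl[OF X(3)] prodl_nonempty[OF X(3)] in auto)
    then show "fset_of M \<tau> (\<Union>x\<in>elems M (A v ! 0). elems M (fset_of M \<tau>
          (\<Union>b\<in>prodl (?A' (v @ [x])). elems M (B ((v @ [x]) @ b))))) =
        fset_of M \<tau> (\<Union>b\<in>prodl (A v). elems M (B (v @ b)))"
      using tup_length[OF v] by (simp add: X(1) prodl_Cons)
  qed
qed

definition UNl :: "ty list \<Rightarrow> 'u list set \<Rightarrow> ('u list \<Rightarrow> 'u list) \<Rightarrow> 'u list" where
  "UNl \<tau>s X B = map (\<lambda>k. fset_of M (\<tau>s ! k) (\<Union>x\<in>X. elems M (B x ! k))) [0..<length \<tau>s]"

lemma dfnl_UN:
  assumes "dfnl \<Gamma> (map Star \<beta>s) A" "dfnl (\<Gamma> @ \<beta>s) (map Star \<tau>s) B"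
  shows "dfnl \<Gamma> (map Star \<tau>s) (\<lambda>v. UNl \<tau>s (prodl (A v)) (\<lambda>b. B (v @ b)))"
  unfolding dfnl_iff
proof (intro conjI ballI allI impI)
  fix k assume "k < length (map Star \<tau>s)"
  then have k: "k < length \<tau>s" by simp
  have "dfn (\<Gamma> @ \<beta>s) (Star (\<tau>s ! k)) (\<lambda>v. B v ! k)"
    using dfnl_nth[OF assms(2)] k by force
  from dfn_UN_prodl[OF assms(1) this]
  show "dfn \<Gamma> (map Star \<tau>s ! k) (\<lambda>v. UNl \<tau>s (prodl (A v)) (\<lambda>b. B (v @ b)) ! k)"
    using k by (simp add: UNl_def)
qed (simp add: UNl_def)

text \<open>As for binary unions, the product of the componentwise unions may exceed the union of
  the products; this direction transfers a hypothesis on the whole to every single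
  \<open>B x\<close>.\<close>

lemma prodl_UN:
  assumes "finite X" "X \<noteq> {}" "\<And>x. x \<in> X \<Longrightarrow> B x \<in> tup (map Star \<tau>s)" "x \<in> X" "b \<in> prodl (B x)"
  shows "b \<in> prodl (UNl \<tau>s X B)"
proof -
  have "elems M (UNl \<tau>s X B ! k) = (\<Union>x\<in>X. elems M (B x ! k))" if k: "k < length \<tau>s" for k
    unfolding UNl_def using k elems_UN[OF assms(1,2), of "\<lambda>x. B x ! k" "\<tau>s ! k"] tup_nth[OF assms(3), of _ k]
    by simp
  then show ?thesis
    using assms(4,5) tup_length[OF assms(3)[OF assms(4)]] by (auto simp: prodl_iff UNl_def)
qed

text \<open>Dummy witnesses are unavoidable, since there is no empty set in a starred type.\<close>

lemma ex_closed_term: "\<exists>t. has_ty \<Gamma> t \<tau>"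
proof (induction \<tau>)
  case NatT
  show ?case by (intro exI[of _ "Con ZeroC"]) simp
next
  case BoolT
  show ?case by (intro exI[of _ "Con FalseC"]) simp
next
  case (Fun \<rho> \<sigma>)
  then obtain t where "has_ty \<Gamma> t \<sigma>" by blast
  then show ?case by (intro exI[of _ "App (Con (PiC \<sigma> \<rho>)) t"]) simp
next
  case (Star \<sigma>)
  then obtain t where "has_ty \<Gamma> t \<sigma>" by blast
  then show ?case by (intro exI[of _ "App (Con (SingC \<sigma>)) t"]) simp
qed

lemma ex_dfnl: "\<exists>F. dfnl \<Gamma> \<tau>s F"
proof (induction \<tau>s)
  case (Cons \<tau> \<tau>s)
  obtain t where "has_ty \<Gamma> t \<tau>" using ex_closed_term by blast
  then have "dfn \<Gamma> \<tau> (\<lambda>v. tm_val M ((!) v) t)" unfolding dfn_def by blast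
  with Cons show ?case by (blast intro: dfnl_Cons)
qed (use dfnl_Nil in blast)

end

section \<open>Entailment of semantic formulas\<close>

text \<open>The index stands for the values of the free variables. The witness types do not vary
  with it, as these values carry no computational information unless a predicate \<open>I\<close>
  supplies it.\<close>

record ('i, 'u) sform =
  ps :: "ty list"
  ns :: "ty list"
  rl :: "'i \<Rightarrow> 'u list \<Rightarrow> 'u list \<Rightarrow> bool"

context omega_star
begin

definition lamsl :: "ty list \<Rightarrow> ty list \<Rightarrow> ('u list \<Rightarrow> 'u list) \<Rightarrow> 'u list" where
  "lamsl \<sigma>s \<tau>s F = map (\<lambda>k. lams M \<sigma>s (\<tau>s ! k) (\<lambda>w. F w ! k)) [0..<length \<tau>s]"

abbreviation aplm :: "'u list \<Rightarrow> 'u list \<Rightarrow> 'u list" where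
  "aplm hs v \<equiv> map (\<lambda>h. apl h v) hs"

lemma dfnl_lamsl:
  assumes "dfnl (\<Gamma> @ \<sigma>s) \<tau>s F"
  shows "dfnl \<Gamma> (map (funs \<sigma>s) \<tau>s) (\<lambda>v. lamsl \<sigma>s \<tau>s (\<lambda>w. F (v @ w)))"
  unfolding dfnl_iff
proof (intro conjI ballI allI impI)
  fix k assume "k < length (map (funs \<sigma>s) \<tau>s)"
  then show "dfn \<Gamma> (map (funs \<sigma>s) \<tau>s ! k) (\<lambda>v. lamsl \<sigma>s \<tau>s (\<lambda>w. F (v @ w)) ! k)"
    using dfn_lams[OF dfnl_nth[OF assms, of k]] by (simp add: lamsl_def)
qed (simp add: lamsl_def)

lemma aplm_lamsl:
  assumes "dfnl (\<Gamma> @ \<sigma>s) \<tau>s F" "v \<in> tup \<Gamma>" "w \<in> tup \<sigma>s"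
  shows "aplm (lamsl \<sigma>s \<tau>s (\<lambda>w. F (v @ w))) w = F (v @ w)"
proof (rule nth_equalityI)
  show "length (aplm (lamsl \<sigma>s \<tau>s (\<lambda>w. F (v @ w))) w) = length (F (v @ w))"
    using tup_length[OF dfnl_in[OF assms(1) append_tup[OF assms(2,3)]]] by (simp add: lamsl_def)
  fix k assume "k < length (aplm (lamsl \<sigma>s \<tau>s (\<lambda>w. F (v @ w))) w)"
  then show "aplm (lamsl \<sigma>s \<tau>s (\<lambda>w. F (v @ w))) w ! k = F (v @ w) ! k"
    using apl_lams_dfn[OF dfnl_nth[OF assms(1), of k] assms(2,3)] by (simp add: lamsl_def)
qed

lemma dfnl_aplm:
  assumes "dfnl \<Gamma> (map (funs \<sigma>s) \<tau>s) F" "dfnl \<Gamma> \<sigma>s G"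
  shows "dfnl \<Gamma> \<tau>s (\<lambda>v. aplm (F v) (G v))"
  unfolding dfnl_iff
proof (intro conjI ballI allI impI)
  show "length (aplm (F v) (G v)) = length \<tau>s" if "v \<in> tup \<Gamma>" for v
    using tup_length[OF dfnl_in[OF assms(1) that]] by simp
  fix k assume k: "k < length \<tau>s"
  have "dfn \<Gamma> (\<tau>s ! k) (\<lambda>v. apl (F v ! k) (G v))"
    by (rule dfn_apl[OF _ assms(2)]) (use dfnl_nth[OF assms(1), of k] k in simp)
  then show "dfn \<Gamma> (\<tau>s ! k) (\<lambda>v. aplm (F v) (G v) ! k)"
    by (rule dfn_cong) (use k tup_length[OF dfnl_in[OF assms(1)]] in simp)
qed

section \<open>Connectives on semantic formulas\<close>

definition conjS :: "('i, 'u) sform \<Rightarrow> ('i, 'u) sform \<Rightarrow> ('i, 'u) sform" where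
  "conjS A B = \<lparr> ps = ps A @ ps B, ns = ns A @ ns B,
     rl = (\<lambda>i a b. rl A i (take (length (ps A)) a) (take (length (ns A)) b) \<and>
                   rl B i (drop (length (ps A)) a) (drop (length (ns A)) b)) \<rparr>"

definition impS :: "('i, 'u) sform \<Rightarrow> ('i, 'u) sform \<Rightarrow> ('i, 'u) sform" where
  "impS A B = \<lparr> ps = imp_pos (ps A) (ns A) (ps B) (ns B), ns = imp_neg (ps A) (ns B),
     rl = (\<lambda>i fg ad.
       (\<forall>b\<in>prodl (aplm (drop (length (ps B)) fg) ad). rl A i (take (length (ps A)) ad) b) \<longrightarrow>
       rl B i (aplm (take (length (ps B)) fg) (take (length (ps A)) ad)) (drop (length (ps A)) ad)) \<rparr>"

definition allS :: "ty \<Rightarrow> ('i \<times> 'u, 'u) sform \<Rightarrow> ('i, 'u) sform" where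
  "allS \<sigma> A = \<lparr> ps = ps A, ns = ns A, rl = (\<lambda>i a b. \<forall>x\<in>carr M \<sigma>. rl A (i, x) a b) \<rparr>"

definition trueS :: "('i, 'u) sform" where
  "trueS = \<lparr> ps = [], ns = [], rl = (\<lambda>_ _ _. True) \<rparr>"

text \<open>Plays the part of substitution: weakening is reindexing along \<open>fst\<close>,
  instantiation along a pairing, and substitution of terms along their evaluation.\<close>

definition reindex :: "('j \<Rightarrow> 'i) \<Rightarrow> ('i, 'u) sform \<Rightarrow> ('j, 'u) sform" where
  "reindex \<pi> A = \<lparr> ps = ps A, ns = ns A, rl = (\<lambda>j. rl A (\<pi> j)) \<rparr>"

lemma conjS_sel [simp]: "ps (conjS A B) = ps A @ ps B" "ns (conjS A B) = ns A @ ns B"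
  by (simp_all add: conjS_def)

lemma rl_conjS:
  "a \<in> tup (ps A) \<Longrightarrow> length b = length (ns A) \<Longrightarrow>
    rl (conjS A B) i (a @ a') (b @ b') \<longleftrightarrow> rl A i a b \<and> rl B i a' b'"
  by (simp add: conjS_def tup_length)

lemma impS_sel [simp]: "ps (impS A B) = imp_pos (ps A) (ns A) (ps B) (ns B)"
    "ns (impS A B) = ps A @ ns B"
  by (simp_all add: impS_def imp_neg_def)

lemma rl_impS:
  "length f = length (ps B) \<Longrightarrow> a \<in> tup (ps A) \<Longrightarrow>
    rl (impS A B) i (f @ g) (a @ d) \<longleftrightarrow>
      ((\<forall>b\<in>prodl (aplm g (a @ d)). rl A i a b) \<longrightarrow> rl B i (aplm f a) d)"
  by (simp add: impS_def tup_length)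

lemma allS_sel [simp]: "ps (allS \<sigma> A) = ps A" "ns (allS \<sigma> A) = ns A"
    "rl (allS \<sigma> A) i a b \<longleftrightarrow> (\<forall>x\<in>carr M \<sigma>. rl A (i, x) a b)"
  by (simp_all add: allS_def)

lemma trueS_sel [simp]: "ps trueS = []" "ns trueS = []" "rl trueS i a b"
  by (simp_all add: trueS_def)

lemma reindex_sel [simp]: "ps (reindex \<pi> A) = ps A" "ns (reindex \<pi> A) = ns A"
    "rl (reindex \<pi> A) j = rl A (\<pi> j)"
  by (simp_all add: reindex_def)

text \<open>This is \<open>impS\<close> with realizers kept as terms in context instead of coded
  functions. They are chosen before \<open>i\<close>, hence serve all of \<open>S\<close> at once;
  \<open>S\<close> is used to collect the indices whose values have the right types.\<close>

definition ent :: "'i set \<Rightarrow> ('i, 'u) sform \<Rightarrow> ('i, 'u) sform \<Rightarrow> bool" where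
  "ent S A B \<longleftrightarrow> (\<exists>f g. dfnl (ps A) (ps B) f \<and> dfnl (ps A @ ns B) (map Star (ns A)) g \<and>
     (\<forall>i\<in>S. \<forall>a\<in>tup (ps A). \<forall>d\<in>tup (ns B).
        (\<forall>b\<in>prodl (g (a @ d)). rl A i a b) \<longrightarrow> rl B i (f a) d))"

lemma entI:
  assumes "dfnl (ps A) (ps B) f" "dfnl (ps A @ ns B) (map Star (ns A)) g"
    "\<And>i a d. \<lbrakk>i \<in> S; a \<in> tup (ps A); d \<in> tup (ns B); \<And>b. b \<in> prodl (g (a @ d)) \<Longrightarrow> rl A i a b\<rbrakk> \<Longrightarrow>
       rl B i (f a) d"
  shows "ent S A B"
  unfolding ent_def using assms by blast

lemma entE:
  assumes "ent S A B"
  obtains f g where "dfnl (ps A) (ps B) f" "dfnl (ps A @ ns B) (map Star (ns A)) g"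
    "\<And>i a d. \<lbrakk>i \<in> S; a \<in> tup (ps A); d \<in> tup (ns B); \<And>b. b \<in> prodl (g (a @ d)) \<Longrightarrow> rl A i a b\<rbrakk> \<Longrightarrow>
       rl B i (f a) d"
  using assms unfolding ent_def by blast

text \<open>Realized by the identity and by singletons: a challenge to \<open>B\<close> is passed on
  to \<open>A\<close> unchanged.\<close>

lemma ent_mono:
  assumes "ps A = ps B" "ns A = ns B"
    "\<And>i a d. \<lbrakk>i \<in> S; a \<in> tup (ps A); d \<in> tup (ns A); rl A i a d\<rbrakk> \<Longrightarrow> rl B i a d"
  shows "ent S A B"
proof (rule entI)
  show "dfnl (ps A) (ps B) (\<lambda>v. v)"
    using dfnl_id assms(1) by simp
  show "dfnl (ps A @ ns B) (map Star (ns A)) (\<lambda>v. sing (ns A) (drop (length (ps A)) v))"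
    using dfnl_sing[OF dfnl_snd] assms(2) by simp
  fix i a d
  assume *: "i \<in> S" "a \<in> tup (ps A)" "d \<in> tup (ns B)"
    "\<And>b. b \<in> prodl (sing (ns A) (drop (length (ps A)) (a @ d))) \<Longrightarrow> rl A i a b"
  have "rl A i a d"
    using *(4)[of d] prodl_sing[of d "ns A"] *(3) assms(2) by (simp add: tup_length[OF *(2)])
  then show "rl B i a d" using assms * by simp
qed

text \<open>A challenge to \<open>C\<close> provokes finitely many challenges to \<open>B\<close>,
  and each of these finitely many challenges to \<open>A\<close>; the union of the latter is the
  challenge set of the composite.\<close>

lemma ent_trans:
  assumes "ent S A B" "ent S B C"
  shows "ent S A C"
proof -
  from assms(1) obtain f1 g1 where f1: "dfnl (ps A) (ps B) f1"
    and g1: "dfnl (ps A @ ns B) (map Star (ns A)) g1"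
    and r1: "\<And>i a d. \<lbrakk>i \<in> S; a \<in> tup (ps A); d \<in> tup (ns B);
      \<And>b. b \<in> prodl (g1 (a @ d)) \<Longrightarrow> rl A i a b\<rbrakk> \<Longrightarrow> rl B i (f1 a) d"
    by (rule entE) (simp only:)
  from assms(2) obtain f2 g2 where f2: "dfnl (ps B) (ps C) f2"
    and g2: "dfnl (ps B @ ns C) (map Star (ns B)) g2"
    and r2: "\<And>i a d. \<lbrakk>i \<in> S; a \<in> tup (ps B); d \<in> tup (ns C);
      \<And>b. b \<in> prodl (g2 (a @ d)) \<Longrightarrow> rl B i a b\<rbrakk> \<Longrightarrow> rl C i (f2 a) d"
    by (rule entE) (simp only:)
  let ?\<Gamma> = "ps A @ ns C"
  \<comment> \<open>\<open>?X\<close> is the set of challenges to \<open>B\<close> provoked by a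
    challenge to \<open>C\<close>. \<open>?B\<close> sends one of its members, stored behind the
    context \<open>?\<Gamma>\<close>, to challenges to \<open>A\<close>, skipping over the challenge
    to \<open>C\<close>.\<close>
  let ?X = "\<lambda>v. g2 (f1 (take (length (ps A)) v) @ drop (length (ps A)) v)"
  let ?B = "\<lambda>v. g1 (take (length (ps A)) (take (length ?\<Gamma>) v) @ drop (length ?\<Gamma>) v)"
  have X: "dfnl ?\<Gamma> (map Star (ns B)) ?X"
    by (intro dfnl_comp[OF g2] dfnl_append dfnl_comp[OF f1] dfnl_fst dfnl_snd)
  have B: "dfnl (?\<Gamma> @ ns B) (map Star (ns A)) ?B"
    by (intro dfnl_comp[OF g1] dfnl_append dfnl_weaken dfnl_fst dfnl_snd)
  show ?thesis
  proof (rule entI)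
    show "dfnl (ps A) (ps C) (\<lambda>v. f2 (f1 v))" by (rule dfnl_comp[OF f2 f1])
    show "dfnl ?\<Gamma> (map Star (ns A)) (\<lambda>v. UNl (ns A) (prodl (?X v)) (\<lambda>b. ?B (v @ b)))"
      by (rule dfnl_UN[OF X B])
    fix i a d
    assume i: "i \<in> S" and a: "a \<in> tup (ps A)" and d: "d \<in> tup (ns C)"
      and h: "\<And>b. b \<in> prodl (UNl (ns A) (prodl (?X (a @ d))) (\<lambda>b. ?B ((a @ d) @ b))) \<Longrightarrow> rl A i a b"
    have ad: "a @ d \<in> tup ?\<Gamma>" using a d by (rule append_tup)
    have X_eq: "?X (a @ d) = g2 (f1 a @ d)" and B_eq: "\<And>b. ?B ((a @ d) @ b) = g1 (a @ b)"
      using tup_length[OF a] tup_length[OF d] by simp_all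
    have X_in: "?X (a @ d) \<in> tup (map Star (ns B))" by (rule dfnl_in[OF X ad])
    show "rl C i (f2 (f1 a)) d"
    proof (rule r2[OF i dfnl_in[OF f1 a] d])
      fix b assume b: "b \<in> prodl (g2 (f1 a @ d))"
      show "rl B i (f1 a) b"
      proof (rule r1[OF i a])
        show "b \<in> tup (ns B)" using prodl_in[OF X_in] b X_eq by simp
        fix c assume c: "c \<in> prodl (g1 (a @ b))"
        show "rl A i a c"
        proof (rule h, rule prodl_UN[OF finite_prodl[OF X_in] prodl_nonempty[OF X_in]])
          show "?B ((a @ d) @ x) \<in> tup (map Star (ns A))" if "x \<in> prodl (?X (a @ d))" for x
            by (rule dfnl_in[OF B append_tup[OF ad prodl_in[OF X_in that]]])
          show "b \<in> prodl (?X (a @ d))" using b X_eq by simp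
          show "c \<in> prodl (?B ((a @ d) @ b))" using c B_eq by simp
        qed
      qed
    qed
  qed
qed

text \<open>The contraction step: both premises challenge the same \<open>X\<close>, and one
  challenge set must serve both, whence the union.\<close>

lemma ent_conjI:
  assumes "ent S X A" "ent S X B"
  shows "ent S X (conjS A B)"
proof -
  from assms(1) obtain f1 g1 where f1: "dfnl (ps X) (ps A) f1"
    and g1: "dfnl (ps X @ ns A) (map Star (ns X)) g1"
    and r1: "\<And>i a d. \<lbrakk>i \<in> S; a \<in> tup (ps X); d \<in> tup (ns A);
      \<And>b. b \<in> prodl (g1 (a @ d)) \<Longrightarrow> rl X i a b\<rbrakk> \<Longrightarrow> rl A i (f1 a) d"
    by (rule entE) (simp only:)
  from assms(2) obtain f2 g2 where f2: "dfnl (ps X) (ps B) f2"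
    and g2: "dfnl (ps X @ ns B) (map Star (ns X)) g2"
    and r2: "\<And>i a d. \<lbrakk>i \<in> S; a \<in> tup (ps X); d \<in> tup (ns B);
      \<And>b. b \<in> prodl (g2 (a @ d)) \<Longrightarrow> rl X i a b\<rbrakk> \<Longrightarrow> rl B i (f2 a) d"
    by (rule entE) (simp only:)
  let ?a = "\<lambda>v. take (length (ps X)) v" and ?d = "\<lambda>v. drop (length (ps X)) v"
  let ?g1 = "\<lambda>v. g1 (?a v @ take (length (ns A)) (?d v))"
  let ?g2 = "\<lambda>v. g2 (?a v @ drop (length (ns A)) (?d v))"
  have 1: "dfnl (ps X @ ns A @ ns B) (map Star (ns X)) ?g1"
    by (intro dfnl_comp[OF g1] dfnl_append dfnl_fst dfnl_take[OF dfnl_snd])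
  have 2: "dfnl (ps X @ ns A @ ns B) (map Star (ns X)) ?g2"
    by (intro dfnl_comp[OF g2] dfnl_append dfnl_fst dfnl_drop[OF dfnl_snd])
  show ?thesis
  proof (rule entI)
    show "dfnl (ps X) (ps (conjS A B)) (\<lambda>v. f1 v @ f2 v)"
      using dfnl_append[OF f1 f2] by simp
    show "dfnl (ps X @ ns (conjS A B)) (map Star (ns X)) (\<lambda>v. unionl (ns X) (?g1 v) (?g2 v))"
      using dfnl_union[OF 1 2] by simp
    fix i a d
    assume i: "i \<in> S" and a: "a \<in> tup (ps X)" and "d \<in> tup (ns (conjS A B))"
      and h: "\<And>b. b \<in> prodl (unionl (ns X) (?g1 (a @ d)) (?g2 (a @ d))) \<Longrightarrow> rl X i a b"
    then obtain d1 d2 where d: "d = d1 @ d2" "d1 \<in> tup (ns A)" "d2 \<in> tup (ns B)"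
      by (auto simp: tup_append)
    have ad: "a @ d \<in> tup (ps X @ ns A @ ns B)" using a d by (auto intro!: append_tup)
    note u = prodl_union[OF dfnl_in[OF 1 ad] dfnl_in[OF 2 ad]]
    have g: "?g1 (a @ d) = g1 (a @ d1)" "?g2 (a @ d) = g2 (a @ d2)"
      using tup_length[OF a] tup_length[OF d(2)] by (simp_all add: d(1))
    have "rl A i (f1 a) d1"
      by (rule r1[OF i a d(2)]) (rule h, rule u, simp only: g simp_thms)
    moreover have "rl B i (f2 a) d2"
      by (rule r2[OF i a d(3)]) (rule h, rule u, simp only: g simp_thms)
    ultimately show "rl (conjS A B) i (f1 a @ f2 a) d"
      using dfnl_in[OF f1 a] tup_length[OF d(2)] by (simp add: d(1) rl_conjS)
  qed
qed

text \<open>A challenge to the conjunction has a component for \<open>B\<close>, which a challenge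
  to \<open>A\<close> does not provide; an arbitrary definable tuple of sets \<open>h\<close> fills
  the place.\<close>

lemma ent_conjD1: "ent S (conjS A B) A"
proof -
  obtain h where h: "dfnl (ps (conjS A B) @ ns A) (map Star (ns B)) h"
    using ex_dfnl by blast
  show ?thesis
  proof (rule entI)
    show "dfnl (ps (conjS A B)) (ps A) (\<lambda>v. take (length (ps A)) v)"
      using dfnl_fst by simp
    show "dfnl (ps (conjS A B) @ ns A) (map Star (ns (conjS A B)))
        (\<lambda>v. sing (ns A) (drop (length (ps (conjS A B))) v) @ h v)"
      using dfnl_append[OF dfnl_sing[OF dfnl_snd] h] by simp
    fix i a d
    assume "a \<in> tup (ps (conjS A B))" and d: "d \<in> tup (ns A)"
      and r: "\<And>b. b \<in> prodl (sing (ns A) (drop (length (ps (conjS A B))) (a @ d)) @ h (a @ d)) \<Longrightarrow>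
        rl (conjS A B) i a b"
    then obtain a1 a2 where a: "a = a1 @ a2" "a1 \<in> tup (ps A)" "a2 \<in> tup (ps B)"
      by (auto simp: tup_append)
    have "a @ d \<in> tup (ps (conjS A B) @ ns A)" using a d by (auto intro!: append_tup)
    \<comment> \<open>Non-emptiness completes \<open>d\<close> to a challenge to the whole
      conjunction; without such a \<open>c\<close> the hypothesis would be void.\<close>
    then obtain c where "c \<in> prodl (h (a @ d))"
      using prodl_nonempty[OF dfnl_in[OF h]] by blast
    then have "rl (conjS A B) i a (d @ c)"
      using prodl_sing[OF d] tup_length[OF a(2)] tup_length[OF a(3)]
      by (intro r) (auto simp: a(1) prodl_append)
    then show "rl A i (take (length (ps A)) a) d"
      using a tup_length[OF a(2)] tup_length[OF d] by (simp add: rl_conjS)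
  qed
qed

lemma ent_conjD2: "ent S (conjS A B) B"
proof -
  obtain h where h: "dfnl (ps (conjS A B) @ ns B) (map Star (ns A)) h"
    using ex_dfnl by blast
  show ?thesis
  proof (rule entI)
    show "dfnl (ps (conjS A B)) (ps B) (\<lambda>v. drop (length (ps A)) v)"
      using dfnl_snd by simp
    show "dfnl (ps (conjS A B) @ ns B) (map Star (ns (conjS A B)))
        (\<lambda>v. h v @ sing (ns B) (drop (length (ps (conjS A B))) v))"
      using dfnl_append[OF h dfnl_sing[OF dfnl_snd]] by simp
    fix i a d
    assume "a \<in> tup (ps (conjS A B))" and d: "d \<in> tup (ns B)"
      and r: "\<And>b. b \<in> prodl (h (a @ d) @ sing (ns B) (drop (length (ps (conjS A B))) (a @ d))) \<Longrightarrow>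
        rl (conjS A B) i a b"
    then obtain a1 a2 where a: "a = a1 @ a2" "a1 \<in> tup (ps A)" "a2 \<in> tup (ps B)"
      by (auto simp: tup_append)
    have ad: "a @ d \<in> tup (ps (conjS A B) @ ns B)" using a d by (auto intro!: append_tup)
    then obtain c where c: "c \<in> prodl (h (a @ d))"
      using prodl_nonempty[OF dfnl_in[OF h]] by blast
    then have "rl (conjS A B) i a (c @ d)"
      using prodl_sing[OF d] tup_length[OF a(2)] tup_length[OF a(3)]
      by (intro r) (auto simp: a(1) prodl_append)
    moreover have "length c = length (ns A)"
      using tup_length[OF prodl_in[OF dfnl_in[OF h ad] c]] .
    ultimately show "rl B i (drop (length (ps A)) a) d"
      using a tup_length[OF a(2)] by (simp add: rl_conjS)
  qed
qed

text \<open>For a formula without positive witnesses truth is enough; the challenges to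
  \<open>X\<close> are dummies.\<close>

lemma ent_true:
  assumes "ps A = []" "\<And>i d. i \<in> S \<Longrightarrow> d \<in> tup (ns A) \<Longrightarrow> rl A i [] d"
  shows "ent S X A"
proof -
  obtain h where "dfnl (ps X @ ns A) (map Star (ns X)) h" using ex_dfnl by blast
  then show ?thesis by (rule entI[rotated]) (use assms in auto)
qed

text \<open>Currying. The challenges to \<open>A\<close>, abstracted over a positive witness of
  \<open>A\<close> and a challenge to \<open>B\<close>, become the second group of positive
  witnesses of the implication, while those to \<open>X\<close> remain challenges.\<close>

lemma ent_impI:
  assumes "ent S (conjS X A) B"
  shows "ent S X (impS A B)"
proof -
  from assms obtain f g where f: "dfnl (ps X @ ps A) (ps B) f"
    and g: "dfnl ((ps X @ ps A) @ ns B) (map Star (ns X @ ns A)) g"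
    and r: "\<And>i a d. \<lbrakk>i \<in> S; a \<in> tup (ps X @ ps A); d \<in> tup (ns B);
      \<And>b. b \<in> prodl (g (a @ d)) \<Longrightarrow> rl (conjS X A) i a b\<rbrakk> \<Longrightarrow> rl B i (f a) d"
    by (rule entE) (simp only: conjS_sel)
  let ?gX = "\<lambda>v. take (length (ns X)) (g v)" and ?gA = "\<lambda>v. drop (length (ns X)) (g v)"
  have gX: "dfnl (ps X @ ps A @ ns B) (map Star (ns X)) ?gX"
    and gA: "dfnl (ps X @ ps A @ ns B) (map Star (ns A)) ?gA"
    using dfnl_take[of _ "map Star (ns X)" "map Star (ns A)" g]
      dfnl_drop[of _ "map Star (ns X)" "map Star (ns A)" g] g by simp_all
  let ?f = "\<lambda>x. lamsl (ps A) (ps B) (\<lambda>a. f (x @ a))"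
  let ?h = "\<lambda>x. lamsl (ps A @ ns B) (map Star (ns A)) (\<lambda>w. ?gA (x @ w))"
  show ?thesis
  proof (rule entI)
    show "dfnl (ps X) (ps (impS A B)) (\<lambda>x. ?f x @ ?h x)"
      using dfnl_append[OF dfnl_lamsl[OF f] dfnl_lamsl[OF gA]] by (simp add: imp_pos_def comp_def)
    show "dfnl (ps X @ ns (impS A B)) (map Star (ns X)) ?gX"
      using gX by simp
    fix i x ad
    assume i: "i \<in> S" and x: "x \<in> tup (ps X)" and "ad \<in> tup (ns (impS A B))"
      and h: "\<And>b. b \<in> prodl (?gX (x @ ad)) \<Longrightarrow> rl X i x b"
    then obtain a d where ad: "ad = a @ d" "a \<in> tup (ps A)" "d \<in> tup (ns B)"
      by (auto simp: tup_append)
    have ad_in: "a @ d \<in> tup (ps A @ ns B)" using ad by (simp add: append_tup)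
    have xad: "x @ a @ d \<in> tup (ps X @ ps A @ ns B)" using x ad_in by (rule append_tup)
    have "rl B i (f (x @ a)) d" if A: "\<forall>b\<in>prodl (?gA (x @ a @ d)). rl A i a b"
    proof (rule r[OF i append_tup[OF x ad(2)] ad(3)])
      fix b assume "b \<in> prodl (g ((x @ a) @ d))"
      then have "b \<in> prodl (?gX (x @ a @ d) @ ?gA (x @ a @ d))" by simp
      then obtain b1 b2 where b: "b = b1 @ b2" "b1 \<in> prodl (?gX (x @ a @ d))"
        "b2 \<in> prodl (?gA (x @ a @ d))"
        unfolding prodl_append by blast
      have "length b1 = length (ns X)"
        using tup_length[OF prodl_in[OF dfnl_in[OF gX xad] b(2)]] .
      then show "rl (conjS X A) i (x @ a) b"
        using h b A x ad(1) by (simp add: rl_conjS)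
    qed
    moreover have "aplm (?f x) a = f (x @ a)"
      by (rule aplm_lamsl[OF f x ad(2)])
    moreover have "aplm (?h x) (a @ d) = ?gA (x @ a @ d)"
      by (rule aplm_lamsl[OF gA x ad_in])
    moreover have "length (?f x) = length (ps B)"
      by (simp add: lamsl_def)
    ultimately show "rl (impS A B) i (?f x @ ?h x) ad"
      using ad(2) by (simp add: ad(1) rl_impS)
  qed
qed

text \<open>The implication is challenged at the single pair of the given witness \<open>a\<close>
  and challenge \<open>d\<close>, and \<open>A\<close> at the sets that the realizer of the
  implication computes from that pair.\<close>

lemma ent_eval: "ent S (conjS (impS A B) A) B"
proof -
  let ?F = "map (funs (ps A)) (ps B)" and ?G = "map (funs (ps A @ ns B)) (map Star (ns A))"
  have P: "ps (impS A B) = ?F @ ?G" by (simp add: imp_pos_def comp_def)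
  let ?\<Gamma> = "(?F @ ?G) @ ps A"
  let ?f = "\<lambda>v. take (length ?F) (take (length (?F @ ?G)) v)"
  let ?g = "\<lambda>v. drop (length ?F) (take (length (?F @ ?G)) v)"
  let ?a = "\<lambda>v. drop (length (?F @ ?G)) v"
  let ?l = "\<lambda>v. take (length ?\<Gamma>) v" and ?d = "\<lambda>v. drop (length ?\<Gamma>) v"
  have f: "dfnl ?\<Gamma> ?F ?f" and g: "dfnl ?\<Gamma> ?G ?g" and a: "dfnl ?\<Gamma> (ps A) ?a"
    by (rule dfnl_take[OF dfnl_fst] dfnl_drop[OF dfnl_fst] dfnl_snd)+
  have ad: "dfnl (?\<Gamma> @ ns B) (ps A @ ns B) (\<lambda>v. ?a (?l v) @ ?d v)"
    by (intro dfnl_append dfnl_weaken[OF a] dfnl_snd)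
  show ?thesis
  proof (rule entI)
    show "dfnl (ps (conjS (impS A B) A)) (ps B) (\<lambda>v. aplm (?f v) (?a v))"
      using dfnl_aplm[OF f a] by (simp only: conjS_sel P)
    show "dfnl (ps (conjS (impS A B) A) @ ns B) (map Star (ns (conjS (impS A B) A)))
        (\<lambda>v. sing (ps A @ ns B) (?a (?l v) @ ?d v) @ aplm (?g (?l v)) (?a (?l v) @ ?d v))"
      using dfnl_append[OF dfnl_sing[OF ad] dfnl_aplm[OF dfnl_weaken[OF g] ad]]
      by (simp only: conjS_sel P impS_sel(2) map_append)
    fix i v d
    assume "v \<in> tup (ps (conjS (impS A B) A))" and d: "d \<in> tup (ns B)"
      and h: "\<And>b. b \<in> prodl (sing (ps A @ ns B) (?a (?l (v @ d)) @ ?d (v @ d)) @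
        aplm (?g (?l (v @ d))) (?a (?l (v @ d)) @ ?d (v @ d))) \<Longrightarrow> rl (conjS (impS A B) A) i v b"
    then obtain f g a where v: "v = (f @ g) @ a" "f \<in> tup ?F" "g \<in> tup ?G" "a \<in> tup (ps A)"
      unfolding conjS_sel P tup_append by blast
    have len: "length f = length (ps B)" "length g = length (ns A)" "length a = length (ps A)"
      using v(2-4)[THEN tup_length] by simp_all
    have ad: "a @ d \<in> tup (ps A @ ns B)" using v(4) d by (rule append_tup)
    have fg: "f @ g \<in> tup (ps (impS A B))" unfolding P using v(2,3) by (rule append_tup)
    have gad: "aplm g (a @ d) \<in> tup (map Star (ns A))"
      using map_apl_in[of g "ps A @ ns B" Star "ns A" "a @ d"] v(3) ad
      by (simp add: comp_def del: foldl_append)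
    have eq: "?a (?l (v @ d)) @ ?d (v @ d) = a @ d" "?g (?l (v @ d)) = g"
      "?f v = f" "?a v = a"
      using len by (simp_all add: v(1))
    have r: "rl (impS A B) i (f @ g) (a @ d) \<and> rl A i a b" if b: "b \<in> prodl (aplm g (a @ d))" for b
    proof -
      have "(a @ d) @ b \<in> prodl (sing (ps A @ ns B) (a @ d) @ aplm g (a @ d))"
        using b prodl_sing[OF ad] unfolding prodl_append by blast
      then have "rl (conjS (impS A B) A) i ((f @ g) @ a) ((a @ d) @ b)"
        using h[unfolded eq] v(1) by simp
      then show ?thesis
        using fg tup_length[OF ad] by (simp add: rl_conjS del: append_assoc)
    qed
    \<comment> \<open>The instance of the implication does not mention \<open>b\<close>, yet
      \<open>r\<close> supplies it only together with some \<open>b\<close>; hence the appeal to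
      non-emptiness.\<close>
    obtain b where "b \<in> prodl (aplm g (a @ d))" using prodl_nonempty[OF gad] by blast
    then have "rl (impS A B) i (f @ g) (a @ d)" using r by blast
    then have "rl B i (aplm f a) d"
      using r len(1) v(4) by (simp add: rl_impS)
    then show "rl B i (aplm (?f v) (?a v)) d" by (simp only: eq)
  qed
qed

lemma ent_mp: "ent S X (impS A B) \<Longrightarrow> ent S X A \<Longrightarrow> ent S X B"
  by (rule ent_trans[OF ent_conjI ent_eval])

lemma ent_reindex: "ent S A B \<Longrightarrow> \<pi> ` S' \<subseteq> S \<Longrightarrow> ent S' (reindex \<pi> A) (reindex \<pi> B)"
  unfolding ent_def reindex_sel by blast

text \<open>The realizers are unchanged: a universal quantifier adds neither witnesses nor
  challenges, only indices.\<close>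

lemma ent_allI: "ent (S \<times> carr M \<sigma>) (reindex fst X) A \<Longrightarrow> ent S X (allS \<sigma> A)"
  unfolding ent_def allS_sel reindex_sel by (elim exE conjE, intro exI conjI, assumption+) auto

section \<open>The predicates, induction and case distinction\<close>

text \<open>Semantic counterpart of \<open>cp_at\<close>, on elements instead of terms;
  \<open>sat_cp_at\<close> relates the two.\<close>

primrec cpr :: "ty \<Rightarrow> 'u \<Rightarrow> 'u list \<Rightarrow> 'u list \<Rightarrow> bool" where
  "cpr NatT x as bs = (x = hd as)"
| "cpr BoolT x as bs = (x = hd as)"
| "cpr (\<rho> \<leadsto> \<sigma>) h as bs =
     (\<forall>x\<in>carr M \<rho>.
       (\<forall>b\<in>prodl (aplm (drop (length (cp_pos \<sigma>)) as) bs). cpr \<rho> x (take (length (cp_pos \<rho>)) bs) b) \<longrightarrow>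
       cpr \<sigma> (app M h x) (aplm (take (length (cp_pos \<sigma>)) as) (take (length (cp_pos \<rho>)) bs))
         (drop (length (cp_pos \<rho>)) bs))"
| "cpr (Star \<sigma>) x as bs = False"

text \<open>The subject is a family over the index, so that derivations can speak of I(t) for a
  value t that varies with the free variables.\<close>

definition inS :: "ty \<Rightarrow> ('i \<Rightarrow> 'u) \<Rightarrow> ('i, 'u) sform" where
  "inS \<sigma> x = \<lparr> ps = cp_pos \<sigma>, ns = cp_neg \<sigma>, rl = (\<lambda>i. cpr \<sigma> (x i)) \<rparr>"

lemma inS_sel [simp]: "ps (inS \<sigma> x) = cp_pos \<sigma>" "ns (inS \<sigma> x) = cp_neg \<sigma>"
    "rl (inS \<sigma> x) i = cpr \<sigma> (x i)"
  by (simp_all add: inS_def)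

lemma inS_fun:
  "inS (\<rho> \<leadsto> \<sigma>) h = allS \<rho> (impS (inS \<rho> snd) (inS \<sigma> (\<lambda>p. app M (h (fst p)) (snd p))))"
  by (simp add: inS_def allS_def impS_def fun_eq_iff)

text \<open>The recursion argument is the last entry of the context, where the witness of I(n)
  stands in the hypothesis "\<open>C\<close> and I(n)" of the induction rule.\<close>

lemma dfnl_rec_last:
  assumes W: "dfnl \<Gamma> \<tau>s W" and F: "dfnl (\<Gamma> @ NatT # \<tau>s) \<tau>s F"
  shows "dfnl (\<Gamma> @ [NatT]) \<tau>s (\<lambda>v. rec_nat (W (take (length \<Gamma>) v))
    (\<lambda>k xs. F (take (length \<Gamma>) v @ num M k # xs)) (nat_of M (v ! length \<Gamma>)))"
proof -
  let ?\<Gamma> = "\<Gamma> @ [NatT]"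
  let ?F = "\<lambda>v. F (take (length \<Gamma>) (take (length ?\<Gamma>) v) @ drop (length ?\<Gamma>) v)"
  have N: "dfn ?\<Gamma> NatT (\<lambda>v. v ! length \<Gamma>)"
    using dfn_var[of "length \<Gamma>" ?\<Gamma>] by simp
  have "dfnl (?\<Gamma> @ NatT # \<tau>s) \<tau>s ?F"
    by (intro dfnl_comp[OF F] dfnl_append dfnl_weaken dfnl_fst dfnl_snd)
  from dfnl_rec[OF N dfnl_weaken[OF W] this] show ?thesis
    by (rule dfnl_cong) (use tup_length in force)
qed

text \<open>The index contains a number of HOL, while the realizers read the number off the witness
  of the guard. Challenges to \<open>C\<close> accumulate backwards: a challenge to D(n+1) provokes
  challenges to \<open>C\<close> and to D(n), and each of the latter is pursued down to
  zero.\<close>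

lemma ent_induct:
  fixes C :: "('i, 'u) sform"
  assumes base: "ent S C (reindex (\<lambda>i. (i, 0)) D)"
    and step: "ent (S \<times> UNIV) (conjS (reindex fst C) (conjS (inS NatT (\<lambda>p. num M (snd p))) D))
      (reindex (\<lambda>p. (fst p, Suc (snd p))) D)"
  shows "ent (S \<times> UNIV) (conjS (reindex fst C) (inS NatT (\<lambda>p. num M (snd p)))) D"
proof -
  let ?C = "ps C" and ?D = "ps D" and ?H = "map (funs (ns D)) (map Star (ns C))"
  let ?n = "length (ns C)"
  from base obtain f0 g0 where f0: "dfnl ?C ?D f0"
    and g0: "dfnl (?C @ ns D) (map Star (ns C)) g0"
    and r0: "\<And>i a d. \<lbrakk>i \<in> S; a \<in> tup ?C; d \<in> tup (ns D);
      \<And>b. b \<in> prodl (g0 (a @ d)) \<Longrightarrow> rl C i a b\<rbrakk> \<Longrightarrow> rl D (i, 0) (f0 a) d"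
    by (rule entE) (simp only: reindex_sel)
  from step obtain f1 g1 where f1: "dfnl (?C @ NatT # ?D) ?D f1"
    and g1: "dfnl ((?C @ NatT # ?D) @ ns D) (map Star (ns C @ ns D)) g1"
    and r1: "\<And>p a d. \<lbrakk>p \<in> S \<times> UNIV; a \<in> tup (?C @ NatT # ?D); d \<in> tup (ns D);
      \<And>b. b \<in> prodl (g1 (a @ d)) \<Longrightarrow>
        rl (conjS (reindex fst C) (conjS (inS NatT (\<lambda>p. num M (snd p))) D)) p a b\<rbrakk> \<Longrightarrow>
      rl D (fst p, Suc (snd p)) (f1 a) d"
    by (rule entE) (simp only: reindex_sel conjS_sel inS_sel cp_pos.simps cp_neg.simps append.simps)
  \<comment> \<open>The positive witness of D(n), obtained by iterating the step from the base.
    \<open>FF'\<close> is the same function on a context that ends in the numeral.\<close>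
  define FF where "FF c n = rec_nat (f0 c) (\<lambda>k xs. f1 (c @ num M k # xs)) n" for c n
  define FF' where "FF' v = FF (take (length ?C) v) (nat_of M (v ! length ?C))" for v
  have FF': "dfnl (?C @ [NatT]) ?D FF'"
    unfolding FF'_def FF_def by (rule dfnl_rec_last[OF f0 f1])
  have FF'_eq: "FF' (c @ [num M k]) = FF c k" if "c \<in> tup ?C" for c k
    using that by (simp add: FF'_def tup_length nth_append)
  have FF_in: "FF c k \<in> tup ?D" if "c \<in> tup ?C" for c k
    using dfnl_in[OF FF', of "c @ [num M k]"] FF'_eq[OF that] that by (simp add: append_tup)
  \<comment> \<open>The context of one step for the challenges: a witness of \<open>C\<close>, a
    number k, and the functions \<open>?h\<close> sending a challenge to D(k) to challenges to
    \<open>C\<close>. In \<open>?\<Gamma>\<close> a challenge to D(k+1) follows.\<close>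
  let ?L = "?C @ NatT # ?H"
  let ?\<Gamma> = "?L @ ns D"
  let ?l = "\<lambda>w. take (length ?L) w" and ?d = "\<lambda>w. drop (length ?L) w"
  let ?c = "\<lambda>w. take (length ?C) (?l w)" and ?nh = "\<lambda>w. drop (length ?C) (?l w)"
  let ?k = "\<lambda>w. take (length [NatT]) (?nh w)" and ?h = "\<lambda>w. drop (length [NatT]) (?nh w)"
  let ?u = "\<lambda>w. g1 ((?c w @ ?k w @ FF' (?c w @ ?k w)) @ ?d w)"
  let ?B = "\<lambda>v. aplm (?h (take (length ?\<Gamma>) v)) (drop (length ?\<Gamma>) v)"
  \<comment> \<open>The tuple \<open>?u\<close> splits into challenges to \<open>C\<close>, which
    are kept, and challenges to D(k), to which the functions \<open>?h\<close> of the previous stage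
    are applied; both results are merged.\<close>
  define body where "body w =
    unionl (ns C) (take ?n (?u w)) (UNl (ns C) (prodl (drop ?n (?u w))) (\<lambda>b. ?B (w @ b)))" for w
  have c: "dfnl ?\<Gamma> ?C ?c" by (rule dfnl_weaken[OF dfnl_fst])
  have nh: "dfnl ?\<Gamma> ([NatT] @ ?H) ?nh"
    using dfnl_weaken[OF dfnl_snd[of ?C "NatT # ?H"]] by simp
  have k: "dfnl ?\<Gamma> [NatT] ?k" and h: "dfnl ?\<Gamma> ?H ?h"
    by (rule dfnl_take[OF nh] dfnl_drop[OF nh])+
  have "dfnl ?\<Gamma> ((?C @ [NatT] @ ?D) @ ns D)
      (\<lambda>w. (?c w @ ?k w @ FF' (?c w @ ?k w)) @ ?d w)"
    by (intro dfnl_append c k dfnl_comp[OF FF'] dfnl_snd)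
  then have u: "dfnl ?\<Gamma> (map Star (ns C) @ map Star (ns D)) ?u"
    using dfnl_comp[OF g1] by simp
  have uC: "dfnl ?\<Gamma> (map Star (ns C)) (\<lambda>w. take ?n (?u w))"
    and uD: "dfnl ?\<Gamma> (map Star (ns D)) (\<lambda>w. drop ?n (?u w))"
    using dfnl_take[OF u] dfnl_drop[OF u] by simp_all
  have B: "dfnl (?\<Gamma> @ ns D) (map Star (ns C)) ?B"
    by (rule dfnl_aplm[OF dfnl_weaken[OF h] dfnl_snd])
  have UN: "dfnl ?\<Gamma> (map Star (ns C))
      (\<lambda>w. UNl (ns C) (prodl (drop ?n (?u w))) (\<lambda>b. ?B (w @ b)))"
    by (rule dfnl_UN[OF uD B])
  have body: "dfnl ?\<Gamma> (map Star (ns C)) body"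
    unfolding body_def by (rule dfnl_union[OF uC UN])
  \<comment> \<open>The values are tuples of functions, because \<open>body\<close> evaluates the
    previous stage at members of \<open>prodl (drop ?n (?u w))\<close> and not at the challenge
    \<open>d\<close> it was given.\<close>
  define GG where "GG c n = rec_nat (lamsl (ns D) (map Star (ns C)) (\<lambda>d. g0 (c @ d)))
    (\<lambda>k xs. lamsl (ns D) (map Star (ns C)) (\<lambda>d. body ((c @ num M k # xs) @ d))) n" for c n
  define GG' where "GG' v = GG (take (length ?C) v) (nat_of M (v ! length ?C))" for v
  have GG': "dfnl (?C @ [NatT]) ?H GG'"
    unfolding GG'_def GG_def by (rule dfnl_rec_last[OF dfnl_lamsl[OF g0] dfnl_lamsl[OF body]])
  have GG'_eq: "GG' (c @ [num M k]) = GG c k" if "c \<in> tup ?C" for c k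
    using that by (simp add: GG'_def tup_length nth_append)
  have GG_in: "GG c k \<in> tup ?H" if "c \<in> tup ?C" for c k
    using dfnl_in[OF GG', of "c @ [num M k]"] GG'_eq[OF that] that by (simp add: append_tup)
  have main: "rl D (i, k) (FF c k) d"
    if i: "i \<in> S" and c: "c \<in> tup ?C" and "d \<in> tup (ns D)"
      and "\<And>b. b \<in> prodl (aplm (GG c k) d) \<Longrightarrow> rl C i c b" for i k c d
    using that(3,4)
  proof (induction k arbitrary: d)
    case 0
    have "aplm (GG c 0) d = g0 (c @ d)"
      using aplm_lamsl[OF g0 c 0(1)] by (simp add: GG_def)
    then show ?case using r0[OF i c 0(1)] 0(2) by (simp add: FF_def)
  next
    case (Suc k)
    let ?v = "c @ num M k # GG c k"
    have v: "?v \<in> tup ?L" using c GG_in[OF c] by (intro append_tup) simp_all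
    have w: "?v @ d \<in> tup ?\<Gamma>" using v Suc.prems(1) by (rule append_tup)
    have eq: "aplm (GG c (Suc k)) d = body (?v @ d)"
      using aplm_lamsl[OF body v Suc.prems(1)] by (simp add: GG_def)
    have lens: "length c = length ?C" "length (GG c k) = length ?H" "length d = length (ns D)"
      using c GG_in[OF c] Suc.prems(1) by (simp_all only: tup_length)
    have proj: "?c (?v @ d) = c" "?k (?v @ d) = [num M k]" "?h (?v @ d) = GG c k" "?d (?v @ d) = d"
      "\<And>b. ?B ((?v @ d) @ b) = aplm (GG c k) b"
      using lens by simp_all
    define U where "U = g1 ((c @ num M k # FF c k) @ d)"
    have u_eq: "?u (?v @ d) = U"
      unfolding proj FF'_eq[OF c] U_def by simp
    have U_in: "take ?n U \<in> tup (map Star (ns C))" "drop ?n U \<in> tup (map Star (ns D))"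
      using dfnl_in[OF uC w] dfnl_in[OF uD w] unfolding u_eq .
    have body_eq: "body (?v @ d) = unionl (ns C) (take ?n U)
        (UNl (ns C) (prodl (drop ?n U)) (\<lambda>b. aplm (GG c k) b))"
      unfolding body_def u_eq unfolding proj ..
    have UN_in: "UNl (ns C) (prodl (drop ?n U)) (\<lambda>b. aplm (GG c k) b) \<in> tup (map Star (ns C))"
      using dfnl_in[OF UN w] unfolding u_eq unfolding proj .
    have ap_in: "aplm (GG c k) b \<in> tup (map Star (ns C))" if "b \<in> tup (ns D)" for b
      using map_apl_in[of "GG c k" "ns D" Star "ns C" b] GG_in[OF c, of k] that by (simp add: comp_def)
    \<comment> \<open>The two parts of the merged set supply the hypotheses of the step:
      \<open>C\<close> directly, and D(k) through the induction hypothesis at each of its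
      challenges.\<close>
    have C1: "rl C i c b" if "b \<in> prodl (take ?n U)" for b
      by (rule Suc.prems(2), unfold eq body_eq, rule prodl_union[OF U_in(1) UN_in]) (use that in simp)
    have D1: "rl D (i, k) (FF c k) d'" if d': "d' \<in> prodl (drop ?n U)" for d'
    proof (rule Suc.IH)
      show "d' \<in> tup (ns D)" using U_in(2) d' by (rule prodl_in)
      fix b assume "b \<in> prodl (aplm (GG c k) d')"
      then have "b \<in> prodl (UNl (ns C) (prodl (drop ?n U)) (\<lambda>b. aplm (GG c k) b))"
        by (intro prodl_UN[OF finite_prodl[OF U_in(2)] prodl_nonempty[OF U_in(2)] _ d'])
          (use ap_in prodl_in[OF U_in(2)] in simp_all)
      then show "rl C i c b"
        by (intro Suc.prems(2), unfold eq body_eq, intro prodl_union[OF U_in(1) UN_in]) simp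
    qed
    have "rl D (fst (i, k), Suc (snd (i, k))) (f1 (c @ num M k # FF c k)) d"
    proof (rule r1)
      show "(i, k) \<in> S \<times> UNIV" using i by simp
      show "c @ num M k # FF c k \<in> tup (?C @ NatT # ?D)"
        using c FF_in[OF c] by (intro append_tup) simp_all
      show "d \<in> tup (ns D)" by fact
      fix b assume "b \<in> prodl (g1 ((c @ num M k # FF c k) @ d))"
      then have "b \<in> prodl (take ?n U @ drop ?n U)" by (simp add: U_def)
      then obtain b1 b2 where b: "b = b1 @ b2" "b1 \<in> prodl (take ?n U)" "b2 \<in> prodl (drop ?n U)"
        unfolding prodl_append by blast
      have l: "length b1 = ?n" using tup_length[OF prodl_in[OF U_in(1) b(2)]] .
      show "rl (conjS (reindex fst C) (conjS (inS NatT (\<lambda>p. num M (snd p))) D)) (i, k)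
          (c @ num M k # FF c k) b"
        using rl_conjS[of c "reindex fst C" b1 "conjS (inS NatT (\<lambda>p. num M (snd p))) D" "(i, k)"
            "num M k # FF c k" b2]
          rl_conjS[of "[num M k]" "inS NatT (\<lambda>p. num M (snd p))" "[]" D "(i, k)" "FF c k" b2]
          c l C1[OF b(2)] D1[OF b(3)] b(1)
        by simp
    qed
    then show ?case by (simp add: FF_def)
  qed
  let ?G = "\<lambda>v. aplm (GG' (take (length (?C @ [NatT])) v)) (drop (length (?C @ [NatT])) v)"
  show ?thesis
  proof (rule entI)
    show "dfnl (ps (conjS (reindex fst C) (inS NatT (\<lambda>p. num M (snd p))))) ?D FF'"
      using FF' by simp
    have "dfnl ((?C @ [NatT]) @ ns D) (map Star (ns C)) ?G"
      by (rule dfnl_aplm[OF dfnl_weaken[OF GG'] dfnl_snd])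
    then show "dfnl (ps (conjS (reindex fst C) (inS NatT (\<lambda>p. num M (snd p)))) @ ns D)
        (map Star (ns (conjS (reindex fst C) (inS NatT (\<lambda>p. num M (snd p)))))) ?G"
      by simp
    fix p a d
    assume p: "p \<in> S \<times> (UNIV :: nat set)"
      and a: "a \<in> tup (ps (conjS (reindex fst C) (inS NatT (\<lambda>p. num M (snd p)))))"
      and d: "d \<in> tup (ns D)"
      and r: "\<And>b. b \<in> prodl (?G (a @ d)) \<Longrightarrow>
        rl (conjS (reindex fst C) (inS NatT (\<lambda>p. num M (snd p)))) p a b"
    obtain i k where p_eq: "p = (i, k)" and i: "i \<in> S" using p by auto
    obtain c x where a_eq: "a = c @ [x]" and c: "c \<in> tup ?C" and x: "x \<in> carr M NatT"
      using a by (auto simp: tup_append tup_Cons)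
    define k' where "k' = nat_of M x"
    have x_eq: "x = num M k'" using x by (simp add: k'_def)
    have G_eq: "?G (a @ d) = aplm (GG c k') d"
      using GG'_eq[OF c, of k'] tup_length[OF c] by (simp add: a_eq x_eq)
    have Gin: "aplm (GG c k') d \<in> tup (map Star (ns C))"
      using map_apl_in[of "GG c k'" "ns D" Star "ns C" d] GG_in[OF c, of k'] d by (simp add: comp_def)
    have *: "rl C i c b \<and> num M k = x" if "b \<in> prodl (aplm (GG c k') d)" for b
    proof -
      have "length b = ?n" using tup_length[OF prodl_in[OF Gin that]] .
      then show ?thesis
        using r[of b, unfolded G_eq, OF that] c
          rl_conjS[of c "reindex fst C" b "inS NatT (\<lambda>p. num M (snd p))" p "[x]" "[]"]
        by (simp add: a_eq p_eq)
    qed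
    \<comment> \<open>Some challenge exists, and the guard, which holds along with it, identifies
      the number \<open>k'\<close> of the witness with the index \<open>k\<close>.\<close>
    obtain b where "b \<in> prodl (aplm (GG c k') d)" using prodl_nonempty[OF Gin] by blast
    then have k: "k' = k" using * by (auto simp: x_eq)
    show "rl D p (FF' a) d"
      using main[OF i c d, of k] * FF'_eq[OF c, of k] by (simp add: p_eq a_eq x_eq k)
  qed
qed

text \<open>The two realizers are joined by the conditional on the witness of the guard, for
  positive witnesses and challenge sets alike. Only the selected case puts challenges, so no union
  arises.\<close>

lemma ent_bool_cases:
  fixes C :: "('i, 'u) sform"
  assumes "ent S C (reindex (\<lambda>i. (i, False)) D)" "ent S C (reindex (\<lambda>i. (i, True)) D)"
  shows "ent (S \<times> UNIV) (conjS (reindex fst C) (inS BoolT (\<lambda>p. boo M (snd p)))) D"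
proof -
  let ?A = "conjS (reindex fst C) (inS BoolT (\<lambda>p. boo M (snd p)))"
  from assms(1) obtain f0 g0 where f0: "dfnl (ps C) (ps D) f0"
    and g0: "dfnl (ps C @ ns D) (map Star (ns C)) g0"
    and r0: "\<And>i a d. \<lbrakk>i \<in> S; a \<in> tup (ps C); d \<in> tup (ns D);
      \<And>b. b \<in> prodl (g0 (a @ d)) \<Longrightarrow> rl C i a b\<rbrakk> \<Longrightarrow> rl D (i, False) (f0 a) d"
    by (rule entE) (simp only: reindex_sel)
  from assms(2) obtain f1 g1 where f1: "dfnl (ps C) (ps D) f1"
    and g1: "dfnl (ps C @ ns D) (map Star (ns C)) g1"
    and r1: "\<And>i a d. \<lbrakk>i \<in> S; a \<in> tup (ps C); d \<in> tup (ns D);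
      \<And>b. b \<in> prodl (g1 (a @ d)) \<Longrightarrow> rl C i a b\<rbrakk> \<Longrightarrow> rl D (i, True) (f1 a) d"
    by (rule entE) (simp only: reindex_sel)
  let ?\<Gamma> = "ps C @ [BoolT]"
  let ?c = "\<lambda>v. take (length (ps C)) v" and ?l = "\<lambda>v. take (length ?\<Gamma>) v"
  let ?f = "\<lambda>v. if bool_of M (v ! length (ps C)) then f1 (?c v) else f0 (?c v)"
  let ?cd = "\<lambda>v. ?c (?l v) @ drop (length ?\<Gamma>) v"
  let ?g = "\<lambda>v. if bool_of M (v ! length (ps C)) then g1 (?cd v) else g0 (?cd v)"
  have f: "dfnl ?\<Gamma> (ps D) ?f"
    using dfn_var[of "length (ps C)" ?\<Gamma>]
    by (intro dfnl_cond dfnl_weaken f0 f1) simp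
  have cd: "dfnl (?\<Gamma> @ ns D) (ps C @ ns D) ?cd"
    by (intro dfnl_append dfnl_weaken[OF dfnl_fst] dfnl_snd)
  have g: "dfnl (?\<Gamma> @ ns D) (map Star (ns C)) ?g"
    using dfn_var[of "length (ps C)" "?\<Gamma> @ ns D"]
    by (intro dfnl_cond dfnl_comp[OF g0 cd] dfnl_comp[OF g1 cd]) (simp add: nth_append)
  show ?thesis
  proof (rule entI)
    show "dfnl (ps ?A) (ps D) ?f" using f by simp
    show "dfnl (ps ?A @ ns D) (map Star (ns ?A)) ?g" using g by simp
    fix p a d
    assume p: "p \<in> S \<times> (UNIV :: bool set)" and a: "a \<in> tup (ps ?A)" and d: "d \<in> tup (ns D)"
      and r: "\<And>b. b \<in> prodl (?g (a @ d)) \<Longrightarrow> rl ?A p a b"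
    obtain i k where p_eq: "p = (i, k)" and i: "i \<in> S" using p by auto
    obtain c x where a_eq: "a = c @ [x]" and c: "c \<in> tup (ps C)" and x: "x \<in> carr M BoolT"
      using a by (auto simp: tup_append tup_Cons)
    have g_eq: "?g (a @ d) = (if bool_of M x then g1 (c @ d) else g0 (c @ d))"
      and f_eq: "?f a = (if bool_of M x then f1 c else f0 c)"
      using tup_length[OF c] by (simp_all add: a_eq nth_append)
    have gin: "?g (a @ d) \<in> tup (map Star (ns C))"
      by (rule dfnl_in[OF g]) (use a d in \<open>simp add: append_tup del: append_assoc\<close>)
    have *: "rl C i c b \<and> boo M k = x" if b: "b \<in> prodl (?g (a @ d))" for b
    proof -
      have "length b = length (ns C)" using tup_length[OF prodl_in[OF gin b]] .
      then show ?thesis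
        using r[OF b] c rl_conjS[of c "reindex fst C" b "inS BoolT (\<lambda>p. boo M (snd p))" p "[x]" "[]"]
        by (simp add: a_eq p_eq)
    qed
    \<comment> \<open>Non-emptiness again makes the guard available, which equates the index with
      the witness.\<close>
    obtain b where "b \<in> prodl (?g (a @ d))" using prodl_nonempty[OF gin] by blast
    then have "boo M k = x" using * by blast
    then have k: "bool_of M x = k" by auto
    show "rl D p (?f a) d"
    proof (cases k)
      case True
      then show ?thesis using r1[OF i c d] * k unfolding f_eq g_eq p_eq by simp
    next
      case False
      then show ?thesis using r0[OF i c d] * k unfolding f_eq g_eq p_eq by simp
    qed
  qed
qed

end

section \<open>Translation of formulas\<close>

lemma cp_base_sel [simp]: "bpos cp_base = cp_pos" "bneg cp_base = cp_neg"
  by (simp_all add: cp_base_def)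

lemma shift_Var [simp]: "shift k (Var n) = Var (n + k)"
  by (simp add: shift_def)

lemma shift_Con [simp]: "shift k (Con c) = Con c"
  by (simp add: shift_def)

lemma up_simps [simp]: "up s 0 = Var 0" "up s (Suc n) = shift 1 (s n)"
  by (simp_all add: up_def)

section \<open>Typing of the translated formulas\<close>

lemma has_ty_shift: "has_ty \<Gamma> t \<sigma> \<Longrightarrow> length \<Theta> = k \<Longrightarrow> has_ty (\<Theta> @ \<Gamma>) (shift k t) \<sigma>"
  unfolding shift_def by (erule has_ty_sub) (simp add: nth_append)

lemma has_ty_weaken: "has_ty \<Gamma> t \<sigma> \<Longrightarrow> has_ty (\<Gamma> @ \<Delta>) t \<sigma>"
proof (induction t arbitrary: \<sigma>)
  case (App t u)
  then show ?case by (simp, blast)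
qed (simp_all add: nth_append)

lemma has_ty_up:
  assumes "\<And>n. n < length \<Gamma> \<Longrightarrow> has_ty \<Delta> (s n) (\<Gamma> ! n)" "n < length (\<sigma> # \<Gamma>)"
  shows "has_ty (\<sigma> # \<Delta>) (up s n) ((\<sigma> # \<Gamma>) ! n)"
  using assms has_ty_shift[of \<Delta> _ _ "[\<sigma>]" 1] by (cases n) auto

lemma wf_fm_fsub:
  "wf_fm \<Gamma> A \<Longrightarrow> (\<And>n. n < length \<Gamma> \<Longrightarrow> has_ty \<Delta> (s n) (\<Gamma> ! n)) \<Longrightarrow> wf_fm \<Delta> (fsub s A)"
proof (induction A arbitrary: \<Gamma> \<Delta> s)
  case (All \<sigma> A)
  have "wf_fm (\<sigma> # \<Delta>) (fsub (up s) A)"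
    by (rule All.IH[of "\<sigma> # \<Gamma>"]) (use All.prems has_ty_up[of \<Gamma> \<Delta> s] in auto)
  then show ?case by simp
next
  case (Ex \<sigma> A)
  have "wf_fm (\<sigma> # \<Delta>) (fsub (up s) A)"
    by (rule Ex.IH[of "\<sigma> # \<Gamma>"]) (use Ex.prems has_ty_up[of \<Gamma> \<Delta> s] in auto)
  then show ?case by simp
next
  case (Eq \<sigma> t u)
  then show ?case using has_ty_sub[of \<Gamma> _ \<sigma> \<Delta> s] by simp
next
  case (Pred \<sigma> t)
  then show ?case using has_ty_sub[of \<Gamma> _ \<sigma> \<Delta> s] by simp
next
  case (And A B)
  then show ?case using And.IH[of \<Gamma> \<Delta> s] by simp
next
  case (Imp A B)
  then show ?case using Imp.IH[of \<Gamma> \<Delta> s] by simp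
qed simp

lemma pred_free_fsub [simp]: "pred_free (fsub s A) = pred_free A"
  by (induction A arbitrary: s) auto

lemma wf_fm_close: "wf_fm \<Delta> (close \<Gamma> A) \<longleftrightarrow> wf_fm (\<Gamma> @ \<Delta>) A"
  by (induction \<Gamma> arbitrary: A) auto

lemma pred_free_close [simp]: "pred_free (close \<Gamma> A) = pred_free A"
  by (induction \<Gamma> arbitrary: A) auto

lemma wf_fm_balls:
  "list_all2 (has_ty \<Delta>) Bs (map Star \<beta>s) \<Longrightarrow> wf_fm (\<beta>s @ \<Delta>) A \<Longrightarrow> wf_fm \<Delta> (balls \<beta>s Bs A)"
proof (induction \<beta>s arbitrary: Bs A)
  case (Cons \<beta> \<beta>s)
  from Cons.prems(1) obtain B Bs' where Bs: "Bs = B # Bs'" "has_ty \<Delta> B (Star \<beta>)"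
    "list_all2 (has_ty \<Delta>) Bs' (map Star \<beta>s)"
    by (auto simp: list_all2_Cons2)
  have "has_ty (\<beta> # \<beta>s @ \<Delta>) (shift (Suc (length \<beta>s)) B) (Star \<beta>)"
    using has_ty_shift[OF Bs(2), of "\<beta> # \<beta>s"] by simp
  then show ?case using Cons.prems(2) Bs by (auto intro!: Cons.IH simp: mem_fm_def)
qed simp

lemma pred_free_balls [simp]: "pred_free (balls \<beta>s Bs A) = pred_free A"
  by (induction \<beta>s Bs A rule: balls.induct) (auto simp: mem_fm_def)

lemma has_ty_vars: "list_all2 (has_ty (\<beta>s @ \<Delta>)) (vars (length \<beta>s)) \<beta>s"
  by (simp add: list_all2_conv_all_nth nth_append)

lemma list_all2_shift:
  "list_all2 (has_ty \<Gamma>) ts \<sigma>s \<Longrightarrow> length \<Theta> = k \<Longrightarrow>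
    list_all2 (has_ty (\<Theta> @ \<Gamma>)) (map (shift k) ts) \<sigma>s"
  by (simp add: list_all2_conv_all_nth has_ty_shift)

lemma list_all2_apps:
  "list_all2 (has_ty \<Gamma>) ts (map (\<lambda>\<tau>. funs \<sigma>s (F \<tau>)) \<tau>s) \<Longrightarrow> list_all2 (has_ty \<Gamma>) us \<sigma>s \<Longrightarrow>
    list_all2 (has_ty \<Gamma>) (map (\<lambda>t. apps t us) ts) (map F \<tau>s)"
  by (auto simp: list_all2_map1 list_all2_map2 intro: has_ty_apps elim!: list_all2_mono)

lemma list_all2_append2_take_drop:
  assumes "list_all2 P xs (ys @ zs)"
  shows "list_all2 P (take (length ys) xs) ys" "list_all2 P (drop (length ys) xs) zs"
  using assms by (auto simp: list_all2_append2 dest: list_all2_lengthD)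

lemma wf_cp_at:
  "has_ty \<Gamma> x \<sigma> \<Longrightarrow> list_all2 (has_ty \<Gamma>) as (cp_pos \<sigma>) \<Longrightarrow> list_all2 (has_ty \<Gamma>) bs (cp_neg \<sigma>) \<Longrightarrow>
    wf_fm \<Gamma> (cp_at \<sigma> x as bs) \<and> pred_free (cp_at \<sigma> x as bs)"
proof (induction \<sigma> arbitrary: \<Gamma> x as bs)
  case (Fun \<rho> \<sigma>)
  let ?f = "take (length (cp_pos \<sigma>)) as" and ?g = "drop (length (cp_pos \<sigma>)) as"
  let ?a = "take (length (cp_pos \<rho>)) bs" and ?d = "drop (length (cp_pos \<rho>)) bs"
  have as: "list_all2 (has_ty \<Gamma>) as (map (\<lambda>\<tau>. funs (cp_pos \<rho>) \<tau>) (cp_pos \<sigma>) @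
      map (\<lambda>\<beta>. funs (cp_pos \<rho> @ cp_neg \<sigma>) (Star \<beta>)) (cp_neg \<rho>))"
    using Fun.prems(2) by (simp add: imp_pos_def)
  have f: "list_all2 (has_ty \<Gamma>) ?f (map (\<lambda>\<tau>. funs (cp_pos \<rho>) \<tau>) (cp_pos \<sigma>))"
    and g: "list_all2 (has_ty \<Gamma>) ?g (map (\<lambda>\<beta>. funs (cp_pos \<rho> @ cp_neg \<sigma>) (Star \<beta>)) (cp_neg \<rho>))"
    using list_all2_append2_take_drop[OF as] by simp_all
  have bs: "list_all2 (has_ty \<Gamma>) bs (cp_pos \<rho> @ cp_neg \<sigma>)"
    using Fun.prems(3) by (simp add: imp_neg_def)
  note a = list_all2_append2_take_drop(1)[OF bs] and d = list_all2_append2_take_drop(2)[OF bs]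
  have 1: "list_all2 (has_ty (\<rho> # \<Gamma>)) (map (\<lambda>t. shift 1 (apps t (?a @ ?d))) ?g) (map Star (cp_neg \<rho>))"
    using list_all2_shift[OF list_all2_apps[where F = Star, OF g bs], of "[\<rho>]" 1] by (simp add: comp_def)
  have 2: "list_all2 (has_ty (\<rho> # \<Gamma>)) (map (\<lambda>t. shift 1 (apps t ?a)) ?f) (cp_pos \<sigma>)"
    using list_all2_shift[OF list_all2_apps[where F = "\<lambda>x. x", OF f a], of "[\<rho>]" 1] by (simp add: comp_def)
  have 3: "list_all2 (has_ty (cp_neg \<rho> @ \<rho> # \<Gamma>)) (map (shift (Suc (length (cp_neg \<rho>)))) ?a) (cp_pos \<rho>)"
    using list_all2_shift[OF a, of "cp_neg \<rho> @ [\<rho>]"] by simp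
  have 4: "list_all2 (has_ty (\<rho> # \<Gamma>)) (map (shift 1) ?d) (cp_neg \<sigma>)"
    using list_all2_shift[OF d, of "[\<rho>]" 1] by simp
  have 5: "has_ty (\<rho> # \<Gamma>) (App (shift 1 x) (Var 0)) \<sigma>"
    using has_ty_shift[OF Fun.prems(1), of "[\<rho>]" 1] by simp
  have 6: "has_ty (cp_neg \<rho> @ \<rho> # \<Gamma>) (Var (length (cp_neg \<rho>))) \<rho>"
    by (simp add: nth_append)
  show ?case
    using wf_fm_balls[OF 1, of "cp_at \<rho> (Var (length (cp_neg \<rho>)))
          (map (shift (Suc (length (cp_neg \<rho>)))) ?a) (vars (length (cp_neg \<rho>)))"]
      Fun.IH(1)[OF 6 3 has_ty_vars] Fun.IH(2)[OF 5 2 4] 1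
    by (simp add: Let_def del: foldl_append)
qed (auto simp: list_all2_Cons2)

lemma target_fm_brel: "target_fm (\<sigma> # cp_pos \<sigma> @ cp_neg \<sigma>) (brel cp_base \<sigma>)"
proof -
  let ?p = "length (cp_pos \<sigma>)" and ?q = "length (cp_neg \<sigma>)"
  have "list_all2 (has_ty (\<sigma> # cp_pos \<sigma> @ cp_neg \<sigma>)) (map Var [1..<1 + ?p]) (cp_pos \<sigma>)"
    by (simp add: list_all2_conv_all_nth nth_append del: upt_Suc)
  moreover have "list_all2 (has_ty (\<sigma> # cp_pos \<sigma> @ cp_neg \<sigma>)) (map Var [1 + ?p..<1 + ?p + ?q]) (cp_neg \<sigma>)"
    by (simp add: list_all2_conv_all_nth nth_append del: upt_Suc)
  ultimately show ?thesis
    unfolding target_fm_def cp_base_def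
    using wf_cp_at[of "\<sigma> # cp_pos \<sigma> @ cp_neg \<sigma>" "Var 0" \<sigma>] by (simp add: Let_def del: upt_Suc)
qed

text \<open>Membership in \<open>target_theory\<close> demands a well-formed formula without
  \<open>Pred\<close>; every \<open>Pred\<close> has been replaced by an instance of
  \<open>brel\<close>.\<close>

lemma wf_uint:
  "wf_fm \<Gamma> A \<Longrightarrow> (\<And>n. n < length \<Gamma> \<Longrightarrow> has_ty \<Delta> (s n) (\<Gamma> ! n)) \<Longrightarrow>
    list_all2 (has_ty \<Delta>) as (pos cp_base A) \<Longrightarrow> list_all2 (has_ty \<Delta>) bs (neg cp_base A) \<Longrightarrow>
    wf_fm \<Delta> (uint cp_base s A as bs) \<and> pred_free (uint cp_base s A as bs)"
proof (induction A arbitrary: \<Gamma> \<Delta> s as bs)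
  case (Eq \<sigma> t u)
  then show ?case using has_ty_sub[of \<Gamma> _ \<sigma> \<Delta> s] by simp
next
  case (Pred \<sigma> t)
  have t: "has_ty \<Delta> (sub s t) \<sigma>" using Pred.prems(1,2) by (auto intro: has_ty_sub)
  have all: "list_all2 (has_ty \<Delta>) (sub s t # as @ bs) (\<sigma> # cp_pos \<sigma> @ cp_neg \<sigma>)"
    using t Pred.prems(3,4) by (auto intro: list_all2_appendI)
  have "wf_fm (\<sigma> # cp_pos \<sigma> @ cp_neg \<sigma>) (brel cp_base \<sigma>)" "pred_free (brel cp_base \<sigma>)"
    using target_fm_brel[of \<sigma>] by (simp_all add: target_fm_def)
  then show ?case
    using wf_fm_fsub[of "\<sigma> # cp_pos \<sigma> @ cp_neg \<sigma>" "brel cp_base \<sigma>" \<Delta> "(!) (sub s t # as @ bs)"]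
      list_all2_nthD2[OF all] by simp
next
  case (And A B)
  have as: "list_all2 (has_ty \<Delta>) as (pos cp_base A @ pos cp_base B)"
    and bs: "list_all2 (has_ty \<Delta>) bs (neg cp_base A @ neg cp_base B)"
    using And.prems(3,4) by simp_all
  show ?case
    using And.prems(1,2) And.IH(1)[of \<Gamma> \<Delta> s] And.IH(2)[of \<Gamma> \<Delta> s]
      list_all2_append2_take_drop[OF as] list_all2_append2_take_drop[OF bs] by simp
next
  case (Imp A B)
  let ?pA = "pos cp_base A" and ?nA = "neg cp_base A" and ?pB = "pos cp_base B" and ?nB = "neg cp_base B"
  let ?f = "take (length ?pB) as" and ?g = "drop (length ?pB) as"
  let ?a = "take (length ?pA) bs" and ?d = "drop (length ?pA) bs"
  let ?k = "length ?nA"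
  have as: "list_all2 (has_ty \<Delta>) as (map (\<lambda>\<tau>. funs ?pA \<tau>) ?pB @
      map (\<lambda>\<beta>. funs (?pA @ ?nB) (Star \<beta>)) ?nA)"
    using Imp.prems(3) by (simp add: imp_pos_def)
  have f: "list_all2 (has_ty \<Delta>) ?f (map (\<lambda>\<tau>. funs ?pA \<tau>) ?pB)"
    and g: "list_all2 (has_ty \<Delta>) ?g (map (\<lambda>\<beta>. funs (?pA @ ?nB) (Star \<beta>)) ?nA)"
    using list_all2_append2_take_drop[OF as] by simp_all
  have bs: "list_all2 (has_ty \<Delta>) bs (?pA @ ?nB)"
    using Imp.prems(4) by (simp add: imp_neg_def)
  note a = list_all2_append2_take_drop(1)[OF bs] and d = list_all2_append2_take_drop(2)[OF bs]
  have 1: "list_all2 (has_ty \<Delta>) (map (\<lambda>t. apps t (?a @ ?d)) ?g) (map Star ?nA)"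
    using list_all2_apps[where F = Star, OF g bs] by simp
  have 2: "list_all2 (has_ty \<Delta>) (map (\<lambda>t. apps t ?a) ?f) ?pB"
    using list_all2_apps[where F = "\<lambda>x. x", OF f a] by simp
  have 3: "list_all2 (has_ty (?nA @ \<Delta>)) (map (shift ?k) ?a) ?pA"
    by (rule list_all2_shift[OF a]) simp
  have 4: "wf_fm (?nA @ \<Delta>) (uint cp_base (\<lambda>n. shift ?k (s n)) A (map (shift ?k) ?a) (vars ?k)) \<and>
      pred_free (uint cp_base (\<lambda>n. shift ?k (s n)) A (map (shift ?k) ?a) (vars ?k))"
    by (rule Imp.IH(1)[of \<Gamma>]) (use Imp.prems(1,2) 3 has_ty_vars in \<open>auto intro: has_ty_shift\<close>)
  show ?case
    using 4 wf_fm_balls[OF 1] Imp.IH(2)[OF _ Imp.prems(2) 2 d] Imp.prems(1)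
    by (simp add: Let_def del: foldl_append)
next
  case (All \<sigma> A)
  have "wf_fm (\<sigma> # \<Delta>) (uint cp_base (up s) A (map (shift 1) as) (map (shift 1) bs)) \<and>
      pred_free (uint cp_base (up s) A (map (shift 1) as) (map (shift 1) bs))"
    using All.prems has_ty_up[of \<Gamma> \<Delta> s] list_all2_shift[of \<Delta> _ _ "[\<sigma>]" 1]
    by (intro All.IH[of "\<sigma> # \<Gamma>"]) auto
  then show ?case by simp
next
  case (Ex \<sigma> A)
  let ?k = "length (neg cp_base A)"
  have 1: "has_ty (neg cp_base A @ \<sigma> # \<Delta>) (shift ?k (up s n)) ((\<sigma> # \<Gamma>) ! n)"
    if "n < length (\<sigma> # \<Gamma>)" for n
    using has_ty_shift[OF has_ty_up[of \<Gamma> \<Delta> s, OF Ex.prems(2) that], of "neg cp_base A" ?k] by simp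
  have 2: "list_all2 (has_ty (neg cp_base A @ \<sigma> # \<Delta>)) (map (shift (Suc ?k)) as) (pos cp_base A)"
    using list_all2_shift[OF Ex.prems(3), of "neg cp_base A @ [\<sigma>]"] by simp
  have 3: "list_all2 (has_ty (\<sigma> # \<Delta>)) (map (shift 1) bs) (map Star (neg cp_base A))"
    using list_all2_shift[OF Ex.prems(4), of "[\<sigma>]" 1] by simp
  have "wf_fm (neg cp_base A @ \<sigma> # \<Delta>)
        (uint cp_base (\<lambda>n. shift ?k (up s n)) A (map (shift (Suc ?k)) as) (vars ?k)) \<and>
      pred_free (uint cp_base (\<lambda>n. shift ?k (up s n)) A (map (shift (Suc ?k)) as) (vars ?k))"
    by (rule Ex.IH[of "\<sigma> # \<Gamma>", OF _ 1 2 has_ty_vars]) (use Ex.prems(1) in simp_all)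
  then show ?case using wf_fm_balls[OF 3] by (simp add: Let_def)
qed simp

section \<open>Satisfaction of the translated formulas\<close>

context omega_star
begin

text \<open>The environment below \<open>length v\<close> binders, the innermost variable first;
  \<open>cat_Cons\<close> accounts for one more binder.\<close>

definition cat :: "'u list \<Rightarrow> (nat \<Rightarrow> 'u) \<Rightarrow> nat \<Rightarrow> 'u" where
  "cat v e n = (if n < length v then v ! n else e (n - length v))"

lemma cat_Nil [simp]: "cat [] e = e"
  by (simp add: cat_def fun_eq_iff)

lemma cat_Cons: "cat (x # v) e = case_nat x (cat v e)"
  by (auto simp: cat_def fun_eq_iff split: nat.split)

lemma tm_val_shift: "tm_val M e (shift k t) = tm_val M (\<lambda>n. e (n + k)) t"
  by (simp add: shift_def tm_val_sub)

lemma tm_val_shift_cat [simp]: "length v = k \<Longrightarrow> tm_val M (cat v e) (shift k t) = tm_val M e t"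
  by (simp add: tm_val_shift cat_def)

lemma tm_val_shift_Suc [simp]:
  "length v = k \<Longrightarrow> tm_val M (case_nat x (cat v e)) (shift (Suc k) t) = tm_val M e t"
  "length v = k \<Longrightarrow> tm_val M (cat v (case_nat x e)) (shift (Suc k) t) = tm_val M e t"
  "tm_val M (case_nat x e) (shift (Suc 0) t) = tm_val M e t"
  by (simp_all add: tm_val_shift cat_def)

lemma tm_val_up: "tm_val M (case_nat x e) (up s n) = (case n of 0 \<Rightarrow> x | Suc n \<Rightarrow> tm_val M e (s n))"
  by (cases n) simp_all

lemma map_tm_val_vars [simp]: "length v = k \<Longrightarrow> map (tm_val M (cat v e)) (vars k) = v"
  by (auto simp: cat_def intro: nth_equalityI)

lemma sat_fsub: "sat M e (fsub s A) \<longleftrightarrow> sat M (\<lambda>n. tm_val M e (s n)) A"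
proof (induction A arbitrary: e s)
  case (All \<sigma> A)
  show ?case by (simp add: All.IH tm_val_up)
next
  case (Ex \<sigma> A)
  show ?case by (simp add: Ex.IH tm_val_up)
qed (simp_all add: tm_val_sub)

lemma sat_close: "sat M e (close \<Gamma> A) \<longleftrightarrow> (\<forall>v\<in>tup \<Gamma>. sat M (cat v e) A)"
proof (induction \<Gamma> arbitrary: A)
  case Nil
  show ?case by simp
next
  case (Cons \<sigma> \<Gamma>)
  have "(\<forall>v\<in>tup (\<sigma> # \<Gamma>). P v) \<longleftrightarrow> (\<forall>v\<in>tup \<Gamma>. \<forall>x\<in>carr M \<sigma>. P (x # v))" for P
    by (auto simp: tup_Cons)
  then show ?case by (simp add: Cons.IH cat_Cons)
qed

text \<open>The premise places the bounds in their carriers, where \<open>MemC\<close> computes true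
  membership. The quantifier over \<open>carr M \<beta>\<close> is then absorbed, because the
  elements of a set lie in that carrier.\<close>

lemma sat_balls:
  "map (tm_val M e) Bs \<in> tup (map Star \<beta>s) \<Longrightarrow>
    sat M e (balls \<beta>s Bs A) \<longleftrightarrow> (\<forall>b\<in>prodl (map (tm_val M e) Bs). sat M (cat b e) A)"
proof (induction \<beta>s arbitrary: Bs A)
  case (Cons \<beta> \<beta>s)
  obtain B Bs' where Bs: "Bs = B # Bs'" using Cons.prems by (cases Bs) simp_all
  have B: "tm_val M e B \<in> carr M (Star \<beta>)" "map (tm_val M e) Bs' \<in> tup (map Star \<beta>s)"
    using Cons.prems by (simp_all add: Bs)
  have "sat M e (balls (\<beta> # \<beta>s) Bs A) \<longleftrightarrow> (\<forall>b\<in>prodl (map (tm_val M e) Bs').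
      \<forall>x\<in>carr M \<beta>. x \<in> elems M (tm_val M e B) \<longrightarrow> sat M (cat (x # b) e) A)"
    using B tup_length[OF prodl_in[OF B(2)]]
    by (simp add: Bs Cons.IH mem_fm_def app_MemC cat_Cons cong: ball_cong del: con_val.simps(12))
  also have "\<dots> \<longleftrightarrow> (\<forall>b\<in>prodl (map (tm_val M e) Bs). sat M (cat b e) A)"
    using elems_subset[OF B(1)] by (auto simp: Bs prodl_Cons)
  finally show ?case .
qed simp

text \<open>The premises concern the witnesses because these determine the bounds of
  \<open>balls\<close>; the subject \<open>x\<close> merely occurs in equations and
  applications.\<close>

lemma sat_cp_at:
  "map (tm_val M e) as \<in> tup (cp_pos \<sigma>) \<Longrightarrow> map (tm_val M e) bs \<in> tup (cp_neg \<sigma>) \<Longrightarrow>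
    sat M e (cp_at \<sigma> x as bs) \<longleftrightarrow> cpr \<sigma> (tm_val M e x) (map (tm_val M e) as) (map (tm_val M e) bs)"
proof (induction \<sigma> arbitrary: e x as bs)
  case (Fun \<rho> \<sigma>)
  let ?f = "take (length (cp_pos \<sigma>)) as" and ?g = "drop (length (cp_pos \<sigma>)) as"
  let ?a = "take (length (cp_pos \<rho>)) bs" and ?d = "drop (length (cp_pos \<rho>)) bs"
  let ?v = "map (tm_val M e)" and ?k = "length (cp_neg \<rho>)"
  have as: "?v ?f @ ?v ?g \<in> tup (map (\<lambda>\<tau>. funs (cp_pos \<rho>) \<tau>) (cp_pos \<sigma>) @
      map (\<lambda>\<beta>. funs (cp_pos \<rho> @ cp_neg \<sigma>) (Star \<beta>)) (cp_neg \<rho>))"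
    using Fun.prems(1) by (simp add: imp_pos_def flip: map_append)
  have "length (?v as) = length (cp_pos (\<rho> \<leadsto> \<sigma>))" using Fun.prems(1) by (rule tup_length)
  then have "length (?v ?f) = length (map (\<lambda>\<tau>. funs (cp_pos \<rho>) \<tau>) (cp_pos \<sigma>))" by (simp add: imp_pos_def)
  with as have f: "?v ?f \<in> tup (map (\<lambda>\<tau>. funs (cp_pos \<rho>) \<tau>) (cp_pos \<sigma>))"
    and g: "?v ?g \<in> tup (map (\<lambda>\<beta>. funs (cp_pos \<rho> @ cp_neg \<sigma>) (Star \<beta>)) (cp_neg \<rho>))"
    by (simp_all only: append_tup_iff)
  have bs: "?v bs \<in> tup (cp_pos \<rho> @ cp_neg \<sigma>)" using Fun.prems(2) by (simp add: imp_neg_def)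
  have a: "?v ?a \<in> tup (cp_pos \<rho>)" and d: "?v ?d \<in> tup (cp_neg \<sigma>)"
    using take_tup[OF bs] drop_tup[OF bs] by (simp_all add: take_map drop_map)
  have gab: "aplm (?v ?g) (?v bs) \<in> tup (map Star (cp_neg \<rho>))" using g bs by (rule map_apl_in)
  have fa: "aplm (?v ?f) (?v ?a) \<in> tup (cp_pos \<sigma>)"
    using map_apl_in[where F = "\<lambda>x. x", OF f a] by simp
  let ?hyp = "balls (cp_neg \<rho>) (map (\<lambda>t. shift 1 (apps t bs)) ?g)
    (cp_at \<rho> (Var ?k) (map (shift (Suc ?k)) ?a) (vars ?k))"
  let ?con = "cp_at \<sigma> (App (shift 1 x) (Var 0)) (map (\<lambda>t. shift 1 (apps t ?a)) ?f) (map (shift 1) ?d)"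
  have cp_at: "cp_at (\<rho> \<leadsto> \<sigma>) x as bs = All \<rho> (Imp ?hyp ?con)"
    by (simp add: Let_def del: foldl_append)
  have hyp: "sat M (case_nat y e) ?hyp \<longleftrightarrow> (\<forall>b\<in>prodl (aplm (?v ?g) (?v bs)). cpr \<rho> y (?v ?a) b)" for y
  proof -
    have Bs: "map (tm_val M (case_nat y e)) (map (\<lambda>t. shift 1 (apps t bs)) ?g) = aplm (?v ?g) (?v bs)"
      by (simp add: tm_val_apps comp_def)
    have "sat M (cat b (case_nat y e)) (cp_at \<rho> (Var ?k) (map (shift (Suc ?k)) ?a) (vars ?k)) \<longleftrightarrow>
        cpr \<rho> y (?v ?a) b" if b: "b \<in> prodl (aplm (?v ?g) (?v bs))" for b
    proof -
      have b_in: "b \<in> tup (cp_neg \<rho>)" using gab b by (rule prodl_in)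
      have eq: "map (tm_val M (cat b (case_nat y e))) (map (shift (Suc ?k)) ?a) = ?v ?a"
        "map (tm_val M (cat b (case_nat y e))) (vars ?k) = b"
        "tm_val M (cat b (case_nat y e)) (Var ?k) = y"
        using tup_length[OF b_in] map_tm_val_vars[of b ?k] by (simp_all add: cat_def[of _ _ "length (cp_neg \<rho>)"])
      show ?thesis
        using Fun.IH(1)[of "cat b (case_nat y e)" "map (shift (Suc ?k)) ?a" "vars ?k" "Var ?k", unfolded eq]
          a b_in by simp
    qed
    then show ?thesis
      unfolding sat_balls[of "case_nat y e" "map (\<lambda>t. shift 1 (apps t bs)) ?g" "cp_neg \<rho>", unfolded Bs, OF gab]
      by (rule ball_cong[OF refl])
  qed
  have con: "sat M (case_nat y e) ?con \<longleftrightarrow>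
      cpr \<sigma> (app M (tm_val M e x) y) (aplm (?v ?f) (?v ?a)) (?v ?d)" for y
  proof -
    have eq: "map (tm_val M (case_nat y e)) (map (\<lambda>t. shift 1 (apps t ?a)) ?f) = aplm (?v ?f) (?v ?a)"
      "map (tm_val M (case_nat y e)) (map (shift 1) ?d) = ?v ?d"
      by (simp_all add: tm_val_apps comp_def)
    show ?thesis
      using Fun.IH(2)[of "case_nat y e" "map (\<lambda>t. shift 1 (apps t ?a)) ?f" "map (shift 1) ?d"
          "App (shift 1 x) (Var 0)", unfolded eq] fa d by simp
  qed
  show ?case
    unfolding cp_at sat.simps hyp con cpr.simps by (simp add: take_map drop_map)
qed (auto simp: tup_Cons)

text \<open>The environment is prescribed on the variables of \<open>brel\<close> alone: in
  \<open>uint\<close> it arises from indexing a list, which is unspecified beyond the end of the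
  list.\<close>

lemma sat_brel:
  assumes "\<And>n. n < length (x # as @ bs) \<Longrightarrow> e n = (x # as @ bs) ! n"
    "as \<in> tup (cp_pos \<sigma>)" "bs \<in> tup (cp_neg \<sigma>)"
  shows "sat M e (brel cp_base \<sigma>) \<longleftrightarrow> cpr \<sigma> x as bs"
proof -
  let ?p = "length (cp_pos \<sigma>)" and ?q = "length (cp_neg \<sigma>)"
  note len = tup_length[OF assms(2)] tup_length[OF assms(3)]
  have as: "map (tm_val M e) (map Var [1..<1 + ?p]) = as"
    using len assms(1) by (intro nth_equalityI) (simp_all add: nth_append del: upt_Suc)
  have bs: "map (tm_val M e) (map Var [1 + ?p..<1 + ?p + ?q]) = bs"
    using len assms(1) by (intro nth_equalityI) (simp_all add: nth_append del: upt_Suc)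
  have x: "tm_val M e (Var 0) = x" using assms(1)[of 0] by simp
  show ?thesis
    using sat_cp_at[of e "map Var [1..<1 + ?p]" \<sigma> "map Var [1 + ?p..<1 + ?p + ?q]" "Var 0",
        unfolded as bs x] assms(2,3) by (simp add: cp_base_def Let_def del: upt_Suc)
qed

text \<open>One element must meet a whole finite set of challenges, but it may vary with that set;
  accordingly a challenge is a tuple of sets.\<close>

definition exS :: "ty \<Rightarrow> ('i \<times> 'u, 'u) sform \<Rightarrow> ('i, 'u) sform" where
  "exS \<sigma> A = \<lparr> ps = ps A, ns = map Star (ns A),
     rl = (\<lambda>i a B. \<exists>x\<in>carr M \<sigma>. \<forall>b\<in>prodl B. rl A (i, x) a b) \<rparr>"

lemma exS_sel [simp]: "ps (exS \<sigma> A) = ps A" "ns (exS \<sigma> A) = map Star (ns A)"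
    "rl (exS \<sigma> A) i a B \<longleftrightarrow> (\<exists>x\<in>carr M \<sigma>. \<forall>b\<in>prodl B. rl A (i, x) a b)"
  by (simp_all add: exS_def)

definition pureS :: "('i \<Rightarrow> bool) \<Rightarrow> ('i, 'u) sform" where
  "pureS P = \<lparr> ps = [], ns = [], rl = (\<lambda>i _ _. P i) \<rparr>"

lemma pureS_sel [simp]: "ps (pureS P) = []" "ns (pureS P) = []" "rl (pureS P) i a b = P i"
  by (simp_all add: pureS_def)

abbreviation push :: "(nat \<Rightarrow> 'u) \<times> 'u \<Rightarrow> nat \<Rightarrow> 'u" where
  "push p \<equiv> case_nat (snd p) (fst p)"

text \<open>Indices are now environments. A quantifier pairs the environment with the bound value,
  and \<open>push\<close> makes an environment of that pair again.\<close>

primrec sem :: "fm \<Rightarrow> (nat \<Rightarrow> 'u, 'u) sform" where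
  "sem Bot = pureS (\<lambda>_. False)"
| "sem (Eq \<sigma> t u) = pureS (\<lambda>e. tm_val M e t = tm_val M e u)"
| "sem (Pred \<sigma> t) = inS \<sigma> (\<lambda>e. tm_val M e t)"
| "sem (And A B) = conjS (sem A) (sem B)"
| "sem (Imp A B) = impS (sem A) (sem B)"
| "sem (All \<sigma> A) = allS \<sigma> (reindex push (sem A))"
| "sem (Ex \<sigma> A) = exS \<sigma> (reindex push (sem A))"

lemma sem_sel [simp]: "ps (sem A) = pos cp_base A" "ns (sem A) = neg cp_base A"
  by (induction A) (simp_all add: imp_neg_def)

lemma tm_val_up_fun: "(\<lambda>n. tm_val M (case_nat x e) (up s n)) = case_nat x (\<lambda>n. tm_val M e (s n))"
  by (rule ext) (simp add: tm_val_up split: nat.split)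

text \<open>The substitution and the witness terms matter only through their values. This ends the
  bookkeeping with shifts: from here on derivations are purely semantic.\<close>

lemma sat_uint:
  "map (tm_val M e) as \<in> tup (pos cp_base A) \<Longrightarrow> map (tm_val M e) bs \<in> tup (neg cp_base A) \<Longrightarrow>
    sat M e (uint cp_base s A as bs) \<longleftrightarrow>
    rl (sem A) (\<lambda>n. tm_val M e (s n)) (map (tm_val M e) as) (map (tm_val M e) bs)"
proof (induction A arbitrary: e s as bs)
  case (Pred \<sigma> t)
  let ?v = "map (tm_val M e)"
  have "tm_val M e ((sub s t # as @ bs) ! n) = (tm_val M e (sub s t) # ?v as @ ?v bs) ! n"
    if "n < length (tm_val M e (sub s t) # ?v as @ ?v bs)" for n
    using that nth_map[of n "sub s t # as @ bs" "tm_val M e"] by simp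
  from sat_brel[OF this, of \<sigma>] show ?case
    using Pred.prems by (simp add: sat_fsub tm_val_sub[symmetric])
next
  case (And A B)
  have as: "map (tm_val M e) as \<in> tup (pos cp_base A @ pos cp_base B)"
    and bs: "map (tm_val M e) bs \<in> tup (neg cp_base A @ neg cp_base B)"
    using And.prems by simp_all
  show ?case
    using take_tup[OF as] drop_tup[OF as] take_tup[OF bs] drop_tup[OF bs]
    by (simp add: And.IH conjS_def take_map drop_map)
next
  case (Imp A B)
  let ?pA = "pos cp_base A" and ?nA = "neg cp_base A" and ?pB = "pos cp_base B" and ?nB = "neg cp_base B"
  let ?f = "take (length ?pB) as" and ?g = "drop (length ?pB) as"
  let ?a = "take (length ?pA) bs" and ?d = "drop (length ?pA) bs"
  let ?v = "map (tm_val M e)" and ?k = "length ?nA"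
  have as: "?v ?f @ ?v ?g \<in> tup (map (\<lambda>\<tau>. funs ?pA \<tau>) ?pB @ map (\<lambda>\<beta>. funs (?pA @ ?nB) (Star \<beta>)) ?nA)"
    using Imp.prems(1) by (simp add: imp_pos_def flip: map_append)
  have "length (?v as) = length (pos cp_base (Imp A B))" using Imp.prems(1) by (rule tup_length)
  then have "length (?v ?f) = length (map (\<lambda>\<tau>. funs ?pA \<tau>) ?pB)" by (simp add: imp_pos_def)
  with as have f: "?v ?f \<in> tup (map (\<lambda>\<tau>. funs ?pA \<tau>) ?pB)"
    and g: "?v ?g \<in> tup (map (\<lambda>\<beta>. funs (?pA @ ?nB) (Star \<beta>)) ?nA)"
    by (simp_all only: append_tup_iff)
  have bs: "?v bs \<in> tup (?pA @ ?nB)" using Imp.prems(2) by (simp add: imp_neg_def)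
  have a: "?v ?a \<in> tup ?pA" and d: "?v ?d \<in> tup ?nB"
    using take_tup[OF bs] drop_tup[OF bs] by (simp_all add: take_map drop_map)
  have gab: "aplm (?v ?g) (?v bs) \<in> tup (map Star ?nA)" using g bs by (rule map_apl_in)
  have fa: "aplm (?v ?f) (?v ?a) \<in> tup ?pB"
    using map_apl_in[where F = "\<lambda>x. x", OF f a] by simp
  let ?hyp = "balls ?nA (map (\<lambda>t. apps t bs) ?g)
    (uint cp_base (\<lambda>n. shift ?k (s n)) A (map (shift ?k) ?a) (vars ?k))"
  let ?con = "uint cp_base s B (map (\<lambda>t. apps t ?a) ?f) ?d"
  let ?e = "\<lambda>n. tm_val M e (s n)"
  have uint: "uint cp_base s (Imp A B) as bs = Imp ?hyp ?con"
    by (simp add: Let_def del: foldl_append)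
  have hyp: "sat M e ?hyp \<longleftrightarrow> (\<forall>b\<in>prodl (aplm (?v ?g) (?v bs)). rl (sem A) ?e (?v ?a) b)"
  proof -
    have Bs: "map (tm_val M e) (map (\<lambda>t. apps t bs) ?g) = aplm (?v ?g) (?v bs)"
      by (simp add: tm_val_apps comp_def)
    \<comment> \<open>Below the \<open>?k\<close> bounded quantifiers the shifted terms keep their
      values, and the new variables denote the entries of \<open>b\<close>.\<close>
    have "sat M (cat b e) (uint cp_base (\<lambda>n. shift ?k (s n)) A (map (shift ?k) ?a) (vars ?k)) \<longleftrightarrow>
        rl (sem A) ?e (?v ?a) b" if b: "b \<in> prodl (aplm (?v ?g) (?v bs))" for b
    proof -
      have b_in: "b \<in> tup ?nA" using gab b by (rule prodl_in)
      have eq: "map (tm_val M (cat b e)) (map (shift ?k) ?a) = ?v ?a"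
        "map (tm_val M (cat b e)) (vars ?k) = b"
        "(\<lambda>n. tm_val M (cat b e) (shift ?k (s n))) = ?e"
        using tup_length[OF b_in] map_tm_val_vars[of b ?k] by (simp_all add: fun_eq_iff)
      show ?thesis
        using Imp.IH(1)[of "cat b e" "map (shift ?k) ?a" "vars ?k" "\<lambda>n. shift ?k (s n)", unfolded eq]
          a b_in by simp
    qed
    then show ?thesis
      unfolding sat_balls[of e "map (\<lambda>t. apps t bs) ?g" ?nA, unfolded Bs, OF gab]
      by (rule ball_cong[OF refl])
  qed
  have con: "sat M e ?con \<longleftrightarrow> rl (sem B) ?e (aplm (?v ?f) (?v ?a)) (?v ?d)"
  proof -
    have eq: "map (tm_val M e) (map (\<lambda>t. apps t ?a) ?f) = aplm (?v ?f) (?v ?a)"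
      by (simp add: tm_val_apps comp_def)
    show ?thesis
      using Imp.IH(2)[of e "map (\<lambda>t. apps t ?a) ?f" ?d s, unfolded eq] fa d by simp
  qed
  show ?case
    unfolding uint sat.simps hyp con by (simp add: impS_def take_map drop_map)
next
  case (All \<sigma> A)
  have eq: "map (tm_val M (case_nat x e)) (map (shift 1) ts) = map (tm_val M e) ts" for x ts
    by simp
  show ?case
    using All.prems All.IH[of "case_nat _ e" "map (shift 1) as" "map (shift 1) bs" "up s", unfolded eq]
    by (simp add: tm_val_up_fun)
next
  case (Ex \<sigma> A)
  let ?v = "map (tm_val M e)" and ?k = "length (neg cp_base A)"
  let ?body = "uint cp_base (\<lambda>n. shift ?k (up s n)) A (map (shift (Suc ?k)) as) (vars ?k)"
  have bs: "?v bs \<in> tup (map Star (neg cp_base A))" using Ex.prems(2) by simp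
  have "sat M (case_nat x e) (balls (neg cp_base A) (map (shift 1) bs) ?body) \<longleftrightarrow>
      (\<forall>b\<in>prodl (?v bs). rl (sem A) (case_nat x (\<lambda>n. tm_val M e (s n))) (?v as) b)" for x
  proof -
    have Bs: "map (tm_val M (case_nat x e)) (map (shift 1) bs) = ?v bs" by simp
    have "sat M (cat b (case_nat x e)) ?body \<longleftrightarrow>
        rl (sem A) (case_nat x (\<lambda>n. tm_val M e (s n))) (?v as) b" if b: "b \<in> prodl (?v bs)" for b
    proof -
      have b_in: "b \<in> tup (neg cp_base A)" using bs b by (rule prodl_in)
      have eq: "map (tm_val M (cat b (case_nat x e))) (map (shift (Suc ?k)) as) = ?v as"
        "map (tm_val M (cat b (case_nat x e))) (vars ?k) = b"
        "(\<lambda>n. tm_val M (cat b (case_nat x e)) (shift ?k (up s n))) = case_nat x (\<lambda>n. tm_val M e (s n))"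
        using tup_length[OF b_in] map_tm_val_vars[of b ?k]
        by (simp_all add: tm_val_up_fun[symmetric])
      show ?thesis
        using Ex.IH[of "cat b (case_nat x e)" "map (shift (Suc ?k)) as" "vars ?k"
            "\<lambda>n. shift ?k (up s n)", unfolded eq] Ex.prems(1) b_in by simp
    qed
    then show ?thesis
      unfolding sat_balls[of "case_nat x e" "map (shift 1) bs" "neg cp_base A", unfolded Bs, OF bs]
      by (rule ball_cong[OF refl])
  qed
  then show ?case by (simp add: Let_def)
qed (simp_all add: tm_val_sub)

end

section \<open>Interpretability of constants and axioms\<close>

lemma relat_fsub: "relat (fsub s A) = fsub s (relat A)"
  by (induction A arbitrary: s) simp_all

lemma wf_fm_relat: "wf_fm \<Gamma> A \<Longrightarrow> wf_fm \<Gamma> (relat A)"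
  by (induction A arbitrary: \<Gamma>) simp_all

lemma wf_fm_conjs: "wf_fm \<Gamma> A \<Longrightarrow> \<forall>B\<in>set Bs. wf_fm \<Gamma> B \<Longrightarrow> wf_fm \<Gamma> (conjs A Bs)"
  by (induction Bs arbitrary: A) auto

lemma wf_fm_guard:
  assumes "wf_fm \<Gamma> A"
  shows "wf_fm \<Gamma> (guard \<Gamma> A)"
proof -
  have "wf_fm \<Gamma> (case Ps of [] \<Rightarrow> A | P # Ps \<Rightarrow> Imp (conjs P Ps) A)"
    if "\<forall>P\<in>set Ps. wf_fm \<Gamma> P" for Ps
    using that assms by (cases Ps) (simp_all add: wf_fm_conjs)
  moreover have "\<forall>P\<in>set (map2 Pred \<Gamma> (vars (length \<Gamma>))). wf_fm \<Gamma> P"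
    by (auto simp: set_zip)
  ultimately show ?thesis
    unfolding guard_def by blast
qed

context omega_star
begin

text \<open>Entries beyond the context are unrestricted, so that the empty context gives
  \<open>UNIV\<close>, where the induction for \<open>ent_close\<close> ends.\<close>

definition envs :: "ty list \<Rightarrow> (nat \<Rightarrow> 'u) set" where
  "envs \<Gamma> = {e. \<forall>n<length \<Gamma>. e n \<in> carr M (\<Gamma> ! n)}"

lemma envs_nth: "e \<in> envs \<Gamma> \<Longrightarrow> n < length \<Gamma> \<Longrightarrow> e n \<in> carr M (\<Gamma> ! n)"
  by (simp add: envs_def)

lemma push_envs: "push ` (envs \<Gamma> \<times> carr M \<sigma>) \<subseteq> envs (\<sigma> # \<Gamma>)"
  by (auto simp: envs_def nth_Cons split: nat.split)

lemma reindex_simps [simp]: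
  "reindex \<pi> trueS = trueS"
  "reindex \<pi> (conjS A B) = conjS (reindex \<pi> A) (reindex \<pi> B)"
  "reindex \<pi> (impS A B) = impS (reindex \<pi> A) (reindex \<pi> B)"
  "reindex \<pi> (inS \<sigma> x) = inS \<sigma> (\<lambda>j. x (\<pi> j))"
  "reindex \<pi> (pureS P) = pureS (\<lambda>j. P (\<pi> j))"
  "reindex \<pi> (reindex \<pi>' A') = reindex (\<lambda>j. \<pi>' (\<pi> j)) A'"
  "reindex \<pi> (allS \<sigma> A'') = allS \<sigma> (reindex (\<lambda>p. (\<pi> (fst p), snd p)) A'')"
  "reindex \<pi> (exS \<sigma> A'') = exS \<sigma> (reindex (\<lambda>p. (\<pi> (fst p), snd p)) A'')"
  by (simp_all add: reindex_def trueS_def conjS_def impS_def inS_def pureS_def allS_def exS_def)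

lemma sem_fsub: "sem (fsub s A) = reindex (\<lambda>e n. tm_val M e (s n)) (sem A)"
proof (induction A arbitrary: s)
  case (All \<sigma> A)
  show ?case by (simp add: All.IH tm_val_up_fun)
next
  case (Ex \<sigma> A)
  show ?case by (simp add: Ex.IH tm_val_up_fun)
qed (simp_all add: tm_val_sub)

lemma ent_trueI: "ent S X trueS"
  by (rule ent_true) simp_all

lemma ent_trueS: "ent S trueS A \<Longrightarrow> ent S X A"
  by (rule ent_trans[OF ent_trueI])

text \<open>With the hypothesis \<open>trueS\<close> the realizer \<open>f\<close> takes no
  arguments, so its defining terms are closed and serve as the required witnesses.\<close>

lemma U_interpretableI:
  assumes "wf_fm [] A" "ent UNIV trueS (sem A)"
  shows "U_interpretable M cp_base [] A"
proof -
  from assms(2) obtain f where f: "dfnl [] (pos cp_base A) f"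
    and r: "\<And>e d. d \<in> tup (neg cp_base A) \<Longrightarrow> rl (sem A) e (f []) d"
    by (rule entE) auto
  from f obtain ts where ts: "list_all2 (has_ty []) ts (pos cp_base A)" "f [] = map (tm_val M ((!) [])) ts"
    unfolding dfnl_def by auto
  let ?N = "neg cp_base A"
  let ?u = "uint cp_base (\<lambda>n. Var (n + length ?N)) A ts (vars (length ?N))"
  have ts': "list_all2 (has_ty ?N) ts (pos cp_base A)"
    using ts(1) has_ty_weaken[of "[]" _ _ ?N] by (auto elim!: list_all2_mono)
  have "wf_fm ?N ?u \<and> pred_free ?u"
    using wf_uint[OF assms(1) _ ts', of _ "vars (length ?N)"] has_ty_vars[of ?N "[]"] by simp
  moreover have "sat M e (close ?N ?u)" for e
    unfolding sat_close
  proof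
    fix v assume v: "v \<in> tup ?N"
    have vars: "map (tm_val M (cat v e)) (vars (length ?N)) = v"
      by (rule map_tm_val_vars) (rule tup_length[OF v])
    \<comment> \<open>Closed terms have the same value in every environment, in particular in one
      that holds the challenge \<open>v\<close>.\<close>
    have eq: "map (tm_val M (cat v e)) ts = f []"
      unfolding ts(2)
    proof (rule map_cong[OF refl])
      fix t assume "t \<in> set ts"
      then obtain \<sigma> where "has_ty [] t \<sigma>" using ts(1) by (auto simp: list_all2_conv_all_nth in_set_conv_nth)
      then show "tm_val M (cat v e) t = tm_val M ((!) []) t" by (rule tm_val_cong) simp
    qed
    show "sat M (cat v e) ?u"
      using sat_uint[of "cat v e" ts A "vars (length ?N)", unfolded vars eq] v r[OF v] dfnl_in[OF f, of "[]"]
      by simp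
  qed
  ultimately show ?thesis
    unfolding U_interpretable_def target_theory_def target_fm_def
    by (intro exI[of _ ts]) (simp add: ts(1) wf_fm_close Let_def)
qed

lemma ent_close:
  "ent (envs \<Gamma>) trueS (sem A) \<Longrightarrow> ent UNIV trueS (sem (close \<Gamma> A))"
proof (induction \<Gamma> arbitrary: A)
  case Nil
  then show ?case by (simp add: envs_def)
next
  case (Cons \<sigma> \<Gamma>)
  have "ent (envs \<Gamma> \<times> carr M \<sigma>) (reindex fst trueS) (reindex push (sem A))"
    using ent_reindex[OF Cons.prems push_envs] by simp
  then show ?case by (simp add: Cons.IH ent_allI)
qed

text \<open>It suffices to derive \<open>relat A\<close> over well-typed environments: the
  implication from the guards follows by weakening, and the closure by
  \<open>ent_close\<close>.\<close>

lemma I_interpretableI: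
  assumes "wf_fm \<Gamma> A" "ent (envs \<Gamma>) trueS (sem (relat A))"
  shows "I_interpretable M cp_base \<Gamma> A"
proof -
  have "ent (envs \<Gamma>) trueS (sem (guard \<Gamma> (relat A)))"
    using assms(2) by (auto simp: guard_def intro: ent_impI ent_trueS split: list.split)
  then show ?thesis
    unfolding I_interpretable_def
    using assms(1) by (intro U_interpretableI ent_close) (simp_all add: wf_fm_close wf_fm_guard wf_fm_relat)
qed

lemma ent_fun_intro:
  assumes "ent (S \<times> carr M \<rho>) (conjS (reindex fst X) (inS \<rho> snd)) (inS \<sigma> (\<lambda>p. app M (h (fst p)) (snd p)))"
  shows "ent S X (inS (\<rho> \<leadsto> \<sigma>) h)"
  unfolding inS_fun by (intro ent_allI ent_impI assms)

text \<open>The instance may vary with the index, provided that it stays in the carrier; the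
  witnesses are passed on by \<open>ent_mono\<close>.\<close>

lemma ent_all_elim:
  assumes "ent S X (allS \<sigma> A)" "\<And>i. i \<in> S \<Longrightarrow> x i \<in> carr M \<sigma>"
  shows "ent S X (reindex (\<lambda>i. (i, x i)) A)"
  by (rule ent_trans[OF assms(1)], rule ent_mono) (use assms(2) in auto)

text \<open>Modus ponens on the instance of \<open>inS_fun\<close> at the argument
  \<open>x\<close>.\<close>

lemma ent_fun_elim:
  assumes "ent S X (inS (\<rho> \<leadsto> \<sigma>) h)" "ent S X (inS \<rho> x)" "\<And>i. i \<in> S \<Longrightarrow> x i \<in> carr M \<rho>"
  shows "ent S X (inS \<sigma> (\<lambda>i. app M (h i) (x i)))"
proof (rule ent_mp)
  show "ent S X (impS (inS \<rho> x) (inS \<sigma> (\<lambda>i. app M (h i) (x i))))"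
    using ent_all_elim[OF assms(1)[unfolded inS_fun] assms(3)] by simp
qed (rule assms(2))

text \<open>The way in which computation rules enter: a subject may be rewritten by any equation
  true on \<open>S\<close>, because the meaning of I depends only on the element.\<close>

lemma ent_inS_cong:
  assumes "ent S X (inS \<sigma> x)" "\<And>i. i \<in> S \<Longrightarrow> x i = y i"
  shows "ent S X (inS \<sigma> y)"
  by (rule ent_trans[OF assms(1)], rule ent_mono) (use assms(2) in auto)

lemma ent_funs_elim:
  assumes "ent S X (inS (funs \<sigma>s \<tau>) h)" "\<And>k. k < length \<sigma>s \<Longrightarrow> ent S X (inS (\<sigma>s ! k) (\<lambda>i. xs i ! k))"
    "\<And>i. i \<in> S \<Longrightarrow> xs i \<in> tup \<sigma>s"
  shows "ent S X (inS \<tau> (\<lambda>i. apl (h i) (xs i)))"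
  using assms
proof (induction \<sigma>s arbitrary: h xs)
  case Nil
  show ?case by (rule ent_inS_cong[OF Nil.prems(1)[simplified]]) (use Nil.prems(3) in simp)
next
  case (Cons \<sigma> \<sigma>s)
  have xs: "xs i ! 0 \<in> carr M \<sigma> \<and> tl (xs i) \<in> tup \<sigma>s \<and> xs i = xs i ! 0 # tl (xs i)" if "i \<in> S" for i
    using Cons.prems(3)[OF that] by (auto simp: tup_Cons)
  have "ent S X (inS (funs \<sigma>s \<tau>) (\<lambda>i. app M (h i) (xs i ! 0)))"
    using Cons.prems(1) Cons.prems(2)[of 0] xs by (auto intro!: ent_fun_elim[where \<rho> = \<sigma>])
  then have "ent S X (inS \<tau> (\<lambda>i. apl (app M (h i) (xs i ! 0)) (tl (xs i))))"
  proof (rule Cons.IH)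
    fix k assume k: "k < length \<sigma>s"
    have "ent S X (inS (\<sigma>s ! k) (\<lambda>i. xs i ! Suc k))"
      using Cons.prems(2)[of "Suc k"] k by simp
    then show "ent S X (inS (\<sigma>s ! k) (\<lambda>i. tl (xs i) ! k))"
      by (rule ent_inS_cong) (metis xs nth_Cons_Suc)
  qed (use xs in blast)
  then show ?case
    by (rule ent_inS_cong) (metis xs foldl_Cons)
qed

section \<open>Hypotheses on lists of arguments\<close>

primrec bconj :: "('i, 'u) sform list \<Rightarrow> ('i, 'u) sform" where
  "bconj [] = trueS"
| "bconj (A # As) = conjS A (bconj As)"

lemma ent_bconjI: "(\<And>A. A \<in> set As \<Longrightarrow> ent S X A) \<Longrightarrow> ent S X (bconj As)"
  by (induction As) (auto intro: ent_conjI ent_trueI)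

lemma ent_bconjD: "A \<in> set As \<Longrightarrow> ent S (bconj As) A"
  by (induction As) (auto intro: ent_conjD1 ent_trans[OF ent_conjD2])

lemma reindex_bconj [simp]: "reindex \<pi> (bconj As) = bconj (map (reindex \<pi>) As)"
  by (induction As) simp_all

text \<open>The index is the list of argument values itself, so the derivations for the constants
  can address their arguments by position.\<close>

definition args :: "ty list \<Rightarrow> ('u list, 'u) sform" where
  "args \<Gamma> = bconj (map (\<lambda>k. inS (\<Gamma> ! k) (\<lambda>v. v ! k)) [0..<length \<Gamma>])"

lemma ent_args: "k < length \<Gamma> \<Longrightarrow> ent S (args \<Gamma>) (inS (\<Gamma> ! k) (\<lambda>v. v ! k))"
  unfolding args_def by (rule ent_bconjD) auto

lemma ent_reindex_args: "k < length \<Gamma> \<Longrightarrow> ent S (reindex \<pi> (args \<Gamma>)) (inS (\<Gamma> ! k) (\<lambda>i. \<pi> i ! k))"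
  using ent_reindex[OF ent_args[of k \<Gamma> UNIV], of \<pi> S] by simp

lemma ent_argsI:
  "(\<And>k. k < length \<Gamma> \<Longrightarrow> ent S X (inS (\<Gamma> ! k) (\<lambda>i. \<pi> i ! k))) \<Longrightarrow> ent S X (reindex \<pi> (args \<Gamma>))"
  unfolding args_def by (auto intro!: ent_bconjI)

text \<open>Arguments move one at a time between \<open>\<sigma>s'\<close> and the hypotheses on
  \<open>\<sigma>s\<close>; at every stage the subject is \<open>c\<close> applied to the list that
  forms the index.\<close>

lemma ent_funs_intro_aux:
  "ent (tup (\<sigma>s @ \<sigma>s')) (args (\<sigma>s @ \<sigma>s')) (inS \<tau> (apl c)) \<Longrightarrow>
    ent (tup \<sigma>s) (args \<sigma>s) (inS (funs \<sigma>s' \<tau>) (apl c))"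
proof (induction \<sigma>s' arbitrary: \<sigma>s)
  case (Cons \<sigma> \<sigma>s')
  let ?\<pi> = "\<lambda>p :: 'u list \<times> 'u. fst p @ [snd p]"
  let ?S = "tup \<sigma>s \<times> carr M \<sigma>" and ?X = "conjS (reindex fst (args \<sigma>s)) (inS \<sigma> snd)"
  have "ent (tup (\<sigma>s @ [\<sigma>])) (args (\<sigma>s @ [\<sigma>])) (inS (funs \<sigma>s' \<tau>) (apl c))"
    by (rule Cons.IH) (use Cons.prems in simp)
  then have "ent ?S (reindex ?\<pi> (args (\<sigma>s @ [\<sigma>]))) (reindex ?\<pi> (inS (funs \<sigma>s' \<tau>) (apl c)))"
    by (rule ent_reindex) (auto intro!: append_tup)
  \<comment> \<open>The longer list of hypotheses consists of those on the old entries and the one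
    on the new last entry.\<close>
  moreover have "ent ?S ?X (reindex ?\<pi> (args (\<sigma>s @ [\<sigma>])))"
  proof (rule ent_argsI)
    fix k assume k: "k < length (\<sigma>s @ [\<sigma>])"
    show "ent ?S ?X (inS ((\<sigma>s @ [\<sigma>]) ! k) (\<lambda>i. ?\<pi> i ! k))"
    proof (cases "k < length \<sigma>s")
      case True
      have "ent ?S ?X (inS (\<sigma>s ! k) (\<lambda>p. fst p ! k))"
        by (rule ent_trans[OF ent_conjD1 ent_reindex_args[OF True]])
      then show ?thesis
        using True by (auto simp: nth_append tup_length intro: ent_inS_cong)
    next
      case False
      then have "k = length \<sigma>s" using k by simp
      then show ?thesis
        by (auto simp: nth_append tup_length intro: ent_inS_cong[OF ent_conjD2])
    qed
  qed
  ultimately have "ent ?S ?X (inS (funs \<sigma>s' \<tau>) (\<lambda>p. app M (apl c (fst p)) (snd p)))"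
    using ent_trans by fastforce
  then show ?case
    unfolding funs_simps by (rule ent_fun_intro)
qed simp

text \<open>Reduces the claim on a constant to its value at a full list of guarded arguments, the
  form in which its computation rule applies.\<close>

lemma ent_funs_intro:
  assumes "ent (tup \<sigma>s) (args \<sigma>s) (inS \<tau> (apl c))"
  shows "ent UNIV trueS (inS (funs \<sigma>s \<tau>) (\<lambda>_. c))"
proof -
  have "ent (tup []) (args []) (inS (funs \<sigma>s \<tau>) (apl c))"
    by (rule ent_funs_intro_aux) (use assms in simp)
  from ent_reindex[OF this, of "\<lambda>_. []" UNIV] show ?thesis
    by (simp add: args_def)
qed

section \<open>Derivations for the constants of the source theory\<close>

lemma ent_num: "ent S X (inS NatT (\<lambda>_. num M n))"
proof -
  obtain h where "dfnl (ps X @ ns (inS NatT (\<lambda>_. num M n))) (map Star (ns X)) h"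
    using ex_dfnl by blast
  then show ?thesis
    by (intro entI[where f = "\<lambda>_. [num M n]" and g = h]) (simp_all add: dfnl_Cons dfn_num)
qed

lemma ent_boo: "ent S X (inS BoolT (\<lambda>_. boo M b))"
proof -
  obtain h where h: "dfnl (ps X @ ns (inS BoolT (\<lambda>_. boo M b))) (map Star (ns X)) h"
    using ex_dfnl by blast
  have "dfn \<Gamma> BoolT (\<lambda>_. boo M b)" for \<Gamma>
    using dfn_con[of TrueC BoolT \<Gamma>] dfn_con[of FalseC BoolT \<Gamma>] by (cases b) simp_all
  with h show ?thesis
    by (intro entI[where f = "\<lambda>_. [boo M b]" and g = h]) (simp_all add: dfnl_Cons)
qed

lemma ent_succ:
  assumes "ent S X (inS NatT x)"
  shows "ent S X (inS NatT (\<lambda>i. num M (Suc (nat_of M (x i)))))"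
proof (rule ent_trans[OF assms])
  have v: "dfn [NatT] NatT (\<lambda>v. v ! 0)" using dfn_var[of 0 "[NatT]"] by simp
  show "ent S (inS NatT x) (inS NatT (\<lambda>i. num M (Suc (nat_of M (x i)))))"
  proof (rule entI[where f = "\<lambda>v. [num M (Suc (nat_of M (v ! 0)))]" and g = "\<lambda>_. []"])
  qed (auto intro!: dfnl_Cons dfn_succ v simp: tup_Cons)
qed

lemma ent_PiC: "ent UNIV trueS (inS (con_ty (PiC \<sigma> \<tau>)) (\<lambda>_. con_val M (PiC \<sigma> \<tau>)))"
proof -
  have "ent (tup [\<sigma>, \<tau>]) (args [\<sigma>, \<tau>]) (inS \<sigma> (apl (con_val M (PiC \<sigma> \<tau>))))"
    by (rule ent_inS_cong[of _ _ _ "\<lambda>v. v ! 0"], use ent_args[of 0 "[\<sigma>, \<tau>]"] in simp)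
      (auto simp: tup_Cons app_PiC simp del: con_val.simps)
  from ent_funs_intro[OF this] show ?thesis by simp
qed

lemma ent_SigmaC: "ent UNIV trueS (inS (con_ty (SigmaC \<rho> \<sigma> \<tau>)) (\<lambda>_. con_val M (SigmaC \<rho> \<sigma> \<tau>)))"
proof -
  let ?\<Gamma> = "[\<rho> \<leadsto> \<sigma> \<leadsto> \<tau>, \<rho> \<leadsto> \<sigma>, \<rho>]"
  have v: "ent (tup ?\<Gamma>) (args ?\<Gamma>) (inS (\<rho> \<leadsto> \<sigma> \<leadsto> \<tau>) (\<lambda>v. v ! 0))"
    "ent (tup ?\<Gamma>) (args ?\<Gamma>) (inS (\<rho> \<leadsto> \<sigma>) (\<lambda>v. v ! 1))"
    "ent (tup ?\<Gamma>) (args ?\<Gamma>) (inS \<rho> (\<lambda>v. v ! 2))"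
    using ent_args[of 0 ?\<Gamma>] ent_args[of 1 ?\<Gamma>] ent_args[of 2 ?\<Gamma>] by simp_all
  have in3: "v ! 2 \<in> carr M \<rho>" "app M (v ! 1) (v ! 2) \<in> carr M \<sigma>" if "v \<in> tup ?\<Gamma>" for v
    using that by (auto simp: tup_Cons)
  have "ent (tup ?\<Gamma>) (args ?\<Gamma>) (inS \<tau> (\<lambda>v. app M (app M (v ! 0) (v ! 2)) (app M (v ! 1) (v ! 2))))"
    by (intro ent_fun_elim[where \<rho> = \<sigma>] ent_fun_elim[where \<rho> = \<rho>] v in3)
  then have "ent (tup ?\<Gamma>) (args ?\<Gamma>) (inS \<tau> (apl (con_val M (SigmaC \<rho> \<sigma> \<tau>))))"
    by (rule ent_inS_cong) (auto simp: tup_Cons app_SigmaC simp del: con_val.simps)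
  from ent_funs_intro[OF this] show ?thesis by simp
qed

lemma ent_SuccC: "ent UNIV trueS (inS (con_ty SuccC) (\<lambda>_. con_val M SuccC))"
proof -
  have "ent (tup [NatT]) (args [NatT]) (inS NatT (\<lambda>v. v ! 0))"
    using ent_args[of 0 "[NatT]"] by simp
  from ent_succ[OF this] have "ent (tup [NatT]) (args [NatT]) (inS NatT (apl (con_val M SuccC)))"
    by (rule ent_inS_cong) (auto simp: tup_Cons app_SuccC simp del: con_val.simps)
  from ent_funs_intro[OF this] show ?thesis by simp
qed

text \<open>Case distinction on a HOL Boolean in the index that selects the value;
  \<open>?\<pi>\<close> then takes this Boolean to be the one coded by the first argument.\<close>

lemma ent_CondC: "ent UNIV trueS (inS (con_ty (CondC \<sigma>)) (\<lambda>_. con_val M (CondC \<sigma>)))"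
proof -
  let ?\<Gamma> = "[BoolT, \<sigma>, \<sigma>]" and ?\<pi> = "\<lambda>v. (v, bool_of M (v ! 0))"
  let ?D = "inS \<sigma> (\<lambda>p. if snd p then fst p ! 2 else fst p ! 1)"
  have v: "ent S (args ?\<Gamma>) (inS BoolT (\<lambda>v. v ! 0))"
    "ent S (args ?\<Gamma>) (inS \<sigma> (\<lambda>v. v ! 1))"
    "ent S (args ?\<Gamma>) (inS \<sigma> (\<lambda>v. v ! 2))" for S
    using ent_args[of 0 ?\<Gamma>] ent_args[of 1 ?\<Gamma>] ent_args[of 2 ?\<Gamma>] by simp_all
  have "ent (tup ?\<Gamma> \<times> UNIV) (conjS (reindex fst (args ?\<Gamma>)) (inS BoolT (\<lambda>p. boo M (snd p)))) ?D"
    by (rule ent_bool_cases) (use v in simp_all)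
  moreover have "?\<pi> ` tup ?\<Gamma> \<subseteq> tup ?\<Gamma> \<times> UNIV" by auto
  ultimately have "ent (tup ?\<Gamma>) (reindex ?\<pi> (conjS (reindex fst (args ?\<Gamma>)) (inS BoolT (\<lambda>p. boo M (snd p)))))
      (reindex ?\<pi> ?D)"
    by (rule ent_reindex)
  then have *: "ent (tup ?\<Gamma>) (conjS (reindex (\<lambda>v. v) (args ?\<Gamma>)) (inS BoolT (\<lambda>v. boo M (bool_of M (v ! 0)))))
      (inS \<sigma> (\<lambda>v. if bool_of M (v ! 0) then v ! 2 else v ! 1))"
    unfolding reindex_simps fst_conv snd_conv .
  have "ent (tup ?\<Gamma>) (args ?\<Gamma>) (inS \<sigma> (\<lambda>v. if bool_of M (v ! 0) then v ! 2 else v ! 1))"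
  proof (rule ent_trans[OF ent_conjI *])
    show "ent (tup ?\<Gamma>) (args ?\<Gamma>) (reindex (\<lambda>v. v) (args ?\<Gamma>))" by (rule ent_mono) simp_all
    show "ent (tup ?\<Gamma>) (args ?\<Gamma>) (inS BoolT (\<lambda>v. boo M (bool_of M (v ! 0))))"
      by (rule ent_inS_cong[OF v(1)]) (auto simp: tup_Cons)
  qed
  then have "ent (tup ?\<Gamma>) (args ?\<Gamma>) (inS \<sigma> (apl (con_val M (CondC \<sigma>))))"
    by (rule ent_inS_cong) (auto simp: tup_Cons app_CondC simp del: con_val.simps)
  from ent_funs_intro[OF this] show ?thesis by simp
qed

text \<open>The guards of initial values and step functions form the side hypothesis
  \<open>?C\<close>. The induction runs over a HOL number in the index, and the single component
  \<open>i\<close> is projected only at the end.\<close>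

lemma ent_RecC:
  assumes i: "i < length \<sigma>s"
  shows "ent UNIV trueS (inS (con_ty (RecC i \<sigma>s)) (\<lambda>_. con_val M (RecC i \<sigma>s)))"
proof -
  let ?n = "length \<sigma>s" and ?F = "map (step_ty \<sigma>s) \<sigma>s"
  let ?S = "tup (\<sigma>s @ ?F)" and ?C = "args (\<sigma>s @ ?F)"
  let ?r = "\<lambda>p. rec_val M (take ?n (fst p)) (drop ?n (fst p)) (snd p)"
  let ?D = "bconj (map (\<lambda>j. inS (\<sigma>s ! j) (\<lambda>p. ?r p ! j)) [0..<?n])"
  have split: "take ?n v \<in> tup \<sigma>s" "drop ?n v \<in> tup ?F" if "v \<in> ?S" for v
    using take_tup[OF that] drop_tup[OF that] by simp_all
  have r_in: "rec_val M (take ?n v) (drop ?n v) k \<in> tup \<sigma>s" if "v \<in> ?S" for v k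
    using split[OF that] by (rule rec_val_in)
  have ind: "ent (?S \<times> UNIV) (conjS (reindex fst ?C) (inS NatT (\<lambda>p. num M (snd p)))) ?D"
  proof (rule ent_induct)
    have "ent ?S ?C (inS (\<sigma>s ! j) (\<lambda>v. take ?n v ! j))" if "j < ?n" for j
      using ent_args[of j "\<sigma>s @ ?F" ?S] that by (simp add: nth_append)
    then show "ent ?S ?C (reindex (\<lambda>i. (i, 0)) ?D)"
      by (auto intro!: ent_bconjI)
    let ?X = "conjS (reindex fst ?C) (conjS (inS NatT (\<lambda>p. num M (snd p))) ?D)"
    have step: "ent (?S \<times> UNIV) ?X (inS (\<sigma>s ! j) (\<lambda>p. ?r (fst p, Suc (snd p)) ! j))" if j: "j < ?n" for j
    proof -
      \<comment> \<open>Entry \<open>?n + j\<close> of the list is the \<open>j\<close>-th step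
        function. Its guard, applied to the guard of the number and to the hypotheses on all
        components of the previous value, gives the new \<open>j\<close>-th component.\<close>
      have f: "ent (?S \<times> UNIV) ?X (inS (funs (NatT # \<sigma>s) (\<sigma>s ! j)) (\<lambda>p. fst p ! (?n + j)))"
        using ent_trans[OF ent_conjD1 ent_reindex_args[of "?n + j" "\<sigma>s @ ?F"], of "?S \<times> UNIV"] j
        by (simp add: nth_append step_ty_def)
      have "ent (?S \<times> UNIV) ?X (inS (\<sigma>s ! j) (\<lambda>p. apl (fst p ! (?n + j)) (num M (snd p) # ?r p)))"
      proof (rule ent_funs_elim[OF f])
        show "num M (snd p) # ?r p \<in> tup (NatT # \<sigma>s)" if "p \<in> ?S \<times> UNIV" for p
          using that r_in by auto
        fix k assume k: "k < length (NatT # \<sigma>s)"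
        show "ent (?S \<times> UNIV) ?X (inS ((NatT # \<sigma>s) ! k) (\<lambda>p. (num M (snd p) # ?r p) ! k))"
        proof (cases k)
          case 0
          then show ?thesis
            using ent_trans[OF ent_conjD2 ent_conjD1] by fastforce
        next
          case (Suc k')
          have "ent (?S \<times> UNIV) ?D (inS (\<sigma>s ! k') (\<lambda>p. ?r p ! k'))"
            by (rule ent_bconjD) (use k Suc in auto)
          from ent_trans[OF ent_conjD2 ent_trans[OF ent_conjD2 this]] show ?thesis
            by (simp add: Suc)
        qed
      qed
      then show ?thesis
      proof (rule ent_inS_cong)
        fix p assume "p \<in> ?S \<times> (UNIV :: nat set)"
        then have "length (fst p) = ?n + ?n" by (auto dest: tup_length)
        then show "apl (fst p ! (?n + j)) (num M (snd p) # ?r p) = ?r (fst p, Suc (snd p)) ! j"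
          using j by simp
      qed
    qed
    show "ent (?S \<times> UNIV) ?X (reindex (\<lambda>p. (fst p, Suc (snd p))) ?D)"
      unfolding reindex_bconj by (rule ent_bconjI) (use step in auto)
  qed
  \<comment> \<open>The recursor takes the number first, so the arguments governed by
    \<open>?C\<close> are the tail of the list, and the number of the index is read from its
    head.\<close>
  let ?\<Gamma> = "NatT # \<sigma>s @ ?F" and ?\<pi> = "\<lambda>v. (tl v, nat_of M (hd v))"
  have "ent (tup ?\<Gamma>) (reindex ?\<pi> (conjS (reindex fst ?C) (inS NatT (\<lambda>p. num M (snd p))))) (reindex ?\<pi> ?D)"
    by (rule ent_reindex[OF ind]) (auto simp: tup_Cons)
  moreover have "ent (tup ?\<Gamma>) (args ?\<Gamma>)
      (reindex ?\<pi> (conjS (reindex fst ?C) (inS NatT (\<lambda>p. num M (snd p)))))"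
    unfolding reindex_simps
  proof (rule ent_conjI)
    show "ent (tup ?\<Gamma>) (args ?\<Gamma>) (reindex (\<lambda>v. fst (?\<pi> v)) ?C)"
    proof (rule ent_argsI)
      fix k assume k: "k < length (\<sigma>s @ ?F)"
      have "ent (tup ?\<Gamma>) (args ?\<Gamma>) (inS (?\<Gamma> ! Suc k) (\<lambda>v. v ! Suc k))"
        by (rule ent_args) (use k in simp)
      then show "ent (tup ?\<Gamma>) (args ?\<Gamma>) (inS ((\<sigma>s @ ?F) ! k) (\<lambda>v. fst (?\<pi> v) ! k))"
        unfolding nth_Cons_Suc by (rule ent_inS_cong) (auto simp: tup_Cons)
    qed
    have "ent (tup ?\<Gamma>) (args ?\<Gamma>) (inS NatT (\<lambda>v. v ! 0))"
      using ent_args[of 0 ?\<Gamma>] by simp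
    then show "ent (tup ?\<Gamma>) (args ?\<Gamma>) (inS NatT (\<lambda>v. num M (snd (?\<pi> v))))"
      by (rule ent_inS_cong) (auto simp: tup_Cons)
  qed
  moreover have "ent (tup ?\<Gamma>) (reindex ?\<pi> ?D) (reindex ?\<pi> (inS (\<sigma>s ! i) (\<lambda>p. ?r p ! i)))"
    unfolding reindex_bconj by (rule ent_bconjD) (use i in auto)
  ultimately have "ent (tup ?\<Gamma>) (args ?\<Gamma>) (reindex ?\<pi> (inS (\<sigma>s ! i) (\<lambda>p. ?r p ! i)))"
    by (blast intro: ent_trans)
  then have "ent (tup ?\<Gamma>) (args ?\<Gamma>) (inS (\<sigma>s ! i) (apl (con_val M (RecC i \<sigma>s))))"
    unfolding reindex_simps
  proof (rule ent_inS_cong)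
    fix v assume "v \<in> tup ?\<Gamma>"
    then obtain x w where v: "v = x # w" "x \<in> carr M NatT" "w \<in> ?S"
      unfolding tup_Cons by blast
    show "?r (?\<pi> v) ! i = apl (con_val M (RecC i \<sigma>s)) v"
      using apl_RecC[OF i split[OF v(3)] v(2)] by (simp add: v(1) del: con_val.simps foldl_append)
  qed
  from ent_funs_intro[OF this] show ?thesis by simp
qed

text \<open>The set constants drop out because their types contain a star, so that
  \<open>ha_con\<close> fails for them.\<close>

lemma ent_con:
  assumes "ha_con c"
  shows "ent UNIV trueS (inS (con_ty c) (\<lambda>_. con_val M c))"
proof (cases c)
  case (RecC i \<sigma>s)
  then have "i < length \<sigma>s" using assms by (simp add: ha_con_def)
  then show ?thesis unfolding RecC by (rule ent_RecC)
next
  case ZeroC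
  show ?thesis unfolding ZeroC con_ty.simps con_val.simps by (rule ent_num)
next
  case FalseC
  show ?thesis unfolding FalseC con_ty.simps con_val.simps by (rule ent_boo)
next
  case TrueC
  show ?thesis unfolding TrueC con_ty.simps con_val.simps by (rule ent_boo)
qed (use assms in \<open>auto simp: ha_con_def simp del: con_ty.simps con_val.simps
      intro: ent_PiC ent_SigmaC ent_SuccC ent_CondC\<close>, auto)

end

lemma has_ty_subst_var:
  "has_ty \<Gamma> t \<sigma> \<Longrightarrow> n < length (\<sigma> # \<Gamma>) \<Longrightarrow> has_ty \<Gamma> (case_nat t Var n) ((\<sigma> # \<Gamma>) ! n)"
  by (cases n) simp_all

lemma has_ty_RecC_apps:
  assumes "i < length \<sigma>s" "has_ty \<Gamma> t NatT" "list_all2 (has_ty \<Gamma>) us (\<sigma>s @ map (step_ty \<sigma>s) \<sigma>s)"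
  shows "has_ty \<Gamma> (apps (Con (RecC i \<sigma>s)) (t # us)) (\<sigma>s ! i)"
  by (rule has_ty_apps[of _ _ "NatT # \<sigma>s @ map (step_ty \<sigma>s) \<sigma>s"]) (use assms in \<open>simp_all add: funs_def\<close>)

lemma wf_fm_ha_axiom: "ha_axiom \<Gamma> A \<Longrightarrow> wf_fm \<Gamma> A"
proof (induction rule: ha_axiom.induct)
  case (eq_subst \<sigma> \<Gamma> D)
  then have D: "wf_fm (\<sigma> # \<Gamma>) D" by (simp add: ha_fm_def)
  have "wf_fm (\<sigma> # \<sigma> # \<Gamma>) (fsub (case_nat (Var 0) (\<lambda>n. Var (n + 2))) D)"
    "wf_fm (\<sigma> # \<sigma> # \<Gamma>) (fsub (case_nat (Var 1) (\<lambda>n. Var (n + 2))) D)"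
    by (rule wf_fm_fsub[OF D], simp add: nth_Cons split: nat.split)+
  then show ?case by simp
next
  case (rec_zero i \<sigma>s)
  let ?\<Gamma> = "\<sigma>s @ map (step_ty \<sigma>s) \<sigma>s"
  have "list_all2 (has_ty ?\<Gamma>) (vars (2 * length \<sigma>s)) ?\<Gamma>"
    using has_ty_vars[of ?\<Gamma> "[]"] by (simp add: mult_2)
  then have "has_ty ?\<Gamma> (apps (Con (RecC i \<sigma>s)) (Con ZeroC # vars (2 * length \<sigma>s))) (\<sigma>s ! i)"
    using rec_zero by (intro has_ty_RecC_apps) simp_all
  moreover have "has_ty ?\<Gamma> (Var i) (\<sigma>s ! i)"
    using rec_zero by (simp add: nth_append)
  ultimately show ?case by (simp only: wf_fm.simps)
next
  case (rec_succ i \<sigma>s ws)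
  let ?\<Gamma> = "\<sigma>s @ map (step_ty \<sigma>s) \<sigma>s"
  have ws: "list_all2 (has_ty (NatT # ?\<Gamma>)) ws ?\<Gamma>"
    using rec_succ by (simp add: list_all2_conv_all_nth nth_append mult_2 del: upt_Suc)
  have "has_ty (NatT # ?\<Gamma>) (apps (Con (RecC i \<sigma>s)) (App (Con SuccC) (Var 0) # ws)) (\<sigma>s ! i)"
    using rec_succ ws by (intro has_ty_RecC_apps) simp_all
  moreover have "list_all2 (has_ty (NatT # ?\<Gamma>))
      (map (\<lambda>j. apps (Con (RecC j \<sigma>s)) (Var 0 # ws)) [0..<length \<sigma>s]) \<sigma>s"
    using ws unfolding list_all2_conv_all_nth[of _ _ \<sigma>s]
    by (auto simp del: foldl_Cons intro!: has_ty_RecC_apps)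
  then have "has_ty (NatT # ?\<Gamma>) (apps (Var (1 + length \<sigma>s + i))
      (Var 0 # map (\<lambda>j. apps (Con (RecC j \<sigma>s)) (Var 0 # ws)) [0..<length \<sigma>s])) (\<sigma>s ! i)"
    using rec_succ
    by (intro has_ty_apps[of _ _ "NatT # \<sigma>s"]) (simp_all add: nth_append step_ty_def funs_def del: foldl_Cons)
  ultimately show ?case by (simp only: wf_fm.simps)
next
  case (bool_cases \<Gamma> D)
  then have D: "wf_fm (BoolT # \<Gamma>) D" by (simp add: ha_fm_def)
  have "wf_fm \<Gamma> (fsub (case_nat (Con FalseC) Var) D)" "wf_fm \<Gamma> (fsub (case_nat (Con TrueC) Var) D)"
    by (rule wf_fm_fsub[OF D has_ty_subst_var], simp_all)+
  with D show ?case by simp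
next
  case (induction \<Gamma> D)
  then have D: "wf_fm (NatT # \<Gamma>) D" by (simp add: ha_fm_def)
  have "wf_fm \<Gamma> (fsub (case_nat (Con ZeroC) Var) D)"
    by (rule wf_fm_fsub[OF D has_ty_subst_var], simp_all)
  moreover have "wf_fm (NatT # \<Gamma>) (fsub (case_nat (App (Con SuccC) (Var 0)) (\<lambda>n. Var (n + 1))) D)"
    by (rule wf_fm_fsub[OF D], simp add: nth_Cons split: nat.split)
  ultimately show ?case using D by simp
qed auto

context omega_star
begin

lemma envs_map:
  assumes "e \<in> envs (\<Gamma> @ \<Delta>)"
  shows "map e [0..<length \<Gamma>] \<in> tup \<Gamma>" "map e [length \<Gamma>..<length \<Gamma> + length \<Delta>] \<in> tup \<Delta>"
proof -
  have "e n \<in> carr M (\<Gamma> ! n)" if "n < length \<Gamma>" for n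
    using envs_nth[OF assms, of n] that by (simp add: nth_append)
  then show "map e [0..<length \<Gamma>] \<in> tup \<Gamma>" by (simp add: tup_iff)
  have "e (length \<Gamma> + n) \<in> carr M (\<Delta> ! n)" if "n < length \<Delta>" for n
    using envs_nth[OF assms, of "length \<Gamma> + n"] that by simp
  then show "map e [length \<Gamma>..<length \<Gamma> + length \<Delta>] \<in> tup \<Delta>" by (simp add: tup_iff)
qed

text \<open>Witnesses occur only in \<open>eq_subst\<close>, \<open>bool_cases\<close> and
  \<open>induction\<close>, namely those of \<open>D\<close>. The other axioms are equations or
  implications between atomic formulas and reduce to truth by \<open>ent_true\<close>.\<close>

lemma ent_ha_axiom:
  assumes "ha_axiom \<Gamma> A"
  shows "ent (envs \<Gamma>) trueS (sem (relat A))"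
  using assms
proof (induction rule: ha_axiom.induct)
  case (eq_subst \<sigma> \<Gamma> D)
  show ?case
    unfolding relat.simps relat_fsub sem.simps sem_fsub
  \<comment> \<open>Once entries 0 and 1 of the environment agree, both substitutions evaluate
    \<open>D\<close> in the same environment, so witnesses and challenges are passed on
    unchanged.\<close>
  proof (rule ent_impI, rule ent_mono)
    fix e a d
    let ?s = "\<lambda>x :: nat. case_nat (Var x) (\<lambda>n. Var (n + 2))"
    assume "rl (conjS trueS (conjS (pureS (\<lambda>e. tm_val M e (Var 0) = tm_val M e (Var 1)))
      (reindex (\<lambda>e n. tm_val M e (?s 0 n)) (sem (relat D))))) e a d"
    then have eq: "e 0 = e 1" and r: "rl (sem (relat D)) (\<lambda>n. tm_val M e (?s 0 n)) a d"
      by (simp_all add: conjS_def)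
    have "(\<lambda>n. tm_val M e (?s 0 n)) = (\<lambda>n. tm_val M e (?s 1 n))"
      using eq by (auto simp: fun_eq_iff split: nat.split)
    then show "rl (reindex (\<lambda>e n. tm_val M e (?s 1 n)) (sem (relat D))) e a d"
      using r by simp
  qed simp_all
next
  case (rec_zero i \<sigma>s)
  let ?n = "length \<sigma>s" and ?F = "map (step_ty \<sigma>s) \<sigma>s"
  show ?case
  proof (rule ent_true)
    fix e d assume "e \<in> envs (\<sigma>s @ ?F)"
    from envs_map[OF this] have in_tup: "map e [0..<?n] \<in> tup \<sigma>s" "map e [?n..<2 * ?n] \<in> tup ?F"
      by (simp_all add: mult_2)
    have "[0..<2 * ?n] = [0..<?n] @ [?n..<2 * ?n]"
      by (metis le_add2 mult_2 upt_add_eq_append zero_le)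
    then have "tm_val M e (apps (Con (RecC i \<sigma>s)) (Con ZeroC # vars (2 * ?n))) =
        apl (con_val M (RecC i \<sigma>s)) (num M 0 # map e [0..<?n] @ map e [?n..<2 * ?n])"
      by (simp add: tm_val_apps comp_def del: con_val.simps(5) foldl_append)
    also have "\<dots> = e i"
      using rec_zero apl_RecC[OF rec_zero(1) in_tup num_in] by (simp del: con_val.simps foldl_append)
    finally show "rl (sem (relat (Eq (\<sigma>s ! i)
        (apps (Con (RecC i \<sigma>s)) (Con ZeroC # vars (2 * ?n))) (Var i)))) e [] d"
      by (simp only: relat.simps sem.simps pureS_sel tm_val.simps(1))
  qed simp
next
  case (rec_succ i \<sigma>s ws)
  let ?n = "length \<sigma>s" and ?F = "map (step_ty \<sigma>s) \<sigma>s"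
  show ?case
  proof (rule ent_true)
    fix e d assume e: "e \<in> envs (NatT # \<sigma>s @ ?F)"
    then have "(\<lambda>n. e (Suc n)) \<in> envs (\<sigma>s @ ?F)" by (fastforce simp: envs_def)
    note in_tup = envs_map[OF this]
    \<comment> \<open>Variable 0 holds the number, hence the initial values start at 1 and the step
      functions at \<open>1 + ?n\<close>.\<close>
    define w f where "w = map e [1..<1 + ?n]" and "f = map e [1 + ?n..<1 + 2 * ?n]"
    have "w = map (\<lambda>n. e (Suc n)) [0..<?n]" "f = map (\<lambda>n. e (Suc n)) [?n..<?n + ?n]"
      unfolding w_def f_def by (auto intro: nth_equalityI simp del: upt_Suc)
    then have w: "w \<in> tup \<sigma>s" and f: "f \<in> tup ?F" using in_tup by simp_all
    have e0: "e 0 \<in> carr M NatT" using e by (auto simp: envs_def)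
    have "[1..<1 + 2 * ?n] = [1..<1 + ?n] @ [1 + ?n..<1 + 2 * ?n]"
      using upt_add_eq_append[of 1 "1 + ?n" ?n] by (simp add: mult_2 del: upt_Suc)
    then have ws: "map (tm_val M e) ws = w @ f"
      by (simp add: rec_succ(3) w_def f_def comp_def del: upt_Suc)
    have rec: "apl (con_val M (RecC j \<sigma>s)) (x # w @ f) = rec_val M w f (nat_of M x) ! j"
      if "j < ?n" "x \<in> carr M NatT" for j x
      using apl_RecC[OF that(1) w f that(2)] .
    let ?r = "rec_val M w f (nat_of M (e 0))"
    have "tm_val M e (apps (Con (RecC i \<sigma>s)) (App (Con SuccC) (Var 0) # ws)) =
        apl (con_val M (RecC i \<sigma>s)) (app M (con_val M SuccC) (e 0) # w @ f)"
      unfolding tm_val_apps list.map ws by simp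
    also have "\<dots> = rec_val M w f (Suc (nat_of M (e 0))) ! i"
      using e0 app_SuccC[OF e0] rec[OF rec_succ(1), of "num M (Suc (nat_of M (e 0)))"]
      by (simp del: con_val.simps foldl_Cons rec_val.simps)
    also have "\<dots> = apl (e (1 + ?n + i)) (e 0 # ?r)"
      using rec_succ(1) e0 by (simp add: f_def del: upt_Suc)
    also have "\<dots> = tm_val M e (apps (Var (1 + ?n + i))
        (Var 0 # map (\<lambda>j. apps (Con (RecC j \<sigma>s)) (Var 0 # ws)) [0..<?n]))"
    proof -
      have "map (\<lambda>j. apl (con_val M (RecC j \<sigma>s)) (e 0 # w @ f)) [0..<?n] = ?r"
        using tup_length[OF rec_val_in[OF w f]] rec e0
        by (intro nth_equalityI) (simp_all del: con_val.simps foldl_Cons)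
      then show ?thesis
        unfolding tm_val_apps list.map map_map comp_def ws tm_val.simps by (simp only:)
    qed
    finally show "rl (sem (relat (Eq (\<sigma>s ! i) (apps (Con (RecC i \<sigma>s)) (App (Con SuccC) (Var 0) # ws))
        (apps (Var (1 + ?n + i))
          (Var 0 # map (\<lambda>j. apps (Con (RecC j \<sigma>s)) (Var 0 # ws)) [0..<?n]))))) e [] d"
      by (simp only: relat.simps sem.simps pureS_sel)
  qed simp
next
  case (bool_cases \<Gamma> D)
  let ?D = "sem (relat D)"
  let ?P = "conjS (reindex (case_nat (boo M False)) ?D) (reindex (case_nat (boo M True)) ?D)"
  \<comment> \<open>\<open>D\<close> with its bound variable replaced by a HOL Boolean in the index,
    the form that \<open>ent_bool_cases\<close> expects.\<close>
  let ?D' = "reindex (\<lambda>p. case_nat (boo M (snd p)) (fst p)) ?D"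
  let ?S = "envs \<Gamma>" and ?\<pi> = "\<lambda>p. (fst p, bool_of M (snd p))"
  have *: "ent (?S \<times> UNIV) (conjS (reindex fst ?P) (inS BoolT (\<lambda>p. boo M (snd p)))) ?D'"
  proof (rule ent_bool_cases)
    show "ent ?S ?P (reindex (\<lambda>i. (i, False)) ?D')" "ent ?S ?P (reindex (\<lambda>i. (i, True)) ?D')"
      using ent_conjD1[of ?S "reindex (case_nat (boo M False)) ?D"]
        ent_conjD2[of ?S "reindex (case_nat (boo M False)) ?D"] by simp_all
  qed
  \<comment> \<open>Return from HOL Booleans to elements of the carrier: reindexing decodes the
    element, and coding it again gives the element back.\<close>
  have "ent (?S \<times> carr M BoolT) (reindex ?\<pi> (conjS (reindex fst ?P) (inS BoolT (\<lambda>p. boo M (snd p)))))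
      (reindex ?\<pi> ?D')"
    by (rule ent_reindex[OF *]) auto
  moreover have "ent (?S \<times> carr M BoolT) (conjS (reindex fst ?P) (inS BoolT snd))
      (reindex ?\<pi> (conjS (reindex fst ?P) (inS BoolT (\<lambda>p. boo M (snd p)))))"
    by (rule ent_mono) (auto simp: conjS_def)
  moreover have "ent (?S \<times> carr M BoolT) (reindex ?\<pi> ?D') (reindex push ?D)"
    by (rule ent_mono) auto
  ultimately have "ent (?S \<times> carr M BoolT) (conjS (reindex fst ?P) (inS BoolT snd)) (reindex push ?D)"
    by (blast intro: ent_trans)
  then have concl: "ent ?S ?P (sem (relat (All BoolT D)))"
    by (auto intro!: ent_allI ent_impI)
  have prem: "sem (relat (And (fsub (case_nat (Con FalseC) Var) D) (fsub (case_nat (Con TrueC) Var) D))) = ?P"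
  proof -
    have "(\<lambda>e n. tm_val M e (case_nat (Con FalseC) Var n)) = case_nat (boo M False)"
      "(\<lambda>e n. tm_val M e (case_nat (Con TrueC) Var n)) = case_nat (boo M True)"
      by (auto simp: fun_eq_iff split: nat.split)
    then show ?thesis by (simp add: relat_fsub sem_fsub)
  qed
  show ?case
    unfolding relat.simps(5) sem.simps(5) prem by (rule ent_impI, rule ent_trans[OF ent_conjD2 concl])
next
  case (induction \<Gamma> D)
  let ?D = "sem (relat D)" and ?S = "envs \<Gamma>"
  let ?z = "case_nat (num M 0) :: (nat \<Rightarrow> 'u) \<Rightarrow> nat \<Rightarrow> 'u"
  \<comment> \<open>The effect of the successor substitution on an environment: entry 0, the
    induction variable, is replaced by its successor.\<close>
  let ?s = "\<lambda>e :: nat \<Rightarrow> 'u. case_nat (app M (con_val M SuccC) (e 0)) (\<lambda>n. e (Suc n))"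
  let ?A = "allS NatT (reindex push (impS (inS NatT (\<lambda>e. e 0)) (impS ?D (reindex ?s ?D))))"
  let ?P = "conjS (reindex ?z ?D) ?A"
  let ?D' = "reindex (\<lambda>p. case_nat (num M (snd p)) (fst p)) ?D"
  let ?N = "inS NatT (\<lambda>p. num M (snd p))"
  let ?\<pi> = "\<lambda>p. (fst p, nat_of M (snd p))"
  have *: "ent (?S \<times> UNIV) (conjS (reindex fst ?P) ?N) ?D'"
  proof (rule ent_induct)
    show "ent ?S ?P (reindex (\<lambda>i. (i, 0)) ?D')"
      using ent_conjD1[of ?S "reindex ?z ?D"] by simp
    let ?X = "conjS (reindex fst ?P) (conjS ?N ?D')" and ?T = "?S \<times> (UNIV :: nat set)"
    \<comment> \<open>What the step may use: the premises of the axiom, the guard of the number, and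
      \<open>D\<close> at that number.\<close>
    have XP: "ent ?T ?X (reindex fst ?P)" and XN: "ent ?T ?X ?N" and XD: "ent ?T ?X ?D'"
      by (rule ent_conjD1 ent_trans[OF ent_conjD2 ent_conjD1] ent_trans[OF ent_conjD2 ent_conjD2])+
    have "ent ?T (reindex fst ?P) (reindex fst ?A)"
      by (rule ent_reindex[OF ent_conjD2]) auto
    from ent_trans[OF XP this] have "ent ?T ?X (allS NatT (reindex (\<lambda>p. (fst (fst p), snd p))
        (reindex push (impS (inS NatT (\<lambda>e. e 0)) (impS ?D (reindex ?s ?D))))))"
      by (simp only: reindex_simps)
    \<comment> \<open>The guarded step of the axiom is instantiated at the numeral of the index; two
      uses of modus ponens then discharge the guard and \<open>D\<close> at this numeral.\<close>
    from ent_all_elim[OF this, of "\<lambda>p. num M (snd p)"]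
    have "ent ?T ?X (impS ?N (impS ?D' (reindex (\<lambda>p. ?s (case_nat (num M (snd p)) (fst p))) ?D)))"
      by simp
    from ent_mp[OF ent_mp[OF this XN] XD]
    show "ent ?T ?X (reindex (\<lambda>p. (fst p, Suc (snd p))) ?D')"
      by (simp add: app_SuccC del: con_val.simps)
  qed
  \<comment> \<open>Return from HOL numbers to elements of \<open>carr M NatT\<close>, by decoding
    as for the Booleans.\<close>
  have "ent (?S \<times> carr M NatT) (reindex ?\<pi> (conjS (reindex fst ?P) ?N)) (reindex ?\<pi> ?D')"
    by (rule ent_reindex[OF *]) auto
  moreover have "ent (?S \<times> carr M NatT) (conjS (reindex fst ?P) (inS NatT snd))
      (reindex ?\<pi> (conjS (reindex fst ?P) ?N))"
    by (rule ent_mono) (auto simp: conjS_def)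
  moreover have "ent (?S \<times> carr M NatT) (reindex ?\<pi> ?D') (reindex push ?D)"
    by (rule ent_mono) auto
  ultimately have "ent (?S \<times> carr M NatT) (conjS (reindex fst ?P) (inS NatT snd)) (reindex push ?D)"
    by (blast intro: ent_trans)
  then have concl: "ent ?S ?P (sem (relat (All NatT D)))"
    by (auto intro!: ent_allI ent_impI)
  have prem: "sem (relat (And (fsub (case_nat (Con ZeroC) Var) D)
      (All NatT (Imp D (fsub (case_nat (App (Con SuccC) (Var 0)) (\<lambda>n. Var (n + 1))) D))))) = ?P"
  proof -
    have "(\<lambda>n. tm_val M e (case_nat (Con ZeroC) Var n)) = ?z e"
      "(\<lambda>n. tm_val M e (case_nat (App (Con SuccC) (Var 0)) (\<lambda>n. Var (Suc n)) n)) = ?s e" for e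
      by (auto simp: fun_eq_iff split: nat.split)
    then show ?thesis by (simp add: relat_fsub sem_fsub)
  qed
  show ?case
    unfolding relat.simps(5) sem.simps(5) prem by (rule ent_impI, rule ent_trans[OF ent_conjD2 concl])
next
  case (pi \<sigma> \<tau>)
  show ?case
  proof (rule ent_true)
    fix e d assume e: "e \<in> envs [\<sigma>, \<tau>]"
    have "e 0 \<in> carr M \<sigma>" "e 1 \<in> carr M \<tau>"
      using envs_nth[OF e, of 0] envs_nth[OF e, of 1] by simp_all
    then show "rl (sem (relat (Eq \<sigma> (apps (Con (PiC \<sigma> \<tau>)) [Var 0, Var 1]) (Var 0)))) e [] d"
      unfolding relat.simps sem.simps pureS_sel foldl.simps tm_val.simps by (rule app_PiC)
  qed simp
next
  case (sigma \<rho> \<sigma> \<tau>)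
  show ?case
  proof (rule ent_true)
    fix e d assume e: "e \<in> envs [\<rho> \<leadsto> \<sigma> \<leadsto> \<tau>, \<rho> \<leadsto> \<sigma>, \<rho>]"
    show "rl (sem (relat (Eq \<tau> (apps (Con (SigmaC \<rho> \<sigma> \<tau>)) [Var 0, Var 1, Var 2])
        (apps (Var 0) [Var 2, App (Var 1) (Var 2)])))) e [] d"
      using envs_nth[OF e, of 0] envs_nth[OF e, of 1] envs_nth[OF e, of 2]
      by (simp add: app_SigmaC del: con_val.simps)
  qed simp
next
  case succ_inj
  show ?case
  proof (rule ent_true)
    fix e d assume e: "e \<in> envs [NatT, NatT]"
    have e01: "e 0 \<in> carr M NatT" "e 1 \<in> carr M NatT"
      using envs_nth[OF e, of 0] envs_nth[OF e, of 1] by simp_all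
    have "e 0 = e 1" if "nat_of M (e 0) = nat_of M (e 1)"
      using num_nat_of[OF e01(1), symmetric] num_nat_of[OF e01(2)] unfolding that by (rule trans)
    with e01 show "rl (sem (relat (Imp (Eq NatT (App (Con SuccC) (Var 0)) (App (Con SuccC) (Var 1)))
            (Eq NatT (Var 0) (Var 1))))) e [] d"
      by (simp add: impS_def app_SuccC del: con_val.simps)
  qed (simp add: imp_pos_def)
next
  case succ_not_zero
  show ?case
    by (rule ent_true) (auto simp: impS_def imp_pos_def envs_def app_SuccC simp del: con_val.simps(4))
next
  case (cond_false \<sigma>)
  show ?case
  proof (rule ent_true)
    fix e d assume e: "e \<in> envs [\<sigma>, \<sigma>]"
    show "rl (sem (relat (Eq \<sigma> (apps (Con (CondC \<sigma>)) [Con FalseC, Var 0, Var 1]) (Var 0)))) e [] d"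
      using envs_nth[OF e, of 0] envs_nth[OF e, of 1] by (simp add: app_CondC del: con_val.simps(8))
  qed simp
next
  case (cond_true \<sigma>)
  show ?case
  proof (rule ent_true)
    fix e d assume e: "e \<in> envs [\<sigma>, \<sigma>]"
    show "rl (sem (relat (Eq \<sigma> (apps (Con (CondC \<sigma>)) [Con TrueC, Var 0, Var 1]) (Var 1)))) e [] d"
      using envs_nth[OF e, of 0] envs_nth[OF e, of 1] by (simp add: app_CondC del: con_val.simps(8))
  qed simp
next
  case (eq_refl \<sigma>)
  show ?case by (rule ent_true) simp_all
next
  case bool_distinct
  show ?case by (rule ent_true) (simp_all add: impS_def imp_pos_def)
qed

text \<open>After the quantifiers and the implication are introduced this is
  \<open>ent_fun_elim\<close>; its two premises are projections from the conjunction, which stands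
  behind the hypothesis \<open>trueS\<close>.\<close>

lemma ent_application:
  "ent UNIV trueS (sem (All \<sigma> (All (\<sigma> \<leadsto> \<tau>)
    (Imp (And (Pred \<sigma> (Var 1)) (Pred (\<sigma> \<leadsto> \<tau>) (Var 0))) (Pred \<tau> (App (Var 0) (Var 1)))))))"
  by (auto intro!: ent_allI ent_impI ent_fun_elim[where \<rho> = \<sigma>]
      intro: ent_trans[OF ent_conjD2 ent_conjD1] ent_trans[OF ent_conjD2 ent_conjD2])

end

theorem theorem7p5:
  fixes M :: "'u struc"
  assumes "is_S_omega_star M"
  shows "sound_type_informative_base M cp_base"
proof -
  interpret omega_star M by standard (rule assms)
  show ?thesis
    unfolding sound_type_informative_base_def is_base_interp_def
  proof (intro conjI allI impI)
    show "target_fm (\<sigma> # bpos cp_base \<sigma> @ bneg cp_base \<sigma>) (brel cp_base \<sigma>)" for \<sigma>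
      using target_fm_brel by simp
    show "U_interpretable M cp_base [] (Pred (con_ty c) (Con c))" if "ha_con c" for c
      by (rule U_interpretableI) (use ent_con[OF that] that in \<open>simp_all add: ha_con_def\<close>)
    show "U_interpretable M cp_base [] (All \<sigma> (All (\<sigma> \<leadsto> \<tau>)
        (Imp (And (Pred \<sigma> (Var 1)) (Pred (\<sigma> \<leadsto> \<tau>) (Var 0))) (Pred \<tau> (App (Var 0) (Var 1))))))"
      for \<sigma> \<tau>
      by (rule U_interpretableI[OF _ ent_application]) simp
    show "I_interpretable M cp_base \<Gamma> A" if "ha_axiom \<Gamma> A" for \<Gamma> A
      using that by (intro I_interpretableI wf_fm_ha_axiom ent_ha_axiom)
  qed
qed

end
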